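(* Let $m>1$ be an integer, let $\ell$ be an odd integer, and let $K$ be the finite $2$-group defined in the context. We have the following series of normal subgroups of $\mathrm{Aut}(K)$: $$1\subset\mathrm{Aut}_1(K)\subset\mathrm{Aut}_2(K)\subset\mathrm{Aut}(K),$$ where $\mathrm{Aut}_1(K)\cong (\mathbb{Z}/2^{m-1}\mathbb{Z})^4$, $\mathrm{Aut}_2(K)/\mathrm{Aut}_1(K)\cong (\mathbb{Z}/2^{m-1}\mathbb{Z})^2\times (\mathbb{Z}/2\mathbb{Z})^4$, and: if $m>2$, then $$\mathrm{Aut}(K)/\mathrm{Aut}_2(K)\cong \big((\mathbb{Z}/2^{m-1}\mathbb{Z})^\times \times (\mathbb{Z}/2\mathbb{Z})^2\big)\rtimes \mathbb{Z}/2\mathbb{Z},$$ with $\mathbb{Z}/2\mathbb{Z}$ acting by inversion on $(\mathbb{Z}/2^{m-1}\mathbb{Z})^\times$ and by switching the factors of $(\mathbb{Z}/2\mathbb{Z})^2$; while if $m=2$, then $\mathrm{Aut}(K)/\mathrm{Aut}_2(K)\cong\mathrm{GL}_2(\mathbb{Z}/2\mathbb{Z})$.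
   Context: Notation: $[a,b]=a^{-1}b^{-1}ab$, $b^a=a^{-1}ba$, $\alpha=1+2^m\ell$. Let $$J=\langle A,B\mid A^{[A,B]}=A^{\alpha},\ B^{[B,A]}=B^{\alpha},\ A^{2^{3m-1}}=B^{2^{3m-1}}=1\rangle$$ and $K=J/Z_2(J)$, which has the presentation $$K=\langle a,b\mid a^{[a,b]}=a^{\alpha},\ b^{[b,a]}=b^{\alpha},\ a^{2^{2m-1}}=b^{2^{2m-1}}=[a,b]^{2^{m-1}}=1\rangle.$$ For a group $T$, $Z_0(T)=1, Z_1(T),Z_2(T),\dots$ denotes the upper central series, and $\mathrm{Aut}_i(T)$ is the kernel of the canonical map $\mathrm{Aut}(T)\to\mathrm{Aut}(T/Z_i(T))$. *)

theory Defs
  imports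
    "HOL-Algebra.Bij"
    "HOL-Algebra.Elementary_Groups"
    "HOL-Number_Theory.Residues"
    "HOL-Library.Z2"
    "HOL-Analysis.Cartesian_Space"
begin

section \<open>Groups given by generators and relations\<close>

text \<open>The letter \<open>(x, True)\<close> stands for the generator \<open>x\<close> and \<open>(x, False)\<close> for its inverse.\<close>

type_synonym 'g word = "('g \<times> bool) list"

definition winv :: "'g word \<Rightarrow> 'g word" where
  "winv w = rev (map (\<lambda>(x, e). (x, \<not> e)) w)"

definition wpow :: "'g word \<Rightarrow> int \<Rightarrow> 'g word" where
  "wpow w k = concat (replicate (nat \<bar>k\<bar>) (if k \<ge> 0 then w else winv w))"

text \<open>\<open>[u,v] = u\<inverse>v\<inverse>uv\<close> and \<open>u\<^sup>v = v\<inverse>uv\<close>.\<close>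

definition wcomm :: "'g word \<Rightarrow> 'g word \<Rightarrow> 'g word" where
  "wcomm u v = winv u @ winv v @ u @ v"

definition wconj :: "'g word \<Rightarrow> 'g word \<Rightarrow> 'g word" where
  "wconj u v = winv v @ u @ v"

text \<open>A pair \<open>(u, v) \<in> R\<close> is the relation \<open>u = v\<close>. Every element of the type \<open>'g\<close> is a generator.\<close>

inductive word_eq :: "('g word \<times> 'g word) set \<Rightarrow> 'g word \<Rightarrow> 'g word \<Rightarrow> bool"
  for R :: "('g word \<times> 'g word) set" where
  word_eq_refl: "word_eq R u u"
| word_eq_sym: "word_eq R u v \<Longrightarrow> word_eq R v u"
| word_eq_trans: "word_eq R u v \<Longrightarrow> word_eq R v w \<Longrightarrow> word_eq R u w"
| word_eq_append: "word_eq R u v \<Longrightarrow> word_eq R u' v' \<Longrightarrow> word_eq R (u @ u') (v @ v')"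
| word_eq_cancel: "word_eq R [(x, e), (x, \<not> e)] []"
| word_eq_rel: "(u, v) \<in> R \<Longrightarrow> word_eq R u v"

definition word_class :: "('g word \<times> 'g word) set \<Rightarrow> 'g word \<Rightarrow> 'g word set" where
  "word_class R u = {v. word_eq R u v}"

definition presented_group :: "('g word \<times> 'g word) set \<Rightarrow> 'g word set monoid" where
  "presented_group R =
    \<lparr>carrier = range (word_class R),
     monoid.mult = (\<lambda>U V. {w. \<exists>u\<in>U. \<exists>v\<in>V. word_eq R (u @ v) w}),
     one = word_class R []\<rparr>"

lemma word_class_eq_iff: "word_class R u = word_class R v \<longleftrightarrow> word_eq R u v"
  unfolding word_class_def
  by (blast intro: word_eq_refl word_eq_sym word_eq_trans)

lemma presented_group_mult:
  "word_class R u \<otimes>\<^bsub>presented_group R\<^esub> word_class R v = word_class R (u @ v)"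
  unfolding presented_group_def word_class_def
  by (auto intro: word_eq_refl word_eq_sym word_eq_trans word_eq_append)

lemma word_eq_winv: "word_eq R (winv w @ w) []"
proof (induction w)
  case Nil
  show ?case by (simp add: winv_def word_eq_refl)
next
  case (Cons l w)
  obtain x e where l: "l = (x, e)" by fastforce
  have "word_eq R ([(x, \<not> e), (x, e)] @ w) ([] @ w)"
    using word_eq_cancel[of R x "\<not> e"] by (intro word_eq_append) (auto intro: word_eq_refl)
  then have "word_eq R (winv w @ [(x, \<not> e), (x, e)] @ w) (winv w @ w)"
    by (intro word_eq_append) (auto intro: word_eq_refl)
  then show ?case
    using Cons.IH by (auto simp: winv_def l intro: word_eq_trans)
qed

lemma group_presented_group: "group (presented_group R)"
proof (rule groupI)
  have carr: "carrier (presented_group R) = range (word_class R)"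
    and one: "\<one>\<^bsub>presented_group R\<^esub> = word_class R []"
    by (simp_all add: presented_group_def)
  show "\<one>\<^bsub>presented_group R\<^esub> \<in> carrier (presented_group R)"
    by (simp add: carr one)
  fix x assume x: "x \<in> carrier (presented_group R)"
  then obtain u where u: "x = word_class R u" by (auto simp: carr)
  show "\<one>\<^bsub>presented_group R\<^esub> \<otimes>\<^bsub>presented_group R\<^esub> x = x"
    by (simp add: u one presented_group_mult)
  show "\<exists>y\<in>carrier (presented_group R). y \<otimes>\<^bsub>presented_group R\<^esub> x = \<one>\<^bsub>presented_group R\<^esub>"
    by (rule bexI[of _ "word_class R (winv u)"])
      (auto simp: carr one u presented_group_mult word_class_eq_iff word_eq_winv)
  fix y assume y: "y \<in> carrier (presented_group R)"
  then obtain v where v: "y = word_class R v" by (auto simp: carr)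
  show "x \<otimes>\<^bsub>presented_group R\<^esub> y \<in> carrier (presented_group R)"
    by (simp add: carr u v presented_group_mult)
  fix z assume "z \<in> carrier (presented_group R)"
  then obtain w where w: "z = word_class R w" by (auto simp: carr)
  show "x \<otimes>\<^bsub>presented_group R\<^esub> y \<otimes>\<^bsub>presented_group R\<^esub> z
      = x \<otimes>\<^bsub>presented_group R\<^esub> (y \<otimes>\<^bsub>presented_group R\<^esub> z)"
    by (simp add: u v w presented_group_mult)
qed


section \<open>The group \<open>K\<close>\<close>

datatype gen = GenA | GenB

abbreviation wa :: "gen word" where "wa \<equiv> [(GenA, True)]"
abbreviation wb :: "gen word" where "wb \<equiv> [(GenB, True)]"

text \<open>The presentation of \<open>K = J/Z\<^sub>2(J)\<close>, where
  \<open>J = \<langle>A, B | A\<^bsup>[A,B]\<^esup> = A\<^bsup>\<alpha>\<^esup>, B\<^bsup>[B,A]\<^esup> = B\<^bsup>\<alpha>\<^esup>, A^(2^(3m-1)) = B^(2^(3m-1)) = 1\<rangle>\<close>.\<close>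

definition K_relations :: "nat \<Rightarrow> int \<Rightarrow> (gen word \<times> gen word) set" where
  "K_relations m l =
    (let \<alpha> = 1 + 2 ^ m * l in
     {(wconj wa (wcomm wa wb), wpow wa \<alpha>),
      (wconj wb (wcomm wb wa), wpow wb \<alpha>),
      (wpow wa (2 ^ (2 * m - 1)), []),
      (wpow wb (2 ^ (2 * m - 1)), []),
      (wpow (wcomm wa wb) (2 ^ (m - 1)), [])})"

definition K_group :: "nat \<Rightarrow> int \<Rightarrow> gen word set monoid" where
  "K_group m l = presented_group (K_relations m l)"


section \<open>Upper central series and the subgroups \<open>Aut\<^sub>i\<close>\<close>

definition group_center :: "('a, 'b) monoid_scheme \<Rightarrow> 'a set" where
  "group_center G = {z \<in> carrier G. \<forall>x\<in>carrier G. z \<otimes>\<^bsub>G\<^esub> x = x \<otimes>\<^bsub>G\<^esub> z}"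

primrec upper_central :: "('a, 'b) monoid_scheme \<Rightarrow> nat \<Rightarrow> 'a set" where
  "upper_central G 0 = {\<one>\<^bsub>G\<^esub>}"
| "upper_central G (Suc i) =
    {x \<in> carrier G. upper_central G i #>\<^bsub>G\<^esub> x \<in> group_center (G Mod upper_central G i)}"

text \<open>An automorphism \<open>f\<close> sends the coset \<open>N x\<close> to \<open>N f(x)\<close>, which is the image set
  \<open>f ` (N x)\<close> because \<open>N\<close> is characteristic; \<open>AutoGroup\<close> consists of extensional functions,
  hence the restriction.\<close>

definition Aut_quotient_map ::
    "('a, 'b) monoid_scheme \<Rightarrow> 'a set \<Rightarrow> ('a \<Rightarrow> 'a) \<Rightarrow> 'a set \<Rightarrow> 'a set" where
  "Aut_quotient_map G N f = (\<lambda>C\<in>carrier (G Mod N). f ` C)"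

definition Aut_i :: "nat \<Rightarrow> ('a, 'b) monoid_scheme \<Rightarrow> ('a \<Rightarrow> 'a) set" where
  "Aut_i i G =
    kernel (AutoGroup G) (AutoGroup (G Mod upper_central G i))
      (Aut_quotient_map G (upper_central G i))"


section \<open>Target groups\<close>

definition semidirect_product ::
    "('a, 'c) monoid_scheme \<Rightarrow> ('b, 'd) monoid_scheme \<Rightarrow> ('b \<Rightarrow> 'a \<Rightarrow> 'a) \<Rightarrow> ('a \<times> 'b) monoid" where
  "semidirect_product N H \<phi> =
    \<lparr>carrier = carrier N \<times> carrier H,
     monoid.mult = (\<lambda>(n, h) (n', h'). (n \<otimes>\<^bsub>N\<^esub> \<phi> h n', h \<otimes>\<^bsub>H\<^esub> h')),
     one = (\<one>\<^bsub>N\<^esub>, \<one>\<^bsub>H\<^esub>)\<rparr>"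

abbreviation Zmod :: "nat \<Rightarrow> int monoid" where
  "Zmod n \<equiv> integer_mod_group n"

definition Zmod_units :: "nat \<Rightarrow> int monoid" where
  "Zmod_units n = units_of (residue_ring (int n))"

definition inv_swap :: "nat \<Rightarrow> int \<Rightarrow> int \<times> int \<times> int \<Rightarrow> int \<times> int \<times> int" where
  "inv_swap n h =
    (\<lambda>(u, x, y). if h = 0 then (u, x, y) else (inv\<^bsub>Zmod_units n\<^esub> u, y, x))"

definition GL2_F2 :: "(bit ^ 2 ^ 2) monoid" where
  "GL2_F2 = \<lparr>carrier = {A. invertible A}, monoid.mult = (**), one = mat 1\<rparr>"

end

theory Submission
  imports Defs "HOL-Analysis.Determinants"
begin

text \<open>
  Write \<open>c = [a, b]\<close> and \<open>q = 2\<^bsup>m-1\<^esup>\<close>. The relations make \<open>c\<close> act on \<open>\<langle>a\<rangle>\<close> and \<open>\<langle>b\<rangle>\<close> by the power maps with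
  exponents \<open>1 + 2\<^sup>m l\<close> and its inverse. Since \<open>a\<^sup>b = a c\<close>, the conjugates of the powers of \<open>a\<close> by \<open>b\<close> can be
  computed, and it follows that \<open>a\<^bsup>2q\<^esup>\<close> and \<open>b\<^bsup>2q\<^esup>\<close> are central and that every word can be collected to
  \<open>a\<^sup>i b\<^sup>j c\<^sup>k\<close>, with \<open>i\<close>, \<open>j\<close> modulo \<open>2q\<^sup>2\<close> and \<open>k\<close> modulo \<open>q\<close> (\<open>K_pair.elt_times_a\<close>, \<open>K_pair.elt_times_b\<close>). The
  multiplication of exponents obtained in this way is associative, so that it defines a group on triples of
  residues which satisfies the relations; hence the exponents are coordinates on \<open>K\<close>
  (\<open>K_group_coordinates\<close>), and everything below is a computation with them.

  In coordinates \<open>Z(K)\<close> is generated by \<open>a\<^bsup>2q\<^esup>\<close> and \<open>b\<^bsup>2q\<^esup>\<close>, the quotient \<open>K/Z(K)\<close> is a Heisenberg group over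
  residues, and \<open>K/Z\<^sub>2(K) = (\<int>/q)\<^sup>2\<close> by the exponents of \<open>a\<close> and \<open>b\<close>. Let \<open>x\<close> and \<open>y\<close> be elements whose exponents
  of \<open>a\<close> and \<open>b\<close> are \<open>(i, j)\<close> and \<open>(i', j')\<close>, and \<open>D = ij' - ji'\<close>. As \<open>[x, y]\<close> is \<open>c\<^sup>D\<close> up to a central factor, \<open>x\<close> and
  \<open>y\<close> satisfy the relations of \<open>K\<close> exactly when \<open>i(D-1)\<close>, \<open>j(D+1)\<close>, \<open>i'(D+1)\<close>, \<open>j'(D-1)\<close> vanish modulo \<open>q\<close>
  (\<open>K_relators_iff\<close>), and they are then the images of \<open>a\<close> and \<open>b\<close> under an automorphism exactly when \<open>D\<close> is
  odd (\<open>auto_matrix\<close>, \<open>auto_exists\<close>).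

  The factors of the series are now read off. The elements of \<open>Aut\<^sub>1(K)\<close> multiply \<open>a\<close> and \<open>b\<close> by arbitrary
  central elements, and composition adds the exponents, because these automorphisms fix the center. The
  elements of \<open>Aut\<^sub>2(K)\<close> multiply \<open>a\<close> and \<open>b\<close> by arbitrary elements of \<open>Z\<^sub>2(K)\<close>, and modulo the center composition
  again adds exponents; here \<open>Z\<^sub>2(K)/Z(K)\<close> is \<open>(\<int>/2)\<^sup>2 \<times> \<int>/q\<close>, generated by \<open>a\<^sup>q\<close>, \<open>b\<^sup>q\<close> and \<open>c\<close>. Finally
  \<open>Aut(K)/Aut\<^sub>2(K)\<close> is the group of all matrices over \<open>\<int>/q\<close> satisfying the above conditions. If \<open>q = 2\<close> these are
  the invertible ones. If \<open>q > 2\<close> then either \<open>i\<close> is odd, \<open>D = 1\<close>, \<open>j\<close> and \<open>i'\<close> are multiples of \<open>q/2\<close>, and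
  \<open>ij' = 1\<close>; or the same holds after exchanging the columns. As \<open>q/2\<close> is even, products of two off-diagonal
  entries vanish, which makes the former matrices a direct product and the exchange an involution that inverts
  \<open>i\<close> and swaps the two off-diagonal entries.
\<close>


section \<open>Evaluating words in a group\<close>

primrec eval_word :: "('a, 'b) monoid_scheme \<Rightarrow> ('g \<Rightarrow> 'a) \<Rightarrow> 'g word \<Rightarrow> 'a" where
  "eval_word G \<phi> [] = \<one>\<^bsub>G\<^esub>"
| "eval_word G \<phi> (s # w) =
    (if snd s then \<phi> (fst s) else inv\<^bsub>G\<^esub> \<phi> (fst s)) \<otimes>\<^bsub>G\<^esub> eval_word G \<phi> w"

definition group_comm :: "('a, 'b) monoid_scheme \<Rightarrow> 'a \<Rightarrow> 'a \<Rightarrow> 'a" where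
  "group_comm G x y = inv\<^bsub>G\<^esub> x \<otimes>\<^bsub>G\<^esub> inv\<^bsub>G\<^esub> y \<otimes>\<^bsub>G\<^esub> x \<otimes>\<^bsub>G\<^esub> y"

definition group_conj :: "('a, 'b) monoid_scheme \<Rightarrow> 'a \<Rightarrow> 'a \<Rightarrow> 'a" where
  "group_conj G x y = inv\<^bsub>G\<^esub> y \<otimes>\<^bsub>G\<^esub> x \<otimes>\<^bsub>G\<^esub> y"

context group
begin

lemma eval_word_closed [simp]:
  "(\<And>x. \<phi> x \<in> carrier G) \<Longrightarrow> eval_word G \<phi> w \<in> carrier G"
  by (induction w) auto

lemma eval_word_append:
  "(\<And>x. \<phi> x \<in> carrier G) \<Longrightarrow> eval_word G \<phi> (u @ v) = eval_word G \<phi> u \<otimes> eval_word G \<phi> v"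
  by (induction u) (auto simp: m_assoc)

lemma eval_word_winv:
  "(\<And>x. \<phi> x \<in> carrier G) \<Longrightarrow> eval_word G \<phi> (winv w) = inv (eval_word G \<phi> w)"
  by (induction w) (auto simp: winv_def eval_word_append inv_mult_group)

lemma eval_word_wpow:
  assumes "\<And>x. \<phi> x \<in> carrier G"
  shows "eval_word G \<phi> (wpow w k) = eval_word G \<phi> w [^] k"
proof -
  have *: "eval_word G \<phi> (concat (replicate n u)) = eval_word G \<phi> u [^] n" for n u
  proof (induction n)
    case (Suc n)
    have "eval_word G \<phi> (concat (replicate (Suc n) u)) = eval_word G \<phi> u \<otimes> eval_word G \<phi> u [^] n"
      using assms by (simp add: eval_word_append Suc)
    then show ?case
      using assms nat_pow_Suc2 by (metis eval_word_closed)
  qed simp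
  show ?thesis
    using assms
    by (cases k rule: int_cases2)
      (auto simp: wpow_def * eval_word_winv int_pow_int int_pow_neg_int nat_pow_inv)
qed

lemma eval_word_wcomm:
  "(\<And>x. \<phi> x \<in> carrier G) \<Longrightarrow>
    eval_word G \<phi> (wcomm u v) = group_comm G (eval_word G \<phi> u) (eval_word G \<phi> v)"
  by (simp add: wcomm_def group_comm_def eval_word_append eval_word_winv m_assoc)

lemma eval_word_wconj:
  "(\<And>x. \<phi> x \<in> carrier G) \<Longrightarrow>
    eval_word G \<phi> (wconj u v) = group_conj G (eval_word G \<phi> u) (eval_word G \<phi> v)"
  by (simp add: wconj_def group_conj_def eval_word_append eval_word_winv m_assoc)

lemma eval_word_respects:
  assumes "\<And>x. \<phi> x \<in> carrier G" and "\<forall>(u, v)\<in>R. eval_word G \<phi> u = eval_word G \<phi> v"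
    and "word_eq R u v"
  shows "eval_word G \<phi> u = eval_word G \<phi> v"
  using assms(3) by induction (use assms(1,2) in \<open>auto simp: eval_word_append\<close>)

end

lemma carrier_presented_group: "carrier (presented_group R) = range (word_class R)"
  by (simp add: presented_group_def)

lemma one_presented_group: "\<one>\<^bsub>presented_group R\<^esub> = word_class R []"
  by (simp add: presented_group_def)

lemma eval_word_presented_group:
  "eval_word (presented_group R) (\<lambda>x. word_class R [(x, True)]) w = word_class R w"
proof (induction w)
  case Nil
  show ?case by (simp add: one_presented_group)
next
  case (Cons s w)
  interpret group "presented_group R" by (rule group_presented_group)
  have "inv\<^bsub>presented_group R\<^esub> word_class R [(x, True)] = word_class R [(x, False)]" for x
    by (rule inv_equality)
      (use word_eq_cancel [of R x False] in
        \<open>auto simp: presented_group_mult one_presented_group word_class_eq_iff carrier_presented_group\<close>)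
  then show ?case
    using Cons by (cases s; cases "snd s") (auto simp: presented_group_mult)
qed

text \<open>The universal property (von Dyck): \<open>eval_word G \<phi>\<close> is constant on the classes of words, so
  it may be read off from any word in the class.\<close>

lemma presented_group_lift:
  assumes "group G" and \<phi>: "\<And>x. \<phi> x \<in> carrier G"
    and R: "\<forall>(u, v)\<in>R. eval_word G \<phi> u = eval_word G \<phi> v"
  obtains h where "h \<in> hom (presented_group R) G"
    and "\<And>w. h (word_class R w) = eval_word G \<phi> w"
proof
  interpret group G by fact
  define h where "h = (\<lambda>C. eval_word G \<phi> (SOME w. w \<in> C))"
  show h: "h (word_class R w) = eval_word G \<phi> w" for w
  proof -
    have "(SOME v. v \<in> word_class R w) \<in> word_class R w"
      by (rule someI [of _ w]) (simp add: word_class_def word_eq_refl)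
    then show ?thesis
      using eval_word_respects [OF \<phi> R] by (simp add: h_def word_class_def)
  qed
  show "h \<in> hom (presented_group R) G"
    by (auto simp: hom_def carrier_presented_group presented_group_mult h \<phi> eval_word_append)
qed


section \<open>Groups satisfying the relations of \<open>K\<close>\<close>

text \<open>The relations of \<open>K\<close> with the words replaced by their values at a pair of group elements.\<close>

definition K_relators :: "nat \<Rightarrow> int \<Rightarrow> ('a, 'b) monoid_scheme \<Rightarrow> 'a \<Rightarrow> 'a \<Rightarrow> bool" where
  "K_relators m l G a b \<longleftrightarrow>
    group_conj G a (group_comm G a b) = a [^]\<^bsub>G\<^esub> (1 + 2 ^ m * l) \<and>
    group_conj G b (group_comm G b a) = b [^]\<^bsub>G\<^esub> (1 + 2 ^ m * l) \<and>
    a [^]\<^bsub>G\<^esub> (2 ^ (2 * m - 1) :: int) = \<one>\<^bsub>G\<^esub> \<and>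
    b [^]\<^bsub>G\<^esub> (2 ^ (2 * m - 1) :: int) = \<one>\<^bsub>G\<^esub> \<and>
    group_comm G a b [^]\<^bsub>G\<^esub> (2 ^ (m - 1) :: int) = \<one>\<^bsub>G\<^esub>"

lemma (in group) K_relators_iff_eval_word:
  assumes "a \<in> carrier G" "b \<in> carrier G"
  shows "K_relators m l G a b \<longleftrightarrow>
    (\<forall>(u, v)\<in>K_relations m l.
      eval_word G (case_gen a b) u = eval_word G (case_gen a b) v)"
proof -
  have "case_gen a b x \<in> carrier G" for x
    using assms by (cases x) auto
  then show ?thesis
    using assms
    by (simp add: K_relations_def K_relators_def Let_def eval_word_wconj eval_word_wcomm
        eval_word_wpow)
qed

abbreviation K_a :: "nat \<Rightarrow> int \<Rightarrow> gen word set" where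
  "K_a m l \<equiv> word_class (K_relations m l) wa"

abbreviation K_b :: "nat \<Rightarrow> int \<Rightarrow> gen word set" where
  "K_b m l \<equiv> word_class (K_relations m l) wb"

lemma group_K_group: "group (K_group m l)"
  by (simp add: K_group_def group_presented_group)

lemma K_generators_closed: "K_a m l \<in> carrier (K_group m l)" "K_b m l \<in> carrier (K_group m l)"
  by (simp_all add: K_group_def carrier_presented_group)

lemma K_group_eval_word:
  "eval_word (K_group m l) (case_gen (K_a m l) (K_b m l)) w = word_class (K_relations m l) w"
proof -
  have "case_gen (K_a m l) (K_b m l) = (\<lambda>x. word_class (K_relations m l) [(x, True)])"
    by (intro ext) (simp split: gen.split)
  then show ?thesis
    by (simp add: K_group_def eval_word_presented_group)
qed

lemma K_group_relators: "K_relators m l (K_group m l) (K_a m l) (K_b m l)"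
  unfolding group.K_relators_iff_eval_word [OF group_K_group K_generators_closed]
  by (auto simp: K_group_eval_word word_class_eq_iff word_eq_rel)

lemma K_group_lift:
  assumes "group G" "a \<in> carrier G" "b \<in> carrier G" "K_relators m l G a b"
  obtains h where "h \<in> hom (K_group m l) G" "h (K_a m l) = a" "h (K_b m l) = b"
proof -
  interpret group G by fact
  have "case_gen a b x \<in> carrier G" for x
    using assms by (cases x) auto
  then obtain h where "h \<in> hom (K_group m l) G"
      "\<And>w. h (word_class (K_relations m l) w) = eval_word G (case_gen a b) w"
    using presented_group_lift [OF \<open>group G\<close>] K_relators_iff_eval_word [of a b m l] assms
    unfolding K_group_def by metis
  then show ?thesis
    using that assms by simp
qed

section \<open>Collecting words into normal form\<close>

text \<open>As exponents range over all integers, \<open>tri\<close> extends the binomial coefficient \<open>x choose 2\<close> to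
  negative arguments.\<close>

definition tri :: "int \<Rightarrow> int" where
  "tri x = x * (x - 1) div 2"

lemma double_tri: "2 * tri x = x * (x - 1)"
  by (simp add: tri_def)

lemma tri_simps [simp]: "tri 0 = 0" "tri 1 = 0"
  by (simp_all add: tri_def)

lemma tri_add: "tri (x + y) = tri x + tri y + x * y"
  using double_tri [of x] double_tri [of y] double_tri [of "x + y"]
  by (simp add: algebra_simps)

lemma tri_double: "tri (2 * x) = x * (2 * x - 1)"
  using double_tri [of "2 * x"] by (simp add: algebra_simps)

lemma tri_add_double: "tri (x + 2 * y) = tri x + y * (2 * x + 2 * y - 1)"
  unfolding tri_add tri_double by (simp add: algebra_simps)

lemma int_choose_two: "int (n choose 2) = tri (int n)"
  by (cases n) (simp_all add: tri_def choose_two zdiv_int algebra_simps)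

lemma tri_mult: "tri (x * y) = x * tri y + tri x * y * y"
proof -
  have "2 * (x * tri y + tri x * y * y) = x * (2 * tri y) + (2 * tri x) * y * y"
    by (simp add: algebra_simps)
  also have "\<dots> = 2 * tri (x * y)"
    unfolding double_tri by (simp add: algebra_simps)
  finally show ?thesis by simp
qed

text \<open>The orders imposed on \<open>a\<close>, \<open>b\<close> and \<open>c\<close> are \<open>2q\<^sup>2\<close>, \<open>2q\<^sup>2\<close> and \<open>q\<close>, and \<open>2\<^sup>m l = 2ql\<close>; in this form
  divisibility arguments become polynomial identities in \<open>q\<close> and \<open>l\<close>.\<close>

locale K_parameters =
  fixes m :: nat and l :: int
  assumes m_gt_1: "m > 1" and odd_l: "odd l"
begin

definition q :: int where
  "q = 2 ^ (m - 1)"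

lemma power_m: "(2 :: int) ^ m = 2 * q"
  using m_gt_1 by (simp add: q_def flip: power_Suc)

lemma power_2m_1: "(2 :: int) ^ (2 * m - 1) = 2 * q * q"
proof -
  have "2 * m - 1 = Suc ((m - 1) + (m - 1))"
    using m_gt_1 by simp
  then show ?thesis
    unfolding q_def by (simp only: power_Suc power_add mult.assoc)
qed

lemma q_pos [simp]: "q > 0"
  by (simp add: q_def)

lemma q_nonzero: "q \<noteq> 0"
  using less_imp_neq [OF q_pos] by simp

lemma even_q: "even q"
  using m_gt_1 by (simp add: q_def)

end

lemma (in group) int_pow_eq_of_dvd:
  assumes "x \<in> carrier G" "x [^] (n :: int) = \<one>" "n dvd i - j"
  shows "x [^] i = x [^] j"
proof -
  obtain d where "i = n * d + j"
    using assms(3) by (metis diff_add_cancel dvdE)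
  then show ?thesis
    using assms(1,2) by (simp add: int_pow_mult flip: int_pow_pow)
qed

text \<open>This evaluates powers with integer exponents: it suffices to check that a proposed formula is additive
  in the exponent.\<close>

lemma (in group) additive_eq_int_pow:
  assumes closed: "\<And>n :: int. F n \<in> carrier G" and add: "\<And>n n'. F (n + n') = F n \<otimes> F n'"
  shows "F n = F 1 [^] n"
proof -
  have "F 0 = \<one>"
    using add [of 0 0] closed by (metis add_0 r_cancel_one)
  then have inv: "F (- n) = inv F n" for n
    using add [of "-n" n] closed inv_equality by simp
  have nat: "F (int k) = F 1 [^] int k" for k
  proof (induction k)
    case 0
    show ?case using \<open>F 0 = \<one>\<close> by simp
  next
    case (Suc k)
    then show ?case
      using add [of "int k" 1] int_pow_mult [of "F 1" "int k" 1] closed by (simp add: add.commute)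
  qed
  show ?thesis
  proof (cases n rule: int_cases2)
    case (nonneg k)
    then show ?thesis using nat by simp
  next
    case (nonpos k)
    then show ?thesis using nat closed by (simp add: inv int_pow_neg)
  qed
qed

context group
begin

lemma inv_mult_cancel_left [simp]:
  assumes "x \<in> carrier G" "y \<in> carrier G"
  shows "inv x \<otimes> (x \<otimes> y) = y" "x \<otimes> (inv x \<otimes> y) = y"
  using assms by (simp_all flip: m_assoc)

lemma conj_eq_iff:
  assumes "x \<in> carrier G" "y \<in> carrier G" "z \<in> carrier G"
  shows "inv y \<otimes> x \<otimes> y = z \<longleftrightarrow> x \<otimes> y = y \<otimes> z"
proof -
  have "inv y \<otimes> x \<otimes> y = inv y \<otimes> (x \<otimes> y)"
    using assms by (simp add: m_assoc)
  then show ?thesis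
    using assms by (metis inv_mult_cancel_left m_closed)
qed

lemma conj_int_pow:
  assumes "x \<in> carrier G" "y \<in> carrier G"
  shows "inv y \<otimes> x [^] (i :: int) \<otimes> y = (inv y \<otimes> x \<otimes> y) [^] i"
  using assms additive_eq_int_pow [of "\<lambda>i. inv y \<otimes> x [^] i \<otimes> y" i]
  by (simp add: int_pow_mult m_assoc)

end

locale K_pair = group G + K_parameters m l for G (structure) and m l +
  fixes a b
  assumes a_closed [simp]: "a \<in> carrier G" and b_closed [simp]: "b \<in> carrier G"
    and relators: "K_relators m l G a b"
begin

definition c where
  "c = group_comm G a b"

lemma c_closed [simp]: "c \<in> carrier G"
  by (simp add: c_def group_comm_def)

lemma b_times_a_times_c: "b \<otimes> a \<otimes> c = a \<otimes> b"
proof -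
  have "c = inv (b \<otimes> a) \<otimes> (a \<otimes> b)"
    by (simp add: c_def group_comm_def inv_mult_group m_assoc)
  then show ?thesis
    by (simp add: m_assoc [symmetric] del: inv_mult_group)
qed

lemma group_comm_b_a: "group_comm G b a = inv c"
  by (simp add: c_def group_comm_def inv_mult_group m_assoc)

lemma a_pow_eq: "2 * q * q dvd i - j \<Longrightarrow> a [^] (i :: int) = a [^] j"
  using relators by (intro int_pow_eq_of_dvd [of _ "2 * q * q"])
    (auto simp: K_relators_def simp flip: power_2m_1)

lemma b_pow_eq: "2 * q * q dvd i - j \<Longrightarrow> b [^] (i :: int) = b [^] j"
  using relators by (intro int_pow_eq_of_dvd [of _ "2 * q * q"])
    (auto simp: K_relators_def simp flip: power_2m_1)

lemma c_pow_eq: "q dvd i - j \<Longrightarrow> c [^] (i :: int) = c [^] j"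
  using relators by (intro int_pow_eq_of_dvd [of _ q]) (simp_all add: K_relators_def q_def flip: c_def)

text \<open>Exchanging \<open>a\<close> and \<open>b\<close> replaces \<open>c\<close> by its inverse, and the relations are symmetric under this
  exchange. Every formula for \<open>a\<close> below therefore has a counterpart for \<open>b\<close>.\<close>

lemma swap: "K_pair G m l b a"
proof
  show "K_relators m l G b a"
    using relators group_comm_b_a
    by (simp add: K_relators_def c_def [symmetric] int_pow_inv)
qed auto

lemma a_pow_times_c: "a [^] (i :: int) \<otimes> c = c \<otimes> a [^] (i + 2 * q * l * i)"
proof -
  have "inv c \<otimes> a \<otimes> c = a [^] (1 + 2 * q * l)"
    using relators by (simp add: K_relators_def group_conj_def c_def [symmetric] power_m)
  then have "inv c \<otimes> a [^] i \<otimes> c = a [^] (i + 2 * q * l * i)"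
    by (simp add: conj_int_pow int_pow_pow algebra_simps)
  then show ?thesis
    by (simp add: conj_eq_iff)
qed

text \<open>The inverse of \<open>1 + 2ql\<close> modulo the order \<open>2q\<^sup>2\<close> of \<open>a\<close> is \<open>1 - 2ql\<close>.\<close>

lemma c_times_a_pow: "c \<otimes> a [^] (i :: int) = a [^] (i - 2 * q * l * i) \<otimes> c"
  unfolding a_pow_times_c by (rule arg_cong [of _ _ "\<lambda>x. c \<otimes> x"], rule a_pow_eq)
    (simp add: algebra_simps)

lemma c_pow_times_a_pow:
  "c [^] (k :: int) \<otimes> a [^] (i :: int) = a [^] (i - 2 * q * l * k * i) \<otimes> c [^] k"
proof (induction k arbitrary: i rule: int_induct [of _ 0])
  case base
  show ?case by simp
next
  case (step1 k)
  have "c [^] (k + 1) \<otimes> a [^] i = c \<otimes> (c [^] k \<otimes> a [^] i)"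
    by (simp add: m_assoc add.commute [of k] int_pow_mult)
  also have "\<dots> = c \<otimes> a [^] (i - 2 * q * l * k * i) \<otimes> c [^] k"
    by (simp add: step1 m_assoc)
  also have "\<dots> = a [^] (i - 2 * q * l * k * i - 2 * q * l * (i - 2 * q * l * k * i)) \<otimes> (c \<otimes> c [^] k)"
    by (simp add: c_times_a_pow m_assoc)
  also have "a [^] (i - 2 * q * l * k * i - 2 * q * l * (i - 2 * q * l * k * i))
      = a [^] (i - 2 * q * l * (k + 1) * i)"
    by (rule a_pow_eq) (simp add: algebra_simps)
  also have "c \<otimes> c [^] k = c [^] (k + 1)"
    by (simp add: add.commute [of k] int_pow_mult)
  finally show ?case .
next
  case (step2 k)
  have "c \<otimes> (c [^] (k - 1) \<otimes> a [^] i) = c [^] k \<otimes> a [^] i"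
    using int_pow_mult [of c 1 "k - 1"] by (simp add: m_assoc [symmetric])
  also have "\<dots> = a [^] (i - 2 * q * l * k * i) \<otimes> (c \<otimes> c [^] (k - 1))"
    unfolding step2 using int_pow_mult [of c 1 "k - 1"] by simp
  also have "a [^] (i - 2 * q * l * k * i)
      = a [^] (i - 2 * q * l * (k - 1) * i - 2 * q * l * (i - 2 * q * l * (k - 1) * i))"
    by (rule a_pow_eq) (simp add: algebra_simps)
  also have "\<dots> \<otimes> (c \<otimes> c [^] (k - 1)) = c \<otimes> (a [^] (i - 2 * q * l * (k - 1) * i) \<otimes> c [^] (k - 1))"
    by (simp add: m_assoc [symmetric] c_times_a_pow)
  finally show ?case
    by simp
qed

text \<open>Since \<open>b\<inverse> a b = a c\<close>, this computes the conjugate of \<open>a\<^sup>n\<close> by \<open>b\<close> as a power of \<open>a c\<close>.\<close>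

lemma a_pow_times_b:
  "a [^] (n :: int) \<otimes> b = b \<otimes> a [^] (n - 2 * q * l * tri n) \<otimes> c [^] n"
proof -
  have eq: "a [^] (n + n' - 2 * q * l * tri (n + n')) \<otimes> c [^] (n + n')
    = a [^] (n - 2 * q * l * tri n) \<otimes> c [^] n \<otimes> (a [^] (n' - 2 * q * l * tri n') \<otimes> c [^] n')" for n n'
  proof -
    have "a [^] (n - 2 * q * l * tri n) \<otimes> c [^] n \<otimes> (a [^] (n' - 2 * q * l * tri n') \<otimes> c [^] n')
      = a [^] (n - 2 * q * l * tri n) \<otimes> (c [^] n \<otimes> a [^] (n' - 2 * q * l * tri n')) \<otimes> c [^] n'"
      by (simp add: m_assoc)
    also have "\<dots> = a [^] (n - 2 * q * l * tri n
        + (n' - 2 * q * l * tri n' - 2 * q * l * n * (n' - 2 * q * l * tri n'))) \<otimes> c [^] (n + n')"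
      by (simp add: c_pow_times_a_pow int_pow_mult m_assoc)
    also have "a [^] (n - 2 * q * l * tri n
        + (n' - 2 * q * l * tri n' - 2 * q * l * n * (n' - 2 * q * l * tri n')))
      = a [^] (n + n' - 2 * q * l * tri (n + n'))"
      by (rule a_pow_eq) (simp add: tri_add algebra_simps)
    finally show ?thesis by simp
  qed
  have "inv b \<otimes> a [^] n \<otimes> b = (inv b \<otimes> a \<otimes> b) [^] n"
    by (simp add: conj_int_pow)
  also have "inv b \<otimes> a \<otimes> b = a \<otimes> c"
    using b_times_a_times_c m_assoc [of b a c] by (simp add: conj_eq_iff)
  also have "(a \<otimes> c) [^] n = a [^] (n - 2 * q * l * tri n) \<otimes> c [^] n"
    using additive_eq_int_pow [of "\<lambda>n. a [^] (n - 2 * q * l * tri n) \<otimes> c [^] n" n] eq by simp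
  finally show ?thesis
    by (simp add: conj_eq_iff m_assoc [of b])
qed

text \<open>The terms of the preceding formula that obstruct commutation vanish for \<open>n = 2qi\<close>, since \<open>tri (2qi)\<close> and
  \<open>n\<close> are multiples of \<open>q\<close>.\<close>

lemma a_pow_2q_commutes_b: "a [^] (2 * q * i) \<otimes> b = b \<otimes> a [^] (2 * q * i)"
proof -
  have "a [^] (2 * q * i - 2 * q * l * tri (2 * q * i)) = a [^] (2 * q * i)"
    using tri_double [of "q * i"] by (intro a_pow_eq) (simp add: mult.assoc)
  moreover have "c [^] (2 * q * i) = \<one>"
    using c_pow_eq [of "2 * q * i" 0] by simp
  ultimately show ?thesis
    by (simp add: a_pow_times_b)
qed

lemma a_pow_2q_commutes_b_pow: "a [^] (2 * q * i) \<otimes> b [^] (j :: int) = b [^] j \<otimes> a [^] (2 * q * i)"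
proof -
  have "inv (a [^] (2 * q * i)) \<otimes> b \<otimes> a [^] (2 * q * i) = b"
    by (simp add: conj_eq_iff a_pow_2q_commutes_b)
  then have "inv (a [^] (2 * q * i)) \<otimes> b [^] j \<otimes> a [^] (2 * q * i) = b [^] j"
    by (simp add: conj_int_pow)
  then show ?thesis
    by (simp add: conj_eq_iff)
qed

lemma c_pow_times_b_pow:
  "c [^] (k :: int) \<otimes> b [^] (j :: int) = b [^] (j + 2 * q * l * k * j) \<otimes> c [^] k"
proof -
  interpret swap: K_pair G m l b a by (rule swap)
  show ?thesis
    using swap.c_pow_times_a_pow [of "- k" j]
    by (simp add: swap.c_def group_comm_b_a int_pow_inv int_pow_neg)
qed

lemma b_pow_times_a:
  "b [^] (n :: int) \<otimes> a = a \<otimes> b [^] (n - 2 * q * l * tri n) \<otimes> c [^] (- n)"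
proof -
  interpret swap: K_pair G m l b a by (rule swap)
  show ?thesis
    using swap.a_pow_times_b [of n] by (simp add: swap.c_def group_comm_b_a int_pow_inv int_pow_neg)
qed

definition elt :: "int \<times> int \<times> int \<Rightarrow> 'a" where
  "elt = (\<lambda>(i, j, k). a [^] i \<otimes> b [^] j \<otimes> c [^] k)"

lemma elt_closed [simp]: "elt p \<in> carrier G"
  by (simp add: elt_def split: prod.split)

lemma elt_times_b: "elt (i, j, k) \<otimes> b = elt (i, j + 1 + 2 * q * l * k, k)"
proof -
  have "c [^] k \<otimes> b = b [^] (1 + 2 * q * l * k) \<otimes> c [^] k"
    using c_pow_times_b_pow [of k 1] by simp
  then show ?thesis
    by (simp add: elt_def m_assoc int_pow_mult)
qed

text \<open>Moving \<open>a\<close> to the left past \<open>c\<^sup>k\<close> produces the central factor \<open>z = a\<^bsup>-2qlk\<^esup>\<close>, and moving it past \<open>b\<^sup>j\<close> produces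
  \<open>c\<^bsup>-j\<^esup>\<close> and a central power of \<open>b\<close>.\<close>

lemma elt_times_a:
  "elt (i, j, k) \<otimes> a = elt (i + 1 - 2 * q * l * k, j - 2 * q * l * tri j, k - j)"
proof -
  define z where "z = a [^] (2 * q * (- l * k))"
  have [simp]: "z \<in> carrier G"
    by (simp add: z_def)
  have za: "a \<otimes> z = a [^] (1 - 2 * q * l * k)"
    using int_pow_mult [of a 1 "2 * q * (- l * k)"] by (simp add: z_def mult.assoc)
  have zc: "c [^] (- j) \<otimes> z = z \<otimes> c [^] (- j)"
  proof -
    have "a [^] (2 * q * (- l * k) - 2 * q * l * - j * (2 * q * (- l * k))) = z"
      unfolding z_def by (rule a_pow_eq) (simp add: algebra_simps)
    then show ?thesis
      unfolding z_def c_pow_times_a_pow by simp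
  qed
  have zb: "b [^] n \<otimes> z = z \<otimes> b [^] n" for n :: int
    unfolding z_def by (rule a_pow_2q_commutes_b_pow [symmetric])
  have "c [^] k \<otimes> a = a \<otimes> z \<otimes> c [^] k"
    using c_pow_times_a_pow [of k 1] by (simp add: za)
  then have "elt (i, j, k) \<otimes> a = a [^] i \<otimes> (b [^] j \<otimes> a) \<otimes> z \<otimes> c [^] k"
    by (simp add: elt_def m_assoc)
  also have "\<dots> = a [^] i \<otimes> a \<otimes> b [^] (j - 2 * q * l * tri j) \<otimes> (c [^] (- j) \<otimes> z) \<otimes> c [^] k"
    by (simp add: b_pow_times_a m_assoc)
  also have "\<dots> = a [^] i \<otimes> a \<otimes> (b [^] (j - 2 * q * l * tri j) \<otimes> z) \<otimes> (c [^] (- j) \<otimes> c [^] k)"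
    by (simp add: zc m_assoc)
  also have "\<dots> = a [^] i \<otimes> (a \<otimes> z) \<otimes> b [^] (j - 2 * q * l * tri j) \<otimes> (c [^] (- j) \<otimes> c [^] k)"
    by (simp add: zb m_assoc)
  also have "\<dots> = elt (i + 1 - 2 * q * l * k, j - 2 * q * l * tri j, k - j)"
    unfolding za by (simp add: elt_def m_assoc [symmetric] add_diff_eq flip: int_pow_mult)
  finally show ?thesis .
qed

end

context K_pair
begin

lemma elt_cong:
  assumes "2 * q * q dvd i - i'" "2 * q * q dvd j - j'" "q dvd k - k'"
  shows "elt (i, j, k) = elt (i', j', k')"
  using assms by (simp add: elt_def a_pow_eq [of i i'] b_pow_eq [of j j'] c_pow_eq [of k k'])

text \<open>The set of the elements in normal form is closed under right multiplication by the
  generators, hence by their inverses, which are positive powers of them.\<close>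

lemma range_elt_times_generator:
  assumes "x \<in> range elt" "g = a \<or> g = b"
  shows "x \<otimes> g \<in> range elt" "x \<otimes> inv g \<in> range elt"
proof -
  have *: "y \<otimes> g \<in> range elt" if y: "y \<in> range elt" for y
  proof -
    obtain i j k where "y = elt (i, j, k)"
      using y by auto
    then show ?thesis
      using assms(2) by (auto simp: elt_times_a elt_times_b)
  qed
  then show "x \<otimes> g \<in> range elt"
    using assms(1) .
  have g: "g \<in> carrier G"
    using assms(2) by auto
  have "x \<otimes> g [^] n \<in> range elt" for n :: nat
  proof (induction n)
    case 0
    show ?case using assms(1) by auto
  next
    case (Suc n)
    have "x \<otimes> g [^] Suc n = (x \<otimes> g [^] n) \<otimes> g"
      using assms(1) g by (auto simp: m_assoc)
    then show ?case
      using * [OF Suc] by simp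
  qed
  moreover have "inv g = g [^] nat (2 * q * q - 1)"
  proof -
    have "g [^] (- 1 :: int) = g [^] (2 * q * q - 1)"
      using assms(2) a_pow_eq [of "-1" "2 * q * q - 1"] b_pow_eq [of "-1" "2 * q * q - 1"] by auto
    moreover have "2 * q * q - 1 \<ge> 0"
      using q_pos by (simp add: int_one_le_iff_zero_less mult_pos_pos)
    ultimately show ?thesis
      using g by (simp add: int_pow_neg pow_nat)
  qed
  ultimately show "x \<otimes> inv g \<in> range elt"
    by (simp only:)
qed

lemma eval_word_in_range_elt: "eval_word G (case_gen a b) w \<in> range elt"
proof (induction w rule: rev_induct)
  case Nil
  have "elt (0, 0, 0) = \<one>"
    by (simp add: elt_def)
  then show ?case
    by (metis eval_word.simps(1) rangeI)
next
  case (snoc s w)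
  have \<phi>: "case_gen a b x \<in> carrier G" for x
    by (cases x) auto
  have "case_gen a b (fst s) = a \<or> case_gen a b (fst s) = b"
    by (cases "fst s") auto
  then show ?case
    using range_elt_times_generator [OF snoc, of "case_gen a b (fst s)"] \<phi>
    by (simp add: eval_word_append)
qed

end


section \<open>The model of \<open>K\<close>\<close>

context K_parameters
begin

text \<open>This is what collecting \<open>a\<^sup>i b\<^sup>j c\<^sup>k a\<^bsup>i'\<^esup> b\<^bsup>j'\<^esup> c\<^bsup>k'\<^esup>\<close> gives if one uses \<open>[a, c] = a\<^bsup>2ql\<^esup>\<close>, \<open>[c, b] = b\<^bsup>2ql\<^esup>\<close> and
  the centrality of these two elements.\<close>

fun mul :: "int \<times> int \<times> int \<Rightarrow> int \<times> int \<times> int \<Rightarrow> int \<times> int \<times> int" where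
  "mul (i, j, k) (i', j', k') =
    (i + i' + 2 * q * l * (j * tri i' - k * i'),
     j + j' + 2 * q * l * (k * j' - i' * tri j - i' * j * j'),
     k + k' - j * i')"

fun cong_mod :: "int \<times> int \<times> int \<Rightarrow> int \<times> int \<times> int \<Rightarrow> bool" where
  "cong_mod (i, j, k) (i', j', k') \<longleftrightarrow>
    2 * q * q dvd i - i' \<and> 2 * q * q dvd j - j' \<and> q dvd k - k'"

fun red :: "int \<times> int \<times> int \<Rightarrow> int \<times> int \<times> int" where
  "red (i, j, k) = (i mod (2 * q * q), j mod (2 * q * q), k mod q)"

lemma red_eq_iff: "red p = red p' \<longleftrightarrow> cong_mod p p'"
  by (cases p; cases p') (simp add: mod_eq_dvd_iff)

lemma red_idem [simp]: "red (red p) = red p"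
  by (cases p) simp

lemma cong_mod_red: "cong_mod (red p) p" "cong_mod p (red p)"
  by (simp_all flip: red_eq_iff)

text \<open>The correction terms in \<open>mul\<close> carry the factor \<open>2\<^sup>m l\<close> and therefore depend only on
  the exponents modulo \<open>q\<close>.\<close>

lemma twist_cong:
  assumes "2 * q * q dvd x - y" "[u = v] (mod q)"
  shows "2 * q * q dvd (x + 2 * q * l * u) - (y + 2 * q * l * v)"
proof -
  obtain w where "u = v + q * w"
    using assms(2) by (metis cong_iff_lin cong_sym)
  then have "(x + 2 * q * l * u) - (y + 2 * q * l * v) = (x - y) + 2 * q * q * (l * w)"
    by (simp add: algebra_simps)
  then show ?thesis
    using assms(1) by (metis dvd_add dvd_triv_left)
qed

lemma tri_cong: "2 * q dvd x - y \<Longrightarrow> [tri x = tri y] (mod q)"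
proof -
  assume "2 * q dvd x - y"
  then obtain w where "x = y + 2 * (q * w)"
    by (metis diff_add_cancel add.commute dvdE mult.assoc)
  then have "tri x - tri y = q * (w * (2 * y + 2 * (q * w) - 1))"
    by (simp add: tri_add_double)
  then show ?thesis
    by (metis cong_iff_dvd_diff dvd_triv_left)
qed

lemma mul_cong:
  assumes "cong_mod p p'" "cong_mod r r'"
  shows "cong_mod (mul p r) (mul p' r')"
proof (cases p; cases p'; cases r; cases r')
  fix i j k i' j' k' I J K I' J' K'
  assume eqs: "p = (i, j, k)" "p' = (i', j', k')" "r = (I, J, K)" "r' = (I', J', K')"
  have N: "2 * q * q dvd i - i'" "2 * q * q dvd j - j'" "2 * q * q dvd I - I'" "2 * q * q dvd J - J'"
    using assms by (simp_all add: eqs)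
  have "2 * q dvd j - j'" "2 * q dvd I - I'"
    using N by (auto dest: dvd_mult_left)
  note tri = this [THEN tri_cong]
  have q: "[i = i'] (mod q)" "[j = j'] (mod q)" "[k = k'] (mod q)"
      "[I = I'] (mod q)" "[J = J'] (mod q)" "[K = K'] (mod q)"
    using assms N by (auto simp: eqs cong_iff_dvd_diff dest: dvd_mult_right)
  have "2 * q * q dvd (i + I) - (i' + I')" "2 * q * q dvd (j + J) - (j' + J')"
    using N by (metis add_diff_add dvd_add)+
  note N' = this
  have 1: "2 * q * q dvd (i + I + 2 * q * l * (j * tri I - k * I))
        - (i' + I' + 2 * q * l * (j' * tri I' - k' * I'))"
    by (intro twist_cong cong_add cong_diff cong_mult q tri N')
  have 2: "2 * q * q dvd (j + J + 2 * q * l * (k * J - I * tri j - I * j * J))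
        - (j' + J' + 2 * q * l * (k' * J' - I' * tri j' - I' * j' * J'))"
    by (intro twist_cong cong_add cong_diff cong_mult q tri N')
  have "[k + K - j * I = k' + K' - j' * I'] (mod q)"
    by (intro cong_add cong_diff cong_mult q)
  with 1 2 show ?thesis
    by (simp add: eqs cong_iff_dvd_diff)
qed

text \<open>Both sides agree exactly up to the correction terms. In these, replacing an exponent by one that
  already contains a correction changes the value by a multiple of \<open>q\<close>, so that the difference has a factor
  \<open>(2ql) q\<close>; the cofactors are written out.\<close>

lemma mul_assoc: "cong_mod (mul (mul p p') p'') (mul p (mul p' p''))"
proof (cases p; cases p'; cases p'')
  fix i j k i' j' k' i'' j'' k''
  assume p: "p = (i, j, k)" "p' = (i', j', k')" "p'' = (i'', j'', k'')"
  have tri: "\<exists>v. tri (x + y + 2 * q * l * u) = tri x + tri y + x * y + q * v" for x y u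
    using tri_add_double [of "x + y" "q * l * u"] by (auto simp: mult.assoc tri_add)
  define A where "A = j' * tri i'' - k' * i''"
  define B where "B = k * j' - i' * tri j - i' * j * j'"
  define C where "C = k' * j'' - i'' * tri j' - i'' * j' * j''"
  obtain X where X: "tri (j + j' + 2 * q * l * B) = tri j + tri j' + j * j' + q * X"
    using tri by blast
  obtain Y where Y: "tri (i' + i'' + 2 * q * l * A) = tri i' + tri i'' + i' * i'' + q * Y"
    using tri by blast
  show ?thesis
    unfolding p mul.simps cong_mod.simps A_def [symmetric] B_def [symmetric] C_def [symmetric] X Y
  proof (intro conjI)
    show "2 * q * q dvd i + i' + 2 * q * l * (j * tri i' - k * i') + i''
          + 2 * q * l * ((j + j' + 2 * q * l * B) * tri i'' - (k + k' - j * i') * i'')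
        - (i + (i' + i'' + 2 * q * l * A) + 2 * q * l *
          (j * (tri i' + tri i'' + i' * i'' + q * Y) - k * (i' + i'' + 2 * q * l * A)))"
      by (rule dvdI [of _ _ "l * (2 * l * B * tri i'' - j * Y + 2 * k * l * A)"])
        (simp add: algebra_simps A_def)
    show "2 * q * q dvd j + j' + 2 * q * l * B + j''
          + 2 * q * l * ((k + k' - j * i') * j'' - i'' * (tri j + tri j' + j * j' + q * X)
              - i'' * (j + j' + 2 * q * l * B) * j'')
        - (j + (j' + j'' + 2 * q * l * C)
          + 2 * q * l * (k * (j' + j'' + 2 * q * l * C) - (i' + i'' + 2 * q * l * A) * tri j
              - (i' + i'' + 2 * q * l * A) * j * (j' + j'' + 2 * q * l * C)))"
      by (rule dvdI [of _ _ "l * (2 * l * A * tri j + 2 * l * A * j * (j' + j'' + 2 * q * l * C)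
            + (i' + i'') * j * 2 * l * C - i'' * X - 2 * l * i'' * B * j'' - 2 * k * l * C)"])
        (simp add: algebra_simps B_def C_def)
    show "q dvd k + k' - j * i' + k'' - (j + j' + 2 * q * l * B) * i''
        - (k + (k' + k'' - j' * i'') - j * (i' + i'' + 2 * q * l * A))"
      by (rule dvdI [of _ _ "2 * l * (j * A - B * i'')"]) (simp add: algebra_simps)
  qed
qed

end

context group
begin

lemma group_comm_eqI:
  assumes "x \<in> carrier G" "y \<in> carrier G" "z \<in> carrier G" "y \<otimes> x \<otimes> z = x \<otimes> y"
  shows "group_comm G x y = z"
proof -
  have "group_comm G x y = inv (y \<otimes> x) \<otimes> (x \<otimes> y)"
    using assms(1-3) by (simp add: group_comm_def inv_mult_group m_assoc)
  also have "\<dots> = z"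
    unfolding assms(4) [symmetric] using assms(1-3) by (simp add: m_assoc inv_mult_group)
  finally show ?thesis .
qed

end

context K_parameters
begin

text \<open>The multiplication of exponents, on representatives of the residues: \<open>K\<close> maps onto this group, so that
  the normal form is unique.\<close>

definition model :: "(int \<times> int \<times> int) monoid" where
  "model = \<lparr>carrier = range red, monoid.mult = (\<lambda>p r. red (mul p r)), one = red (0, 0, 0)\<rparr>"

lemma model_mult: "red p \<otimes>\<^bsub>model\<^esub> red r = red (mul p r)"
  by (simp add: model_def red_eq_iff mul_cong cong_mod_red)

lemma red_in_model [simp]: "red p \<in> carrier model"
  by (simp add: model_def)

lemma one_model: "\<one>\<^bsub>model\<^esub> = red (0, 0, 0)"
  by (simp add: model_def)

lemma group_model: "group model"
proof (rule groupI)
  fix x y z assume "x \<in> carrier model" "y \<in> carrier model" "z \<in> carrier model"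
  then obtain p r s where x: "x = red p" and y: "y = red r" and z: "z = red s"
    by (auto simp: model_def)
  show "x \<otimes>\<^bsub>model\<^esub> y \<in> carrier model"
    unfolding x y model_mult by simp
  show "x \<otimes>\<^bsub>model\<^esub> y \<otimes>\<^bsub>model\<^esub> z = x \<otimes>\<^bsub>model\<^esub> (y \<otimes>\<^bsub>model\<^esub> z)"
    unfolding x y z model_mult red_eq_iff by (rule mul_assoc)
next
  fix x assume "x \<in> carrier model"
  then obtain i j k where x: "x = red (i, j, k)"
    by (auto simp: model_def)
  show "\<one>\<^bsub>model\<^esub> \<otimes>\<^bsub>model\<^esub> x = x"
    unfolding x one_model model_mult by simp
  \<comment> \<open>Up to the corrections \<open>2qlu\<close> and \<open>2qlv\<close> the inverse is that of the Heisenberg group.\<close>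
  define K where "K = - k - j * i"
  define u where "u = j * tri i + K * i"
  define v where "v = i * tri (- j) - i * j * j - K * j"
  obtain w where w: "tri (- j + 2 * q * l * v) = tri (- j) + q * w"
    using tri_add_double [of "- j" "q * l * v"] by (auto simp: mult.assoc)
  have "mul (- i + 2 * q * l * u, - j + 2 * q * l * v, K) (i, j, k) =
      (2 * q * q * (2 * l * l * v * tri i),
       2 * q * q * (- l * i * w - 2 * l * l * i * v * j),
       q * (- 2 * l * v * i))"
    unfolding mul.simps w by (simp add: u_def v_def K_def algebra_simps)
  then have "red (- i + 2 * q * l * u, - j + 2 * q * l * v, K) \<otimes>\<^bsub>model\<^esub> x = \<one>\<^bsub>model\<^esub>"
    unfolding x one_model model_mult red_eq_iff by simp
  then show "\<exists>y\<in>carrier model. y \<otimes>\<^bsub>model\<^esub> x = \<one>\<^bsub>model\<^esub>"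
    by (rule bexI) (rule red_in_model)
qed (simp add: one_model del: red.simps)

interpretation model: group model
  by (rule group_model)

lemma model_pow:
  "red (i, 0, 0) = red (1, 0, 0) [^]\<^bsub>model\<^esub> i"
  "red (0, i, 0) = red (0, 1, 0) [^]\<^bsub>model\<^esub> i"
  "red (0, 0, i) = red (0, 0, 1) [^]\<^bsub>model\<^esub> i"
  by (rule model.additive_eq_int_pow; simp add: model_mult del: red.simps)+

lemma model_comm: "group_comm model (red (1, 0, 0)) (red (0, 1, 0)) = red (0, 0, 1)"
  by (rule model.group_comm_eqI) (simp_all add: model_mult del: red.simps)

lemma K_relators_model: "K_relators m l model (red (1, 0, 0)) (red (0, 1, 0))"
proof -
  have inv: "group_comm model (red (0, 1, 0)) (red (1, 0, 0)) = red (0, 0, - 1)"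
    by (rule model.group_comm_eqI) (simp_all add: model_mult del: red.simps)
  show ?thesis
    unfolding K_relators_def inv model_comm power_m power_2m_1 q_def [symmetric] group_conj_def
    by (simp add: model.conj_eq_iff model_mult one_model red_eq_iff algebra_simps
        del: red.simps flip: model_pow)
qed

lemma model_elt: "K_pair.elt model (red (1, 0, 0)) (red (0, 1, 0)) p = red p"
proof -
  interpret K_pair model m l "red (1, 0, 0)" "red (0, 1, 0)"
    by unfold_locales (simp_all add: K_relators_model del: red.simps)
  show ?thesis
    by (cases p) (simp add: elt_def c_def model_comm model_mult del: red.simps flip: model_pow)
qed

end

section \<open>Exponents as coordinates on \<open>K\<close>\<close>

text \<open>All that the study of \<open>Aut(K)\<close> requires of \<open>K\<close>: the map \<open>E (i, j, k) = a\<^sup>i b\<^sup>j c\<^sup>k\<close> is onto, the exponents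
  are unique modulo the orders of \<open>a\<close>, \<open>b\<close>, \<open>c\<close> and multiply by \<open>mul\<close>, and pairs of elements satisfying the
  relations extend to endomorphisms.\<close>

locale K_coordinates = group G + K_parameters m l for G (structure) and m l +
  fixes E :: "int \<times> int \<times> int \<Rightarrow> 'a"
  assumes carrier_eq: "carrier G = range E"
    and E_mult: "E p \<otimes> E r = E (mul p r)"
    and E_eq_iff: "E p = E r \<longleftrightarrow> cong_mod p r"
    and lift: "x \<in> carrier G \<Longrightarrow> y \<in> carrier G \<Longrightarrow> K_relators m l G x y \<Longrightarrow>
      \<exists>h\<in>hom G G. h (E (1, 0, 0)) = x \<and> h (E (0, 1, 0)) = y"
    and relators: "K_relators m l G (E (1, 0, 0)) (E (0, 1, 0))"

context K_parameters
begin

text \<open>The homomorphism \<open>h\<close> from \<open>K\<close> to the model recovers the exponents of an element in normal form; so they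
  are unique, and their product law is that of the model.\<close>

lemma K_group_coordinates:
  obtains E where "K_coordinates (K_group m l) m l E"
proof
  let ?K = "K_group m l" and ?a = "K_a m l" and ?b = "K_b m l"
  interpret K: K_pair ?K m l ?a ?b
    using K_parameters_axioms group_K_group K_group_relators K_generators_closed
    by (intro K_pair.intro K_pair_axioms.intro)
  interpret model: K_pair model m l "red (1, 0, 0)" "red (0, 1, 0)"
    using K_parameters_axioms group_model K_relators_model
    by (intro K_pair.intro K_pair_axioms.intro) (simp_all del: red.simps)
  obtain h where h: "h \<in> hom ?K model" "h ?a = red (1, 0, 0)" "h ?b = red (0, 1, 0)"
    using K_group_lift [OF group_model _ _ K_relators_model] red_in_model by blast
  interpret h: group_hom ?K model h
    using h(1) by unfold_locales
  have h_elt: "h (K.elt p) = red p" for p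
  proof -
    have "h (K.elt p) = model.elt p"
      by (cases p) (simp add: K.elt_def model.elt_def K.c_def model.c_def group_comm_def h
          h.hom_int_pow del: red.simps)
    then show ?thesis by (simp only: model_elt)
  qed
  show "K_coordinates ?K m l K.elt"
  proof
    show carrier: "carrier ?K = range K.elt"
    proof
      show "carrier ?K \<subseteq> range K.elt"
        using K.eval_word_in_range_elt
        by (auto simp: K_group_eval_word) (auto simp: K_group_def carrier_presented_group)
    qed auto
    show eq_iff: "K.elt p = K.elt r \<longleftrightarrow> cong_mod p r" for p r
    proof
      show "cong_mod p r" if "K.elt p = K.elt r"
        using arg_cong [OF that, of h] by (simp only: h_elt red_eq_iff)
      show "K.elt p = K.elt r" if "cong_mod p r"
        using that by (cases p; cases r) (simp add: K.elt_cong)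
    qed
    show "K.elt p \<otimes>\<^bsub>?K\<^esub> K.elt r = K.elt (mul p r)" for p r
    proof -
      obtain s where s: "K.elt p \<otimes>\<^bsub>?K\<^esub> K.elt r = K.elt s"
        using K.m_closed [OF K.elt_closed K.elt_closed, of p r] unfolding carrier by (rule rangeE)
      have "red s = red (mul p r)"
        using arg_cong [OF s, of h] by (simp add: h_elt model_mult del: red.simps)
      then show ?thesis
        using s by (simp add: eq_iff red_eq_iff)
    qed
    have ab: "K.elt (1, 0, 0) = ?a" "K.elt (0, 1, 0) = ?b"
      by (simp_all add: K.elt_def)
    show "\<exists>h\<in>hom ?K ?K. h (K.elt (1, 0, 0)) = x \<and> h (K.elt (0, 1, 0)) = y"
      if "x \<in> carrier ?K" "y \<in> carrier ?K" "K_relators m l ?K x y" for x y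
      unfolding ab using K_group_lift [OF group_K_group that] by blast
    show "K_relators m l ?K (K.elt (1, 0, 0)) (K.elt (0, 1, 0))"
      by (simp add: ab K_group_relators)
  qed
qed

end

section \<open>Central automorphisms relative to a normal subgroup\<close>

context group
begin

lemma rcos_eq_iff:
  assumes "subgroup N G" "x \<in> carrier G" "y \<in> carrier G"
  shows "N #> x = N #> y \<longleftrightarrow> x \<in> N #> y"
  using assms repr_independence rcos_self by metis

lemma center_Mod_iff:
  assumes "N \<lhd> G" "x \<in> carrier G"
  shows "N #> x \<in> group_center (G Mod N) \<longleftrightarrow>
    (\<forall>y\<in>carrier G. N #> (x \<otimes> y) = N #> (y \<otimes> x))"
  using assms normal.rcos_sum [OF assms(1)]
  by (auto simp: group_center_def FactGroup_def RCOSETS_def)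

lemma upper_central_Suc:
  assumes "upper_central G i \<lhd> G"
  shows "upper_central G (Suc i) = {x \<in> carrier G. \<forall>y\<in>carrier G.
    upper_central G i #> (x \<otimes> y) = upper_central G i #> (y \<otimes> x)}"
  using center_Mod_iff [OF assms] by auto

lemma carrier_AutoGroup: "carrier (AutoGroup G) = auto G"
  by (simp add: AutoGroup_def)

lemma AutoGroup_mult:
  assumes "f \<in> auto G" "g \<in> auto G" "x \<in> carrier G"
  shows "(f \<otimes>\<^bsub>AutoGroup G\<^esub> g) x = f (g x)"
  using assms by (simp add: AutoGroup_def BijGroup_def auto_def compose_def)

lemma auto_closed: "f \<in> auto G \<Longrightarrow> x \<in> carrier G \<Longrightarrow> f x \<in> carrier G"
  by (auto simp: auto_def hom_def)

lemma auto_mult: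
  "f \<in> auto G \<Longrightarrow> x \<in> carrier G \<Longrightarrow> y \<in> carrier G \<Longrightarrow> f (x \<otimes> y) = f x \<otimes> f y"
  by (auto simp: auto_def hom_def)

lemma auto_surj:
  assumes "f \<in> auto G" "x \<in> carrier G"
  obtains y where "y \<in> carrier G" "x = f y"
  using assms by (auto simp: auto_def Bij_def bij_betw_def)

lemma auto_eqI:
  assumes "f \<in> auto G" "g \<in> auto G" "\<And>x. x \<in> carrier G \<Longrightarrow> f x = g x"
  shows "f = g"
  using assms by (auto simp: auto_def Bij_def intro: extensionalityI)

lemma one_AutoGroup: "x \<in> carrier G \<Longrightarrow> \<one>\<^bsub>AutoGroup G\<^esub> x = x"
  by (simp add: AutoGroup_def BijGroup_def)

lemma inv_AutoGroup_apply:
  assumes "f \<in> auto G" "x \<in> carrier G"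
  shows "(inv\<^bsub>AutoGroup G\<^esub> f) (f x) = x"
proof -
  interpret A: group "AutoGroup G"
    by (rule AutoGroup)
  have "(inv\<^bsub>AutoGroup G\<^esub> f) (f x) = (inv\<^bsub>AutoGroup G\<^esub> f \<otimes>\<^bsub>AutoGroup G\<^esub> f) x"
    using assms A.inv_closed [of f] by (subst AutoGroup_mult) (simp_all add: carrier_AutoGroup)
  also have "\<dots> = x"
    using assms fun_cong [OF A.l_inv [of f], of x] by (simp add: carrier_AutoGroup one_AutoGroup)
  finally show ?thesis .
qed

text \<open>Triviality on \<open>G/N\<close> is stated elementwise, so that no induced map on cosets has to be formed.\<close>

definition autos_trivial_mod :: "'a set \<Rightarrow> ('a \<Rightarrow> 'a) set" where
  "autos_trivial_mod N = {f \<in> auto G. \<forall>x\<in>carrier G. f x \<in> N #> x}"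

text \<open>An automorphism maps each coset of \<open>N\<close> onto itself as soon as it maps each element into its own coset,
  since it is onto.\<close>

lemma Aut_i_eq_autos_trivial_mod:
  assumes "upper_central G i \<lhd> G"
  shows "Aut_i i G = autos_trivial_mod (upper_central G i)"
proof -
  define N where "N = upper_central G i"
  have N: "N \<lhd> G" "subgroup N G"
    using assms normal_imp_subgroup by (simp_all add: N_def)
  have iff: "Aut_quotient_map G N f = \<one>\<^bsub>AutoGroup (G Mod N)\<^esub> \<longleftrightarrow> (\<forall>x\<in>carrier G. f x \<in> N #> x)"
    if f: "f \<in> auto G" for f
  proof -
    have "Aut_quotient_map G N f = \<one>\<^bsub>AutoGroup (G Mod N)\<^esub> \<longleftrightarrow>
        (\<forall>x\<in>carrier G. f ` (N #> x) = N #> x)"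
      unfolding Aut_quotient_map_def AutoGroup_def BijGroup_def
      by (auto simp: FactGroup_def RCOSETS_def restrict_def fun_eq_iff)
    also have "\<dots> \<longleftrightarrow> (\<forall>x\<in>carrier G. f x \<in> N #> x)"
    proof (intro iffI ballI)
      fix x assume "\<forall>x\<in>carrier G. f ` (N #> x) = N #> x" "x \<in> carrier G"
      then show "f x \<in> N #> x"
        using rcos_self N(2) by blast
    next
      fix x assume *: "\<forall>x\<in>carrier G. f x \<in> N #> x" and x: "x \<in> carrier G"
      have coset: "N #> x \<subseteq> carrier G"
        using x N(2) by (meson r_coset_subset_G subgroup.subset)
      have cos: "N #> f y = N #> y" if "y \<in> carrier G" for y
        using * that rcos_eq_iff [OF N(2)] auto_closed [OF f] by blast
      show "f ` (N #> x) = N #> x"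
      proof
        show "f ` (N #> x) \<subseteq> N #> x"
        proof clarify
          fix y assume y: "y \<in> N #> x"
          then have y': "y \<in> carrier G"
            using coset by blast
          then have "N #> f y = N #> x"
            using cos y rcos_eq_iff [OF N(2) y' x] by simp
          then show "f y \<in> N #> x"
            using rcos_eq_iff [OF N(2) auto_closed [OF f y'] x] by simp
        qed
        show "N #> x \<subseteq> f ` (N #> x)"
        proof
          fix y assume y: "y \<in> N #> x"
          then obtain z where z: "z \<in> carrier G" "y = f z"
            using coset auto_surj [OF f] by blast
          then have "N #> z = N #> x"
            using cos [OF z(1)] y rcos_eq_iff [OF N(2) auto_closed [OF f z(1)] x] by simp
          then have "z \<in> N #> x"
            using rcos_eq_iff [OF N(2) z(1) x] by simp
          then show "y \<in> f ` (N #> x)"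
            using z by blast
        qed
      qed
    qed
    finally show ?thesis .
  qed
  show ?thesis
    unfolding Aut_i_def kernel_def autos_trivial_mod_def
    using iff by (auto simp: N_def [symmetric] carrier_AutoGroup)
qed

text \<open>If \<open>f y = n y\<close> then \<open>g f g\<inverse>\<close> multiplies \<open>g y\<close> by \<open>g n\<close>, which lies in \<open>N\<close> again.\<close>

lemma autos_trivial_mod_normal:
  assumes N: "N \<lhd> G" and char: "\<And>g x. g \<in> auto G \<Longrightarrow> x \<in> N \<Longrightarrow> g x \<in> N"
  shows "autos_trivial_mod N \<lhd> AutoGroup G"
proof -
  interpret A: group "AutoGroup G"
    by (rule AutoGroup)
  have sub: "subgroup N G"
    using N by (rule normal_imp_subgroup)
  have cos: "N #> f x = N #> x" if "f \<in> autos_trivial_mod N" "x \<in> carrier G" for f x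
    using that rcos_eq_iff [OF sub] auto_closed by (auto simp: autos_trivial_mod_def)
  have triv: "f \<in> autos_trivial_mod N" if "f \<in> auto G" "\<And>x. x \<in> carrier G \<Longrightarrow> N #> f x = N #> x" for f
    using that rcos_eq_iff [OF sub] auto_closed by (auto simp: autos_trivial_mod_def)
  have auto: "f \<in> auto G" if "f \<in> autos_trivial_mod N" for f
    using that by (simp add: autos_trivial_mod_def)
  have inv_auto: "inv\<^bsub>AutoGroup G\<^esub> f \<in> auto G" if "f \<in> auto G" for f
    using A.inv_closed that by (simp add: carrier_AutoGroup)
  have mult_auto: "f \<otimes>\<^bsub>AutoGroup G\<^esub> g \<in> auto G" if "f \<in> auto G" "g \<in> auto G" for f g
    using A.m_closed that by (simp add: carrier_AutoGroup)
  show ?thesis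
  proof (rule A.normal_invI)
    show "subgroup (autos_trivial_mod N) (AutoGroup G)"
    proof (rule A.subgroupI)
      show "autos_trivial_mod N \<subseteq> carrier (AutoGroup G)"
        by (auto simp: carrier_AutoGroup auto)
      show "autos_trivial_mod N \<noteq> {}"
        using triv [of "\<one>\<^bsub>AutoGroup G\<^esub>"] A.one_closed by (auto simp: carrier_AutoGroup one_AutoGroup)
      show "inv\<^bsub>AutoGroup G\<^esub> f \<in> autos_trivial_mod N" if f: "f \<in> autos_trivial_mod N" for f
      proof (rule triv)
        fix x assume "x \<in> carrier G"
        then obtain y where "y \<in> carrier G" "x = f y"
          using auto_surj [OF auto [OF f]] by blast
        then show "N #> (inv\<^bsub>AutoGroup G\<^esub> f) x = N #> x"
          using inv_AutoGroup_apply [OF auto [OF f]] cos [OF f] by simp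
      qed (use f inv_auto auto in blast)
      show "f \<otimes>\<^bsub>AutoGroup G\<^esub> g \<in> autos_trivial_mod N"
        if "f \<in> autos_trivial_mod N" "g \<in> autos_trivial_mod N" for f g
        by (rule triv) (use that in \<open>simp_all add: mult_auto auto AutoGroup_mult cos auto_closed\<close>)
    qed
  next
    fix g f assume g': "g \<in> carrier (AutoGroup G)" and f: "f \<in> autos_trivial_mod N"
    then have g: "g \<in> auto G"
      by (simp add: carrier_AutoGroup)
    show "g \<otimes>\<^bsub>AutoGroup G\<^esub> f \<otimes>\<^bsub>AutoGroup G\<^esub> inv\<^bsub>AutoGroup G\<^esub> g \<in> autos_trivial_mod N"
      unfolding autos_trivial_mod_def
    proof (intro CollectI conjI ballI)
      show "g \<otimes>\<^bsub>AutoGroup G\<^esub> f \<otimes>\<^bsub>AutoGroup G\<^esub> inv\<^bsub>AutoGroup G\<^esub> g \<in> auto G"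
        by (intro mult_auto g auto f inv_auto)
      fix x assume "x \<in> carrier G"
      then obtain y where y: "y \<in> carrier G" "x = g y"
        using auto_surj [OF g] by blast
      have "f y \<in> N #> y"
        using f y by (simp add: autos_trivial_mod_def)
      then obtain n where n: "n \<in> N" "f y = n \<otimes> y"
        by (auto simp: r_coset_def)
      then have "n \<in> carrier G"
        using subgroup.mem_carrier [OF sub] by blast
      then have "(g \<otimes>\<^bsub>AutoGroup G\<^esub> f \<otimes>\<^bsub>AutoGroup G\<^esub> inv\<^bsub>AutoGroup G\<^esub> g) x = g n \<otimes> x"
        using y n f g
        by (simp add: AutoGroup_mult mult_auto inv_auto auto auto_closed inv_AutoGroup_apply auto_mult)
      then show "(g \<otimes>\<^bsub>AutoGroup G\<^esub> f \<otimes>\<^bsub>AutoGroup G\<^esub> inv\<^bsub>AutoGroup G\<^esub> g) x \<in> N #> x"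
        using char [OF g n(1)] by (auto simp: r_coset_def)
    qed
  qed
qed

end

section \<open>Computations in coordinates\<close>

context K_parameters
begin

text \<open>Modulo the center \<open>\<langle>a\<^bsup>2q\<^esup>, b\<^bsup>2q\<^esup>\<rangle>\<close> the product of \<open>K\<close> is that of an integer Heisenberg group,
  in which the exponents of \<open>a\<close> and \<open>b\<close> matter modulo \<open>2 q\<close> and that of \<open>c\<close> modulo \<open>q\<close>.\<close>

fun heis :: "int \<times> int \<times> int \<Rightarrow> int \<times> int \<times> int \<Rightarrow> int \<times> int \<times> int" where
  "heis (i, j, k) (i', j', k') = (i + i', j + j', k + k' - j * i')"

fun redZ :: "int \<times> int \<times> int \<Rightarrow> int \<times> int \<times> int" where
  "redZ (i, j, k) = (i mod (2 * q), j mod (2 * q), k mod q)"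

lemma redZ_eq_iff:
  "redZ (i, j, k) = redZ (i', j', k') \<longleftrightarrow> 2 * q dvd i - i' \<and> 2 * q dvd j - j' \<and> q dvd k - k'"
  by (simp add: mod_eq_dvd_iff)

lemma redZ_mul: "redZ (mul p r) = redZ (heis p r)"
proof (cases p; cases r)
  fix i j k i' j' k' assume "p = (i, j, k)" "r = (i', j', k')"
  then show ?thesis
    by (simp add: redZ_eq_iff mult.assoc del: redZ.simps)
qed

lemma redZ_heis_cong:
  assumes "redZ p = redZ p'" "redZ r = redZ r'"
  shows "redZ (heis p r) = redZ (heis p' r')"
proof (cases p; cases p'; cases r; cases r')
  fix i j k i' j' k' I J K I' J' K'
  assume eqs: "p = (i, j, k)" "p' = (i', j', k')" "r = (I, J, K)" "r' = (I', J', K')"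
  have Q: "2 * q dvd i - i'" "2 * q dvd j - j'" "2 * q dvd I - I'" "2 * q dvd J - J'"
      "[k = k'] (mod q)" "[K = K'] (mod q)"
    using assms unfolding eqs redZ_eq_iff cong_iff_dvd_diff by auto
  then have q: "[j = j'] (mod q)" "[I = I'] (mod q)"
    by (auto simp: cong_iff_dvd_diff dest: dvd_mult_right)
  have "2 * q dvd (i + I) - (i' + I')" "2 * q dvd (j + J) - (j' + J')"
    using Q by (metis add_diff_add dvd_add)+
  moreover have "[k + K - j * I = k' + K' - j' * I'] (mod q)"
    by (intro cong_add cong_diff cong_mult q Q)
  ultimately show ?thesis
    unfolding eqs heis.simps redZ_eq_iff cong_iff_dvd_diff by simp
qed

lemma cong_mod_imp_redZ: "cong_mod p r \<Longrightarrow> redZ p = redZ r"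
proof (cases p; cases r)
  fix i j k i' j' k' assume "cong_mod p r" "p = (i, j, k)" "r = (i', j', k')"
  then show ?thesis
    by (auto simp: redZ_eq_iff simp del: redZ.simps dest: dvd_mult_left)
qed

text \<open>The endomorphism of the integer Heisenberg group with \<open>a \<mapsto> P\<close> and \<open>b \<mapsto> P'\<close>, which sends \<open>c\<close> to the
  power of \<open>c\<close> with the determinant as exponent.\<close>

fun heis_endo ::
    "int \<times> int \<times> int \<Rightarrow> int \<times> int \<times> int \<Rightarrow> int \<times> int \<times> int \<Rightarrow> int \<times> int \<times> int" where
  "heis_endo (i, j, k) (i', j', k') (r, s, u) =
    (r * i + s * i', r * j + s * j',
     r * k + s * k' - tri r * i * j - tri s * i' * j' - r * s * j * i' + u * (i * j' - j * i'))"

lemma heis_endo_heis: "heis_endo P P' (heis x y) = heis (heis_endo P P' x) (heis_endo P P' y)"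
  by (cases P; cases P'; cases x; cases y) (simp add: tri_add algebra_simps)

lemma redZ_heis_endo_cong:
  assumes "redZ x = redZ y" "redZ P = redZ R" "redZ P' = redZ R'"
  shows "redZ (heis_endo P P' x) = redZ (heis_endo R R' y)"
proof (cases P; cases P'; cases R; cases R'; cases x; cases y)
  fix i j k i' j' k' I J K I' J' K' r s u r' s' u'
  assume eqs: "P = (i, j, k)" "P' = (i', j', k')" "R = (I, J, K)" "R' = (I', J', K')"
    "x = (r, s, u)" "y = (r', s', u')"
  have Q: "2 * q dvd r - r'" "2 * q dvd s - s'" "2 * q dvd i - I" "2 * q dvd j - J"
      "2 * q dvd i' - I'" "2 * q dvd j' - J'"
      "[u = u'] (mod q)" "[k = K] (mod q)" "[k' = K'] (mod q)"
    using assms unfolding eqs redZ_eq_iff cong_iff_dvd_diff by auto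
  then have q: "[r = r'] (mod q)" "[s = s'] (mod q)" "[i = I] (mod q)" "[j = J] (mod q)"
      "[i' = I'] (mod q)" "[j' = J'] (mod q)"
    by (auto simp: cong_iff_dvd_diff dest: dvd_mult_right)
  have "[r * i + s * i' = r' * I + s' * I'] (mod 2 * q)" "[r * j + s * j' = r' * J + s' * J'] (mod 2 * q)"
    using Q(1-6) by (auto simp flip: cong_iff_dvd_diff intro!: cong_add cong_mult)
  moreover have "[r * k + s * k' - tri r * i * j - tri s * i' * j' - r * s * j * i' + u * (i * j' - j * i')
    = r' * K + s' * K' - tri r' * I * J - tri s' * I' * J' - r' * s' * J * I' + u' * (I * J' - J * I')] (mod q)"
    by (intro cong_add cong_diff cong_mult q Q tri_cong)
  ultimately show ?thesis
    unfolding eqs heis_endo.simps redZ_eq_iff cong_iff_dvd_diff by simp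
qed

text \<open>The factors \<open>a\<^bsup>2qx\<^esup>\<close> and \<open>b\<^bsup>2qy\<^esup>\<close> are central. Only \<open>c\<^sup>d\<close> can leave a correction, namely when it stands on
  the left and has to be moved past \<open>a\<^sup>i b\<^sup>j\<close>.\<close>

lemma cong_mod_mul_central_c:
  "cong_mod (mul (i, j, k) (2 * q * x, 2 * q * y, d)) (i + 2 * q * x, j + 2 * q * y, k + d)"
  "cong_mod (mul (2 * q * x, 2 * q * y, d) (i, j, k))
    (i + 2 * q * x - 2 * q * l * d * i, j + 2 * q * y + 2 * q * l * d * j, k + d)"
proof -
  have tri: "tri (2 * q * u) = q * (u * (2 * q * u - 1))" for u
    using tri_double [of "q * u"] by (simp add: mult.assoc)
  show "cong_mod (mul (i, j, k) (2 * q * x, 2 * q * y, d)) (i + 2 * q * x, j + 2 * q * y, k + d)"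
    unfolding mul.simps cong_mod.simps tri
  proof (intro conjI)
    show "2 * q * q dvd i + 2 * q * x
        + 2 * q * l * (j * (q * (x * (2 * q * x - 1))) - k * (2 * q * x)) - (i + 2 * q * x)"
      by (rule dvdI [of _ _ "l * (j * x * (2 * q * x - 1) - 2 * k * x)"]) (simp add: algebra_simps)
    show "2 * q * q dvd j + 2 * q * y
        + 2 * q * l * (k * (2 * q * y) - 2 * q * x * tri j - 2 * q * x * j * (2 * q * y))
        - (j + 2 * q * y)"
      by (rule dvdI [of _ _ "l * (2 * k * y - 2 * x * tri j - 4 * q * x * j * y)"])
        (simp add: algebra_simps)
  qed (simp add: mult.assoc)
  show "cong_mod (mul (2 * q * x, 2 * q * y, d) (i, j, k))
      (i + 2 * q * x - 2 * q * l * d * i, j + 2 * q * y + 2 * q * l * d * j, k + d)"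
    unfolding mul.simps cong_mod.simps tri
  proof (intro conjI)
    show "2 * q * q dvd 2 * q * x + i + 2 * q * l * (2 * q * y * tri i - d * i)
        - (i + 2 * q * x - 2 * q * l * d * i)"
      by (rule dvdI [of _ _ "2 * l * y * tri i"]) (simp add: algebra_simps)
    show "2 * q * q dvd 2 * q * y + j
        + 2 * q * l * (d * j - i * (q * (y * (2 * q * y - 1))) - i * (2 * q * y) * j)
        - (j + 2 * q * y + 2 * q * l * d * j)"
      by (rule dvdI [of _ _ "- l * i * y * (2 * q * y - 1) - 2 * l * i * y * j"])
        (simp add: algebra_simps)
  qed (simp add: mult.assoc)
qed

lemma coprime_l_q: "coprime l q"
  using odd_l by (simp add: q_def)

lemma double_q_dvd_iff: "2 * q * q dvd 2 * q * x \<longleftrightarrow> q dvd x"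
proof -
  have "2 * q \<noteq> 0"
    using less_imp_neq [OF q_pos] by simp
  then show ?thesis
    by (simp only: dvd_mult_cancel_left simp_thms)
qed

lemma coprime_two_power_odd: "odd (d :: int) \<Longrightarrow> coprime (2 * q) d" "odd d \<Longrightarrow> coprime q d"
  by (simp_all add: q_def)

lemma dvd_twist_iff: "2 * q * q dvd 2 * q * l * u \<longleftrightarrow> q dvd u"
proof -
  have "2 * q * q dvd 2 * q * l * u \<longleftrightarrow> q dvd l * u"
    using q_pos by (simp add: mult.assoc less_imp_neq [symmetric])
  also have "\<dots> \<longleftrightarrow> q dvd u"
    using coprime_l_q by (simp add: coprime_commute coprime_dvd_mult_right_iff)
  finally show ?thesis .
qed

end

context K_coordinates
begin

abbreviation gen_a where "gen_a \<equiv> E (1, 0, 0)"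
abbreviation gen_b where "gen_b \<equiv> E (0, 1, 0)"

lemma E_closed [simp]: "E p \<in> carrier G"
  by (simp add: carrier_eq)

lemma E_cong: "cong_mod p r \<Longrightarrow> E p = E r"
  by (simp add: E_eq_iff)

lemma E_cases:
  assumes "x \<in> carrier G"
  obtains i j k where "x = E (i, j, k)"
  using assms unfolding carrier_eq by auto

lemma one_eq: "\<one> = E (0, 0, 0)"
proof -
  have "E (0, 0, 0) \<otimes> E (0, 0, 0) = E (0, 0, 0)"
    by (simp add: E_mult)
  then show ?thesis
    using r_cancel_one E_closed by metis
qed

lemma finite_carrier: "finite (carrier G)"
proof -
  have "carrier G \<subseteq> E ` ({0..<2 * q * q} \<times> {0..<2 * q * q} \<times> {0..<q})"
  proof
    fix x assume "x \<in> carrier G"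
    then obtain i j k where "x = E (i, j, k)"
      by (rule E_cases)
    then have "x = E (red (i, j, k))"
      using E_cong cong_mod_red by simp
    moreover have "2 * q * q > 0"
      using q_pos by simp
    ultimately show "x \<in> E ` ({0..<2 * q * q} \<times> {0..<2 * q * q} \<times> {0..<q})"
      by simp
  qed
  then show ?thesis
    by (rule finite_subset) simp
qed

definition coord where
  "coord x = (SOME p. x = E p)"

lemma E_coord: "x \<in> carrier G \<Longrightarrow> E (coord x) = x"
  unfolding coord_def carrier_eq by (metis (mono_tags, lifting) imageE someI)

lemma cong_mod_coord_E: "cong_mod (coord (E p)) p"
  using E_coord [OF E_closed] by (simp add: E_eq_iff)

lemma redZ_coord_E: "redZ (coord (E p)) = redZ p"
  by (rule cong_mod_imp_redZ) (rule cong_mod_coord_E)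

lemma redZ_coord_mult:
  assumes "x \<in> carrier G" "y \<in> carrier G"
  shows "redZ (coord (x \<otimes> y)) = redZ (heis (coord x) (coord y))"
proof -
  have "x \<otimes> y = E (mul (coord x) (coord y))"
    using assms by (simp add: E_coord flip: E_mult)
  then show ?thesis
    by (simp add: redZ_coord_E redZ_mul)
qed

text \<open>This is induction over the submonoid generated by \<open>a\<close> and \<open>b\<close>: in a finite group it contains the inverses
  of \<open>a\<close> and \<open>b\<close>, hence the commutator \<open>c\<close> and all normal forms.\<close>

lemma triple_induct:
  assumes resp: "\<And>p r. cong_mod p r \<Longrightarrow> Q p \<Longrightarrow> Q r"
    and mul: "\<And>p r. Q p \<Longrightarrow> Q r \<Longrightarrow> Q (mul p r)"
    and a: "Q (1, 0, 0)" and b: "Q (0, 1, 0)"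
  shows "Q p"
proof -
  have nat: "Q (int n + 1, 0, 0)" "Q (0, int n + 1, 0)" for n
  proof (induction n)
    case (Suc n)
    show "Q (int (Suc n) + 1, 0, 0)" "Q (0, int (Suc n) + 1, 0)"
      using mul [OF Suc(1) a] mul [OF Suc(2) b] by (simp_all add: add.commute)
  qed (use a b in simp_all)
  have pos: "\<exists>n. M dvd int n + 1 - i" if "M > 0" for M i :: int
  proof
    have "int (nat ((i - 1) mod M)) = i - 1 - M * ((i - 1) div M)"
      using that by (simp add: minus_mult_div_eq_mod)
    then have "int (nat ((i - 1) mod M)) + 1 - i = - (M * ((i - 1) div M))"
      by simp
    then show "M dvd int (nat ((i - 1) mod M)) + 1 - i"
      by simp
  qed
  have N: "2 * q * q > 0"
    using q_pos by simp
  have A: "Q (i, 0, 0)" for i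
    using pos [OF N, of i] resp [OF _ nat(1)] by force
  have B: "Q (0, i, 0)" for i
    using pos [OF N, of i] resp [OF _ nat(2)] by force
  have "mul (mul (mul (- 1, 0, 0) (0, - 1, 0)) (1, 0, 0)) (0, 1, 0) = (0, 0, 1)"
    by (simp add: tri_def)
  then have c: "Q (0, 0, 1)"
    using mul A B by metis
  have "Q (0, 0, int n + 1)" for n
  proof (induction n)
    case (Suc n)
    show ?case
      using mul [OF Suc c] by (simp add: add.commute)
  qed (use c in simp)
  then have C: "Q (0, 0, i)" for i
    using pos [OF q_pos, of i] resp by force
  obtain i j k where p: "p = (i, j, k)"
    by (cases p)
  have "mul (mul (i, 0, 0) (0, j, 0)) (0, 0, k) = p"
    by (simp add: p)
  then show ?thesis
    using mul [OF mul [OF A B] C] by metis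
qed

lemma homs_eqI:
  assumes f: "f \<in> hom G G" and g: "g \<in> hom G G" and "f gen_a = g gen_a" "f gen_b = g gen_b"
    and x: "x \<in> carrier G"
  shows "f x = g x"
proof -
  have "f (E p) = g (E p)" for p
  proof (induction p rule: triple_induct)
    case (2 p r)
    have "f (E p \<otimes> E r) = g (E p \<otimes> E r)"
      using 2 hom_mult [OF f] hom_mult [OF g] by simp
    then show ?case by (simp add: E_mult)
  qed (use assms E_cong in metis)+
  then show ?thesis
    using x unfolding carrier_eq by auto
qed

text \<open>Both sides are homomorphisms into \<open>K/Z(K)\<close> with the same values at \<open>a\<close> and \<open>b\<close>.\<close>

lemma redZ_endo:
  assumes f: "f \<in> hom G G" and fa: "f gen_a = E P" and fb: "f gen_b = E P'"
  shows "redZ (coord (f (E x))) = redZ (heis_endo P P' x)"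
proof (induction x rule: triple_induct)
  case (1 p r)
  then show ?case
    using E_cong cong_mod_imp_redZ redZ_heis_endo_cong [OF _ refl refl] by metis
next
  case (2 p r)
  have closed: "f (E s) \<in> carrier G" for s
    using f by (auto simp: hom_def)
  have "f (E (mul p r)) = f (E p) \<otimes> f (E r)"
    using hom_mult [OF f] by (simp flip: E_mult)
  then have "redZ (coord (f (E (mul p r)))) = redZ (heis (coord (f (E p))) (coord (f (E r))))"
    using closed by (simp add: redZ_coord_mult)
  also have "\<dots> = redZ (heis (heis_endo P P' p) (heis_endo P P' r))"
    using 2 by (rule redZ_heis_cong)
  also have "\<dots> = redZ (heis_endo P P' (mul p r))"
    unfolding heis_endo_heis [symmetric] by (rule redZ_heis_endo_cong [OF _ refl refl]) (simp only: redZ_mul)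
  finally show ?case .
next
  case 3
  show ?case by (cases P; cases P') (simp add: fa redZ_coord_E del: redZ.simps)
next
  case 4
  show ?case by (cases P; cases P') (simp add: fb redZ_coord_E del: redZ.simps)
qed

end

section \<open>Endomorphisms of \<open>K\<close>\<close>

context K_coordinates
begin

text \<open>The sum of the corrections that arise when \<open>a\<^sup>i b\<^sup>j c\<^sup>k\<close> is multiplied \<open>n\<close> times by itself: the \<open>r\<close>-th
  correction is quadratic in \<open>r\<close>, which leads to the binomial coefficients.\<close>

lemma E_nat_pow:
  "E (i, j, k) [^] (n :: nat) =
    E (int n * i + 2 * q * l *
          (- int (n choose 2) * k * i + int (n choose 3) * i * i * j + int (n choose 2) * j * tri i),
       int n * j + 2 * q * l *
          (int (n choose 2) * k * j - int (n choose 3) * i * j * j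
            - i * (int (n choose 2) * tri j + int (n choose 3) * j * j) - int (n choose 2) * i * j * j),
       int n * k - int (n choose 2) * i * j)"
proof (induction n)
  case 0
  show ?case by (simp add: one_eq binomial_eq_0)
next
  case (Suc n)
  define c2 c3 where "c2 = int (n choose 2)" and "c3 = int (n choose 3)"
  define P where "P = - c2 * k * i + c3 * i * i * j + c2 * j * tri i"
  define R where "R = c2 * k * j - c3 * i * j * j - i * (c2 * tri j + c3 * j * j) - c2 * i * j * j"
  have c2_Suc: "int (Suc n choose 2) = c2 + int n" and c3_Suc: "int (Suc n choose 3) = c3 + c2"
    by (simp_all add: c2_def c3_def numeral_2_eq_2 numeral_3_eq_3)
  have tri_nj: "tri (int n * j) = int n * tri j + c2 * j * j"
    by (simp add: tri_mult c2_def int_choose_two)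
  obtain w where w: "tri (int n * j + 2 * q * l * R) = tri (int n * j) + q * w"
    using tri_add_double [of "int n * j" "q * l * R"] by (auto simp: mult.assoc)
  have "E (i, j, k) [^] Suc n = E (mul (int n * i + 2 * q * l * P, int n * j + 2 * q * l * R,
      int n * k - c2 * i * j) (i, j, k))"
    unfolding P_def R_def c2_def c3_def by (simp only: nat_pow_Suc Suc E_mult)
  also have "\<dots> = E (int (Suc n) * i + 2 * q * l *
        (- (c2 + int n) * k * i + (c3 + c2) * i * i * j + (c2 + int n) * j * tri i),
      int (Suc n) * j + 2 * q * l *
        ((c2 + int n) * k * j - (c3 + c2) * i * j * j
            - i * ((c2 + int n) * tri j + (c3 + c2) * j * j) - (c2 + int n) * i * j * j),
      int (Suc n) * k - (c2 + int n) * i * j)"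
    unfolding E_eq_iff mul.simps cong_mod.simps w tri_nj
  proof (intro conjI)
    show "2 * q * q dvd int n * i + 2 * q * l * P + i
        + 2 * q * l * ((int n * j + 2 * q * l * R) * tri i - (int n * k - c2 * i * j) * i)
      - (int (Suc n) * i + 2 * q * l *
        (- (c2 + int n) * k * i + (c3 + c2) * i * i * j + (c2 + int n) * j * tri i))"
      by (rule dvdI [of _ _ "2 * l * l * R * tri i"]) (simp add: P_def algebra_simps)
    show "2 * q * q dvd int n * j + 2 * q * l * R + j
        + 2 * q * l * ((int n * k - c2 * i * j) * j - i * (int n * tri j + c2 * j * j + q * w)
            - i * (int n * j + 2 * q * l * R) * j)
      - (int (Suc n) * j + 2 * q * l *
        ((c2 + int n) * k * j - (c3 + c2) * i * j * j
            - i * ((c2 + int n) * tri j + (c3 + c2) * j * j) - (c2 + int n) * i * j * j))"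
      by (rule dvdI [of _ _ "l * (- i * w - 2 * l * i * R * j)"]) (simp add: R_def algebra_simps)
    show "q dvd int n * k - c2 * i * j + k - (int n * j + 2 * q * l * R) * i
        - (int (Suc n) * k - (c2 + int n) * i * j)"
      by (rule dvdI [of _ _ "- 2 * l * R * i"]) (simp add: algebra_simps)
  qed
  finally show ?case
    unfolding c2_Suc c3_Suc .
qed

text \<open>Both \<open>2q choose 2\<close> and \<open>2q choose 3\<close> are divisible by \<open>q\<close>, so that the corrections in \<open>E_nat_pow\<close> vanish.\<close>

lemma E_pow_2q: "E (i, j, k) [^] (2 * q) = E (2 * q * i, 2 * q * j, 0)"
proof -
  define n where "n = nat (2 * q)"
  have n: "int n = 2 * q"
    using q_pos by (simp add: n_def less_imp_le)
  define c2 c3 where "c2 = int (n choose 2)" and "c3 = int (n choose 3)"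
  have c2: "c2 = q * (2 * q - 1)"
    by (simp add: c2_def int_choose_two n tri_double)
  have "3 * (n choose 3) = (n - 2) * (n choose 2)"
    using binomial_absorb_comp [of n 2] binomial_absorption [of 2 n]
    by (cases n) (simp_all add: numeral_2_eq_2 numeral_3_eq_3 algebra_simps)
  then have "3 * c3 = int (n - 2) * c2"
    unfolding c2_def c3_def by (metis of_nat_mult of_nat_numeral)
  then have "q dvd 3 * c3"
    by (simp add: c2)
  moreover have "coprime q 3"
    by (simp add: q_def)
  ultimately have "q dvd c3"
    by (simp add: coprime_dvd_mult_right_iff)
  then obtain z where z: "c3 = q * z" ..
  have "E (i, j, k) [^] (2 * q) = E (i, j, k) [^] n"
    unfolding n [symmetric] by (rule int_pow_int)
  also have "\<dots> = E (2 * q * i, 2 * q * j, 0)"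
    unfolding E_nat_pow c2_def [symmetric] c3_def [symmetric] n c2 z E_eq_iff cong_mod.simps
  proof (intro conjI)
    show "2 * q * q dvd 2 * q * i + 2 * q * l * (- (q * (2 * q - 1)) * k * i + q * z * i * i * j
        + q * (2 * q - 1) * j * tri i) - 2 * q * i"
      by (rule dvdI [of _ _ "l * (- (2 * q - 1) * k * i + z * i * i * j + (2 * q - 1) * j * tri i)"])
        (simp add: algebra_simps)
    show "2 * q * q dvd 2 * q * j + 2 * q * l * (q * (2 * q - 1) * k * j - q * z * i * j * j
        - i * (q * (2 * q - 1) * tri j + q * z * j * j) - q * (2 * q - 1) * i * j * j) - 2 * q * j"
      by (rule dvdI [of _ _ "l * ((2 * q - 1) * k * j - z * i * j * j
          - i * ((2 * q - 1) * tri j + z * j * j) - (2 * q - 1) * i * j * j)"])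
        (simp add: algebra_simps)
    show "q dvd 2 * q * k - q * (2 * q - 1) * i * j - 0"
      by simp
  qed
  finally show ?thesis .
qed

lemma E_central_c_pow:
  "E (2 * q * x, 2 * q * y, d) [^] (n :: int) = E (2 * q * (x * n), 2 * q * (y * n), d * n)"
proof -
  have "E (2 * q * (x * (n + n')), 2 * q * (y * (n + n')), d * (n + n')) =
      E (2 * q * (x * n), 2 * q * (y * n), d * n) \<otimes> E (2 * q * (x * n'), 2 * q * (y * n'), d * n')"
    for n n'
    unfolding E_mult
    using E_cong [OF cong_mod_mul_central_c(1) [of "2 * q * (x * n)" "2 * q * (y * n)" "d * n"
          "x * n'" "y * n'" "d * n'"]]
    by (simp add: distrib_left)
  then show ?thesis
    using additive_eq_int_pow [of "\<lambda>n. E (2 * q * (x * n), 2 * q * (y * n), d * n)" n] by simp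
qed

lemma E_pow_alpha: "E (i, j, k) [^] (1 + 2 * q * l) = E (i + 2 * q * l * i, j + 2 * q * l * j, k)"
proof -
  have "E (i, j, k) [^] (1 + 2 * q * l) = E (i, j, k) \<otimes> (E (i, j, k) [^] (2 * q)) [^] l"
    by (simp add: int_pow_mult int_pow_pow)
  also have "\<dots> = E (mul (i, j, k) (2 * q * (i * l), 2 * q * (j * l), 0))"
    using E_central_c_pow [of i j 0 l] by (simp add: E_pow_2q E_mult del: mul.simps)
  also have "\<dots> = E (i + 2 * q * (i * l), j + 2 * q * (j * l), k + 0)"
    by (rule E_cong) (rule cong_mod_mul_central_c)
  finally show ?thesis
    by (simp add: ac_simps)
qed

text \<open>Commutators are known modulo the center, which suffices for conjugating by them.\<close>

lemma group_comm_E: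
  obtains x y where "group_comm G (E (i, j, k)) (E (i', j', k')) = E (2 * q * x, 2 * q * y, i * j' - j * i')"
proof -
  let ?P = "(i, j, k)" and ?P' = "(i', j', k')"
  define z where "z = group_comm G (E ?P) (E ?P')"
  have "z \<in> carrier G"
    by (simp add: z_def group_comm_def)
  then obtain u v w where z: "z = E (u, v, w)"
    by (rule E_cases)
  have "z = inv (E ?P' \<otimes> E ?P) \<otimes> (E ?P \<otimes> E ?P')"
    by (simp add: z_def group_comm_def inv_mult_group m_assoc)
  then have "E ?P' \<otimes> E ?P \<otimes> E (u, v, w) = E ?P \<otimes> E ?P'"
    by (simp add: z)
  then have "redZ (mul (mul ?P' ?P) (u, v, w)) = redZ (mul ?P ?P')"
    unfolding E_mult E_eq_iff by (rule cong_mod_imp_redZ)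
  moreover have "redZ (mul (mul ?P' ?P) (u, v, w)) = redZ (heis (heis ?P' ?P) (u, v, w))"
    unfolding redZ_mul by (rule redZ_heis_cong) (simp_all only: redZ_mul)
  ultimately have "redZ (heis (heis ?P' ?P) (u, v, w)) = redZ (heis ?P ?P')"
    by (simp only: redZ_mul)
  then have dvd: "2 * q dvd u" "2 * q dvd v" "q dvd w - (i * j' - j * i') - (j + j') * u"
    unfolding heis.simps redZ_eq_iff by (simp_all add: algebra_simps)
  then have "q dvd w - (i * j' - j * i')"
    by (metis dvd_add_left_iff dvd_mult dvd_mult_right diff_add_cancel)
  moreover obtain x y where "u = 2 * q * x" "v = 2 * q * y"
    using dvd by (auto elim!: dvdE)
  ultimately have "z = E (2 * q * x, 2 * q * y, i * j' - j * i')"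
    unfolding z E_eq_iff by simp
  then show ?thesis
    using that by (simp add: z_def)
qed

text \<open>Conjugation by \<open>c\<^sup>d\<close> multiplies \<open>a\<^sup>i b\<^sup>j c\<^sup>k\<close> by \<open>a\<^bsup>2qldi\<^esup> b\<^bsup>-2qldj\<^esup>\<close>, and raising it to the power \<open>1 + 2ql\<close>
  multiplies it by \<open>a\<^bsup>2qli\<^esup> b\<^bsup>2qlj\<^esup>\<close>.\<close>

lemma conj_eq_pow_alpha_iff:
  assumes "w = E (2 * q * x, 2 * q * y, d)"
  shows "group_conj G (E (i, j, k)) w = E (i, j, k) [^] (1 + 2 ^ m * l)
    \<longleftrightarrow> q dvd i * (d - 1) \<and> q dvd j * (d + 1)"
proof -
  have "group_conj G (E (i, j, k)) w = E (i, j, k) [^] (1 + 2 ^ m * l) \<longleftrightarrow>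
      E (i, j, k) \<otimes> w = w \<otimes> E (i + 2 * q * l * i, j + 2 * q * l * j, k)"
    by (simp add: assms group_conj_def conj_eq_iff power_m E_pow_alpha)
  also have "E (i, j, k) \<otimes> w = E (i + 2 * q * x, j + 2 * q * y, k + d)"
    unfolding assms E_mult by (rule E_cong) (rule cong_mod_mul_central_c)
  also have "w \<otimes> E (i + 2 * q * l * i, j + 2 * q * l * j, k) =
      E (i + 2 * q * l * i + 2 * q * x - 2 * q * l * d * (i + 2 * q * l * i),
         j + 2 * q * l * j + 2 * q * y + 2 * q * l * d * (j + 2 * q * l * j), k + d)"
    unfolding assms E_mult by (rule E_cong) (rule cong_mod_mul_central_c)
  also have "E (i + 2 * q * x, j + 2 * q * y, k + d) = \<dots> \<longleftrightarrow>
      2 * q * q dvd 2 * q * l * (i * (d - 1) + q * (2 * l * d * i)) \<and>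
      2 * q * q dvd 2 * q * l * (- (j * (d + 1) + q * (2 * l * d * j)))"
    unfolding E_eq_iff cong_mod.simps by (simp add: algebra_simps)
  also have "\<dots> \<longleftrightarrow> q dvd i * (d - 1) \<and> q dvd j * (d + 1)"
    unfolding dvd_twist_iff dvd_minus_iff by (simp add: dvd_add_left_iff)
  finally show ?thesis .
qed

text \<open>The two relations between generators become the four congruences, the commutator having exponent \<open>D\<close> for
  the first and \<open>-D\<close> for the second one. The relations on orders hold for all elements.\<close>

lemma K_relators_iff:
  "K_relators m l G (E (i, j, k)) (E (i', j', k')) \<longleftrightarrow>
    q dvd i * (i * j' - j * i' - 1) \<and> q dvd j * (i * j' - j * i' + 1) \<and>
    q dvd i' * (i * j' - j * i' + 1) \<and> q dvd j' * (i * j' - j * i' - 1)"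
proof -
  obtain x y where w: "group_comm G (E (i, j, k)) (E (i', j', k')) = E (2 * q * x, 2 * q * y, i * j' - j * i')"
    by (rule group_comm_E)
  obtain x' y' where w': "group_comm G (E (i', j', k')) (E (i, j, k)) = E (2 * q * x', 2 * q * y', i' * j - j' * i)"
    by (rule group_comm_E)
  have order: "E (r, s, u) [^] (2 ^ (2 * m - 1) :: int) = \<one>" for r s u
  proof -
    have "E (r, s, u) [^] (2 * q * q) = E (2 * q * (r * q), 2 * q * (s * q), 0)"
      using E_central_c_pow [of r s 0 q] by (simp add: E_pow_2q flip: int_pow_pow)
    also have "\<dots> = \<one>"
      unfolding one_eq by (rule E_cong) simp
    finally show ?thesis by (simp only: power_2m_1)
  qed
  have order_c: "E (2 * q * x, 2 * q * y, i * j' - j * i') [^] (2 ^ (m - 1) :: int) = \<one>"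
    unfolding q_def [symmetric] E_central_c_pow one_eq by (rule E_cong) simp
  have "q dvd i' * (i' * j - j' * i - 1) \<longleftrightarrow> q dvd i' * (i * j' - j * i' + 1)"
    "q dvd j' * (i' * j - j' * i + 1) \<longleftrightarrow> q dvd j' * (i * j' - j * i' - 1)"
  proof -
    have "i' * (i' * j - j' * i - 1) = - (i' * (i * j' - j * i' + 1))"
      "j' * (i' * j - j' * i + 1) = - (j' * (i * j' - j * i' - 1))"
      by (simp_all add: algebra_simps)
    then show "q dvd i' * (i' * j - j' * i - 1) \<longleftrightarrow> q dvd i' * (i * j' - j * i' + 1)"
      "q dvd j' * (i' * j - j' * i + 1) \<longleftrightarrow> q dvd j' * (i * j' - j * i' - 1)"
      by (simp_all only: dvd_minus_iff)
  qed
  then show ?thesis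
    unfolding K_relators_def conj_eq_pow_alpha_iff [OF w] conj_eq_pow_alpha_iff [OF w']
    using order order_c by (simp add: w)
qed

text \<open>The values on the center follow from \<open>E_pow_2q\<close>, because the center consists of \<open>2q\<close>-th powers of
  \<open>a\<^sup>x b\<^sup>y\<close>; the formula is exact, unlike \<open>redZ_endo\<close>.\<close>

lemma endo_central:
  assumes f: "f \<in> hom G G" and "f gen_a = E (i, j, k)" "f gen_b = E (i', j', k')"
  shows "f (E (2 * q * x, 2 * q * y, 0)) = E (2 * q * (x * i + y * i'), 2 * q * (x * j + y * j'), 0)"
proof -
  interpret f: group_hom G G f
    using f by unfold_locales
  have gen: "f (E p [^] n) = f (E p) [^] n" for p and n :: int
    by (simp add: f.hom_int_pow)
  have "E (2 * q * x, 0, 0) = (gen_a [^] (2 * q)) [^] x" "E (0, 2 * q * y, 0) = (gen_b [^] (2 * q)) [^] y"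
    using E_central_c_pow [of 1 0 0 x] E_central_c_pow [of 0 1 0 y] by (simp_all add: E_pow_2q)
  then have fa: "f (E (2 * q * x, 0, 0)) = (E (i, j, k) [^] (2 * q)) [^] x"
    and fb: "f (E (0, 2 * q * y, 0)) = (E (i', j', k') [^] (2 * q)) [^] y"
    by (simp_all add: f.hom_int_pow assms)
  have "f (E (2 * q * x, 2 * q * y, 0)) = f (E (2 * q * x, 0, 0) \<otimes> E (0, 2 * q * y, 0))"
    by (simp add: E_mult)
  also have "\<dots> = f (E (2 * q * x, 0, 0)) \<otimes> f (E (0, 2 * q * y, 0))"
    by (rule f.hom_mult) simp_all
  also have "\<dots> = E (mul (2 * q * (i * x), 2 * q * (j * x), 0) (2 * q * (i' * y), 2 * q * (j' * y), 0))"
    using E_central_c_pow [of i j 0 x] E_central_c_pow [of i' j' 0 y]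
    by (simp add: fa fb E_pow_2q E_mult del: mul.simps)
  also have "\<dots> = E (2 * q * (i * x) + 2 * q * (i' * y), 2 * q * (j * x) + 2 * q * (j' * y), 0 + 0)"
    by (rule E_cong) (rule cong_mod_mul_central_c)
  finally show ?thesis
    by (simp add: algebra_simps)
qed

end

section \<open>The upper central series of \<open>K\<close>\<close>

context group
begin

definition center where
  "center = {x \<in> carrier G. \<forall>y\<in>carrier G. x \<otimes> y = y \<otimes> x}"

lemma center_normal: "center \<lhd> G"
proof (rule normal_invI)
  show "subgroup center G"
    unfolding center_def
  proof (rule subgroupI)
    let ?Z = "{x \<in> carrier G. \<forall>y\<in>carrier G. x \<otimes> y = y \<otimes> x}"
    fix x assume x: "x \<in> ?Z"
    then have x': "x \<in> carrier G"
      by simp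
    have "inv x \<otimes> y = y \<otimes> inv x" if "y \<in> carrier G" for y
    proof -
      have "inv x \<otimes> y = inv x \<otimes> (y \<otimes> x) \<otimes> inv x"
        using x' that by (simp add: m_assoc)
      also have "y \<otimes> x = x \<otimes> y"
        using x that by simp
      finally show ?thesis
        using x' that by (simp add: m_assoc)
    qed
    then show "inv x \<in> ?Z"
      using x by simp
    fix y assume "y \<in> ?Z"
    then have y: "y \<in> carrier G" "\<And>z. z \<in> carrier G \<Longrightarrow> y \<otimes> z = z \<otimes> y"
      by simp_all
    have "x \<otimes> y \<otimes> z = z \<otimes> (x \<otimes> y)" if "z \<in> carrier G" for z
    proof -
      have "x \<otimes> y \<otimes> z = (x \<otimes> z) \<otimes> y"
        using x' y that by (simp add: m_assoc)
      also have "x \<otimes> z = z \<otimes> x"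
        using x that by simp
      finally show ?thesis
        using x' y(1) that by (simp add: m_assoc)
    qed
    then show "x \<otimes> y \<in> ?Z"
      using x' y(1) by simp
  qed auto
  show "x \<otimes> h \<otimes> inv x \<in> center" if "x \<in> carrier G" "h \<in> center" for x h
  proof -
    have "x \<otimes> h = h \<otimes> x" "h \<in> carrier G"
      using that by (simp_all add: center_def)
    then have "x \<otimes> h \<otimes> inv x = h"
      using that(1) by (simp add: m_assoc)
    then show ?thesis
      using that by simp
  qed
qed

lemma upper_central_1: "upper_central G 1 = center"
proof -
  have "upper_central G 1 = {x \<in> carrier G. \<forall>y\<in>carrier G. {\<one>} #> (x \<otimes> y) = {\<one>} #> (y \<otimes> x)}"
    using upper_central_Suc [of 0] one_is_normal by simp
  also have "\<dots> = center"
    unfolding center_def by (intro Collect_cong conj_cong refl ball_cong) (simp add: r_coset_def)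
  finally show ?thesis .
qed

lemma auto_preserves_center:
  assumes f: "f \<in> auto G" and x: "x \<in> center"
  shows "f x \<in> center"
proof -
  have x': "x \<in> carrier G"
    using x by (simp add: center_def)
  have "f x \<otimes> y = y \<otimes> f x" if y: "y \<in> carrier G" for y
  proof -
    obtain z where z: "z \<in> carrier G" "y = f z"
      using auto_surj [OF f y] by blast
    then have "x \<otimes> z = z \<otimes> x"
      using x by (simp add: center_def)
    then show ?thesis
      using auto_mult [OF f x' z(1)] auto_mult [OF f z(1) x'] z by simp
  qed
  then show ?thesis
    using auto_closed [OF f x'] by (simp add: center_def)
qed

lemma mult_inv_eq_one_iff:
  "x \<in> carrier G \<Longrightarrow> y \<in> carrier G \<Longrightarrow> x \<otimes> inv y = \<one> \<longleftrightarrow> x = y"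
  using inv_equality [of x "inv y"] by auto

end

lemma (in group_hom) kernel_coset_iff:
  assumes "x \<in> carrier G" "y \<in> carrier G"
  shows "x \<in> kernel G H h #> y \<longleftrightarrow> h x = h y"
proof -
  have "x \<in> kernel G H h #> y \<longleftrightarrow> x \<otimes> inv y \<in> kernel G H h"
    using subgroup.rcos_module [OF subgroup_kernel G.is_group assms(2,1)] .
  also have "\<dots> \<longleftrightarrow> h x = h y"
    using assms by (simp add: kernel_def H.mult_inv_eq_one_iff)
  finally show ?thesis .
qed

context K_coordinates
begin

lemma double_q_dvd_of_tri:
  assumes "q dvd tri x" "q dvd x"
  shows "2 * q dvd x"
proof -
  obtain w where w: "x = q * w"
    using assms(2) ..
  have "2 * q dvd 2 * tri x"
    using assms(1) by simp
  moreover have "2 * tri x = (x - 1) * x"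
    by (simp add: double_tri)
  ultimately have "2 * q dvd (x - 1) * x"
    by simp
  moreover have "coprime (2 * q) (x - 1)"
    using even_q w by (simp add: q_def)
  ultimately show ?thesis
    by (simp only: coprime_dvd_mult_right_iff)
qed

text \<open>Commutation with \<open>a\<close> and \<open>b\<close> modulo the center only makes \<open>i\<close> and \<open>j\<close> multiples of \<open>q\<close>; the correction
  terms \<open>2ql tri i\<close> and \<open>2ql tri j\<close> make them multiples of \<open>2q\<close>. Oddness of \<open>l\<close> enters here.\<close>

lemma E_in_center_iff: "E p \<in> center \<longleftrightarrow> redZ p = redZ (0, 0, 0)"
proof -
  obtain i j k where p: "p = (i, j, k)"
    by (cases p)
  show ?thesis
  proof
    assume "E p \<in> center"
    then have "E p \<otimes> gen_a = gen_a \<otimes> E p" "E p \<otimes> gen_b = gen_b \<otimes> E p"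
      by (simp_all add: center_def)
    then have "2 * q * q dvd 2 * q * l * k" "2 * q * q dvd 2 * q * l * tri j" "q dvd j"
      "2 * q * q dvd 2 * q * l * tri i" "q dvd i"
      by (simp_all add: p E_mult E_eq_iff algebra_simps)
    then show "redZ p = redZ (0, 0, 0)"
      unfolding p redZ_eq_iff using dvd_twist_iff double_q_dvd_of_tri by simp
  next
    assume "redZ p = redZ (0, 0, 0)"
    then obtain x y where "i = 2 * q * x" "j = 2 * q * y" "q dvd k"
      unfolding p redZ_eq_iff by (auto elim!: dvdE)
    then have Ep: "E p = E (2 * q * x, 2 * q * y, 0)"
      by (intro E_cong) (simp add: p)
    have "E p \<otimes> z = z \<otimes> E p" if carr: "z \<in> carrier G" for z
    proof -
      obtain r s u where z: "z = E (r, s, u)"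
        using carr by (rule E_cases)
      have "E p \<otimes> z = E (r + 2 * q * x - 2 * q * l * 0 * r, s + 2 * q * y + 2 * q * l * 0 * s, u + 0)"
        unfolding Ep z E_mult by (rule E_cong) (rule cong_mod_mul_central_c)
      also have "\<dots> = E (r + 2 * q * x, s + 2 * q * y, u + 0)"
        by simp
      also have "\<dots> = z \<otimes> E p"
        unfolding Ep z E_mult by (rule E_cong [symmetric]) (rule cong_mod_mul_central_c)
      finally show ?thesis .
    qed
    then show "E p \<in> center"
      by (simp add: center_def)
  qed
qed

lemma E_in_center_coset_iff: "E p \<in> center #> E r \<longleftrightarrow> redZ p = redZ r"
proof -
  obtain s where s: "E p \<otimes> inv (E r) = E s"
    by (metis E_closed E_coord inv_closed m_closed)
  then have "E s \<otimes> E r = E p"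
    by (metis E_closed inv_solve_right)
  then have p: "redZ p = redZ (heis s r)"
    unfolding E_mult E_eq_iff by (metis cong_mod_imp_redZ redZ_mul)
  have "E p \<in> center #> E r \<longleftrightarrow> E s \<in> center"
    using subgroup.rcos_module [OF normal_imp_subgroup [OF center_normal] is_group E_closed E_closed, of p r]
    by (simp add: s)
  also have "\<dots> \<longleftrightarrow> redZ s = redZ (0, 0, 0)"
    by (rule E_in_center_iff)
  also have "\<dots> \<longleftrightarrow> redZ (heis s r) = redZ r"
  proof (cases s; cases r)
    fix i j k i' j' k' assume eq: "s = (i, j, k)" "r = (i', j', k')"
    have "q dvd k - j * i' \<longleftrightarrow> q dvd k" if "2 * q dvd j"
    proof -
      have "q dvd j * i'"
        using dvd_mult_right [OF that] by simp
      then show ?thesis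
        by (metis diff_add_cancel dvd_add dvd_diff)
    qed
    moreover have "i + i' - i' = i" "j + j' - j' = j" "k + k' - j * i' - k' = k - j * i'"
      by simp_all
    ultimately show ?thesis
      unfolding eq heis.simps redZ_eq_iff diff_0_right by metis
  qed
  finally show ?thesis
    unfolding p .
qed

text \<open>\<open>K/Z\<^sub>2(K)\<close> is \<open>(\<int>/q)\<^sup>2\<close>, by reducing the exponents of \<open>a\<close> and \<open>b\<close>.\<close>

fun redab :: "int \<times> int \<times> int \<Rightarrow> int \<times> int" where
  "redab (i, j, k) = (i mod q, j mod q)"

lemma redab_eq_iff: "redab (i, j, k) = redab (i', j', k') \<longleftrightarrow> q dvd i - i' \<and> q dvd j - j'"
  by (simp add: mod_eq_dvd_iff)

lemma redZ_imp_redab: "redZ p = redZ r \<Longrightarrow> redab p = redab r"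
proof (cases p; cases r)
  fix i j k i' j' k' assume "redZ p = redZ r" "p = (i, j, k)" "r = (i', j', k')"
  then show ?thesis
    by (auto simp: redab_eq_iff redZ_eq_iff simp del: redZ.simps redab.simps dest: dvd_mult_right)
qed

lemma power_m_1: "2 ^ (m - Suc 0) = q"
  by (simp add: q_def)

lemma redab_group_hom:
  "group_hom G (Zmod (2 ^ (m - 1)) \<times>\<times> Zmod (2 ^ (m - 1))) (\<lambda>x. redab (coord x))"
proof -
  interpret H: group "Zmod (2 ^ (m - 1)) \<times>\<times> Zmod (2 ^ (m - 1))"
    by (simp add: DirProd_group)
  have "redab (coord (x \<otimes> y)) = redab (heis (coord x) (coord y))"
    if "x \<in> carrier G" "y \<in> carrier G" for x y
    using redZ_coord_mult [OF that] by (rule redZ_imp_redab)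
  moreover have "redab (heis p r) = redab p \<otimes>\<^bsub>Zmod (2 ^ (m - 1)) \<times>\<times> Zmod (2 ^ (m - 1))\<^esub> redab r" for p r
    by (cases p; cases r) (simp add: mod_add_eq power_m_1)
  moreover have "redab p \<in> carrier (Zmod (2 ^ (m - 1)) \<times>\<times> Zmod (2 ^ (m - 1)))" for p
    by (cases p) (simp add: carrier_integer_mod_group power_m_1)
  ultimately show ?thesis
    by unfold_locales (simp add: hom_def)
qed

definition Z2 where
  "Z2 = kernel G (Zmod (2 ^ (m - 1)) \<times>\<times> Zmod (2 ^ (m - 1))) (\<lambda>x. redab (coord x))"

lemma Z2_normal: "Z2 \<lhd> G"
  unfolding Z2_def by (rule group_hom.normal_kernel [OF redab_group_hom])

lemma redab_coord_E: "redab (coord (E p)) = redab p"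
  by (rule redZ_imp_redab) (rule redZ_coord_E)

lemma E_in_Z2_iff: "E p \<in> Z2 \<longleftrightarrow> redab p = redab (0, 0, 0)"
  by (simp add: Z2_def kernel_def redab_coord_E)

lemma E_in_Z2_coset_iff: "E p \<in> Z2 #> E r \<longleftrightarrow> redab p = redab r"
proof -
  interpret h: group_hom G "Zmod (2 ^ (m - 1)) \<times>\<times> Zmod (2 ^ (m - 1))" "\<lambda>x. redab (coord x)"
    by (rule redab_group_hom)
  show ?thesis
    unfolding Z2_def h.kernel_coset_iff [OF E_closed E_closed] by (simp add: redab_coord_E)
qed

text \<open>By the Heisenberg product, the commutator of \<open>a\<^sup>i b\<^sup>j c\<^sup>k\<close> with any element is, modulo the center, \<open>c\<close> to the
  power of a determinant in \<open>i\<close> and \<open>j\<close>.\<close>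

lemma upper_central_2: "upper_central G 2 = Z2"
proof -
  have "E p \<in> upper_central G 2 \<longleftrightarrow> E p \<in> Z2" for p
  proof -
    obtain i j k where p: "p = (i, j, k)"
      by (cases p)
    have comm: "redZ (mul p (i', j', k')) = redZ (mul (i', j', k') p) \<longleftrightarrow> q dvd j' * i - j * i'" for i' j' k'
      unfolding p redZ_mul heis.simps redZ_eq_iff by (simp add: algebra_simps)
    have "E p \<in> upper_central G (Suc 1) \<longleftrightarrow>
        (\<forall>y\<in>carrier G. center #> (E p \<otimes> y) = center #> (y \<otimes> E p))"
      using upper_central_Suc [of 1] center_normal unfolding upper_central_1 by simp
    also have "\<dots> \<longleftrightarrow> (\<forall>r. redZ (mul p r) = redZ (mul r p))"
      by (simp only: carrier_eq ball_simps E_mult E_in_center_coset_iff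
          rcos_eq_iff [OF normal_imp_subgroup [OF center_normal] E_closed E_closed])
    also have "\<dots> \<longleftrightarrow> q dvd i \<and> q dvd j"
    proof
      assume *: "\<forall>r. redZ (mul p r) = redZ (mul r p)"
      then show "q dvd i \<and> q dvd j"
        using comm [of 0 1 0] comm [of 1 0 0] by (simp del: redZ.simps mul.simps)
    next
      assume "q dvd i \<and> q dvd j"
      then have "q dvd j' * i - j * i'" for i' j'
        by simp
      then show "\<forall>r. redZ (mul p r) = redZ (mul r p)"
        using comm by (auto simp del: redZ.simps mul.simps)
    qed
    also have "\<dots> \<longleftrightarrow> E p \<in> Z2"
      unfolding E_in_Z2_iff p redab_eq_iff by simp
    finally show ?thesis
      by (simp only: numeral_2_eq_2 One_nat_def)
  qed
  moreover have "upper_central G 2 \<subseteq> carrier G" "Z2 \<subseteq> carrier G"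
    by (auto simp: numeral_2_eq_2 Z2_def kernel_def)
  ultimately show ?thesis
    unfolding carrier_eq by blast
qed

end

section \<open>Automorphisms of \<open>K\<close>\<close>

lemma (in group) hom_preserves_K_relators:
  assumes f: "f \<in> hom G G" and "x \<in> carrier G" "y \<in> carrier G" and rel: "K_relators m l G x y"
  shows "K_relators m l G (f x) (f y)"
proof -
  interpret f: group_hom G G f
    using f by unfold_locales
  have comm: "f (group_comm G u v) = group_comm G (f u) (f v)"
    and conj: "f (group_conj G u v) = group_conj G (f u) (f v)"
    if "u \<in> carrier G" "v \<in> carrier G" for u v
    using that by (simp_all add: group_comm_def group_conj_def)
  have closed: "group_comm G u v \<in> carrier G" if "u \<in> carrier G" "v \<in> carrier G" for u v
    using that by (simp add: group_comm_def)
  have pow: "f (u [^] n) = f u [^] n" if "u \<in> carrier G" for u and n :: int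
    using that by (simp add: f.hom_int_pow)
  show ?thesis
    unfolding K_relators_def
  proof (intro conjI)
    show "group_conj G (f x) (group_comm G (f x) (f y)) = f x [^] (1 + 2 ^ m * l)"
      using rel assms(2,3) by (simp add: K_relators_def closed flip: comm conj pow)
    show "group_conj G (f y) (group_comm G (f y) (f x)) = f y [^] (1 + 2 ^ m * l)"
      using rel assms(2,3) by (simp add: K_relators_def closed flip: comm conj pow)
    show "f x [^] (2 ^ (2 * m - 1) :: int) = \<one>" "f y [^] (2 ^ (2 * m - 1) :: int) = \<one>"
      "group_comm G (f x) (f y) [^] (2 ^ (m - 1) :: int) = \<one>"
      unfolding comm [OF assms(2,3), symmetric]
      using rel assms(2,3) closed by (simp_all add: K_relators_def flip: pow)
  qed
qed

context K_coordinates
begin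

lemma auto_in_hom: "f \<in> auto G \<Longrightarrow> f \<in> hom G G"
  by (simp add: auto_def)

lemma auto_redZ:
  assumes "f \<in> auto G" "f gen_a = E P" "f gen_b = E P'"
  shows "redZ (coord (f (E x))) = redZ (heis_endo P P' x)"
  using assms redZ_endo auto_in_hom by simp

text \<open>The determinant is a unit modulo \<open>2\<close> because an automorphism is onto, and the congruences
  are the defining relations of \<open>K\<close> for the images of the generators.\<close>

lemma auto_matrix:
  assumes f: "f \<in> auto G" and fa: "f gen_a = E (i, j, k)" and fb: "f gen_b = E (i', j', k')"
  shows "odd (i * j' - j * i')"
    and "q dvd i * (i * j' - j * i' - 1)" "q dvd j * (i * j' - j * i' + 1)"
    and "q dvd i' * (i * j' - j * i' + 1)" "q dvd j' * (i * j' - j * i' - 1)"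
proof -
  have surj: "\<exists>r s u. E p = f (E (r, s, u))" for p
    using auto_surj [OF f E_closed] E_cases by metis
  obtain r s u where a: "gen_a = f (E (r, s, u))"
    using surj by blast
  obtain r' s' u' where b: "gen_b = f (E (r', s', u'))"
    using surj by blast
  have "redZ (1, 0, 0) = redZ (heis_endo (i, j, k) (i', j', k') (r, s, u))"
    "redZ (0, 1, 0) = redZ (heis_endo (i, j, k) (i', j', k') (r', s', u'))"
    unfolding auto_redZ [OF f fa fb, symmetric] a [symmetric] b [symmetric]
    by (simp_all only: redZ_coord_E)
  then have "2 * q dvd 1 - (r * i + s * i')" "2 * q dvd 0 - (r * j + s * j')"
    "2 * q dvd 0 - (r' * i + s' * i')" "2 * q dvd 1 - (r' * j + s' * j')"
    unfolding heis_endo.simps redZ_eq_iff by simp_all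
  then have "even (1 - (r * i + s * i'))" "even (0 - (r * j + s * j'))"
      "even (1 - (r' * j + s' * j'))"
    by (blast intro: dvd_mult_left)+
  then have "odd ((r * i + s * i') * (r' * j + s' * j') - (r * j + s * j') * (r' * i + s' * i'))"
    by simp
  moreover have "(r * i + s * i') * (r' * j + s' * j') - (r * j + s * j') * (r' * i + s' * i')
      = (r * s' - s * r') * (i * j' - j * i')"
    by (simp add: algebra_simps)
  ultimately show "odd (i * j' - j * i')"
    by (metis even_mult_iff)
  have "K_relators m l G (f gen_a) (f gen_b)"
    using hom_preserves_K_relators [OF auto_in_hom [OF f] _ _ relators] by simp
  then show "q dvd i * (i * j' - j * i' - 1)" "q dvd j * (i * j' - j * i' + 1)"
    "q dvd i' * (i * j' - j * i' + 1)" "q dvd j' * (i * j' - j * i' - 1)"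
    unfolding fa fb K_relators_iff by simp_all
qed

text \<open>Conversely the relations give an endomorphism, which is injective: on \<open>K/Z(K)\<close> and on \<open>Z(K)\<close>
  it is given by a matrix of odd determinant.\<close>

lemma auto_exists:
  assumes odd: "odd (i * j' - j * i')"
    and rel: "q dvd i * (i * j' - j * i' - 1)" "q dvd j * (i * j' - j * i' + 1)"
      "q dvd i' * (i * j' - j * i' + 1)" "q dvd j' * (i * j' - j * i' - 1)"
  obtains f where "f \<in> auto G" "f gen_a = E (i, j, k)" "f gen_b = E (i', j', k')"
proof -
  let ?D = "i * j' - j * i'"
  obtain h where h: "h \<in> hom G G" "h gen_a = E (i, j, k)" "h gen_b = E (i', j', k')"
    using lift [OF E_closed E_closed] rel K_relators_iff by blast
  interpret h: group_hom G G h
    using h(1) by unfold_locales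
  have solve: "n dvd r \<and> n dvd s"
    if "coprime n ?D" "n dvd r * i + s * i'" "n dvd r * j + s * j'" for n r s
  proof -
    have "r * ?D = (r * i + s * i') * j' - (r * j + s * j') * i'"
      "s * ?D = (r * j + s * j') * i - (r * i + s * i') * j"
      by (simp_all add: algebra_simps)
    then have "n dvd r * ?D" "n dvd s * ?D"
      using that by simp_all
    then show ?thesis
      using that(1) by (simp add: coprime_dvd_mult_left_iff)
  qed
  have "inj_on h (carrier G)"
    unfolding h.inj_on_one_iff
  proof (intro allI impI)
    fix x assume "x \<in> carrier G" and hx: "h x = \<one>"
    then obtain r s u where x: "x = E (r, s, u)"
      using E_cases by blast
    have "redZ (heis_endo (i, j, k) (i', j', k') (r, s, u)) = redZ (0, 0, 0)"
      unfolding redZ_endo [OF h, symmetric] x [symmetric] hx one_eq by (rule redZ_coord_E)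
    then have rs: "2 * q dvd r * i + s * i'" "2 * q dvd r * j + s * j'"
      and u: "q dvd r * k + s * k' - tri r * i * j - tri s * i' * j' - r * s * j * i' + u * ?D"
      unfolding heis_endo.simps redZ_eq_iff by simp_all
    have r: "2 * q dvd r" and s: "2 * q dvd s"
      using solve [OF coprime_two_power_odd(1) [OF odd] rs] by blast+
    have "q dvd tri r" "q dvd tri s" "q dvd r" "q dvd s"
      using tri_cong [of r 0] tri_cong [of s 0] r s by (auto simp: cong_0_iff dest: dvd_mult_right)
    then have "q dvd r * k + s * k' - tri r * i * j - tri s * i' * j' - r * s * j * i'"
      by (simp add: mult.assoc)
    then have "q dvd u * ?D"
      using u by (simp only: dvd_add_right_iff)
    then have "q dvd u"
      using coprime_two_power_odd(2) [OF odd] by (simp only: coprime_dvd_mult_left_iff)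
    obtain y z where yz: "r = 2 * q * y" "s = 2 * q * z"
      using r s by (auto elim!: dvdE)
    have x': "x = E (2 * q * y, 2 * q * z, 0)"
      unfolding x yz by (rule E_cong) (simp add: \<open>q dvd u\<close>)
    have "E (2 * q * (y * i + z * i'), 2 * q * (y * j + z * j'), 0) = E (0, 0, 0)"
      using hx unfolding x' endo_central [OF h] one_eq .
    then have "q dvd y * i + z * i'" "q dvd y * j + z * j'"
      unfolding E_eq_iff cong_mod.simps diff_0_right double_q_dvd_iff by blast+
    then have "q dvd y \<and> q dvd z"
      by (rule solve [OF coprime_two_power_odd(2) [OF odd]])
    then show "x = \<one>"
      unfolding x' one_eq by (intro E_cong) (simp add: mult.assoc)
  qed
  moreover have "h ` carrier G \<subseteq> carrier G"
    using h.hom_closed by blast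
  ultimately have bij: "bij_betw h (carrier G) (carrier G)"
    unfolding bij_betw_def using endo_inj_surj [OF finite_carrier, of h] by blast
  have "restrict h (carrier G) \<in> auto G"
  proof -
    have "restrict h (carrier G) \<in> hom G G"
      by (rule homI) simp_all
    moreover have "bij_betw (restrict h (carrier G)) (carrier G) (carrier G)"
      using bij by simp
    ultimately show ?thesis
      by (simp add: auto_def Bij_def)
  qed
  then show ?thesis
    by (rule that) (simp_all add: h)
qed

text \<open>The elements \<open>x\<close> with \<open>f x\<close> in \<open>N x\<close> are closed under products because \<open>N\<close> is normal.\<close>

lemma auto_trivial_mod_iff:
  assumes N: "N \<lhd> G" and f: "f \<in> auto G"
  shows "f \<in> autos_trivial_mod N \<longleftrightarrow> f gen_a \<in> N #> gen_a \<and> f gen_b \<in> N #> gen_b"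
proof
  assume "f \<in> autos_trivial_mod N"
  then show "f gen_a \<in> N #> gen_a \<and> f gen_b \<in> N #> gen_b"
    by (simp add: autos_trivial_mod_def)
next
  assume gen: "f gen_a \<in> N #> gen_a \<and> f gen_b \<in> N #> gen_b"
  have sub: "subgroup N G"
    using N by (rule normal_imp_subgroup)
  have closed: "f (E p) \<in> carrier G" for p
    using f by (simp add: auto_closed)
  have "N #> f (E p) = N #> E p" for p
  proof (induction p rule: triple_induct)
    case (1 p r)
    then show ?case
      using E_cong by simp
  next
    case (2 p r)
    have "N #> f (E p \<otimes> E r) = (N #> f (E p)) <#> (N #> f (E r))"
      using N closed f by (simp add: auto_mult normal.rcos_sum)
    also have "\<dots> = N #> (E p \<otimes> E r)"
      using 2 N by (simp add: normal.rcos_sum)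
    finally show ?case
      by (simp add: E_mult)
  qed (use gen rcos_eq_iff [OF sub] closed in simp_all)
  then have "f (E p) \<in> N #> E p" for p
    using rcos_eq_iff [OF sub closed E_closed] by simp
  then show "f \<in> autos_trivial_mod N"
    using f unfolding autos_trivial_mod_def carrier_eq by auto
qed

lemma Aut_1_eq: "Aut_i 1 G = autos_trivial_mod center"
  using Aut_i_eq_autos_trivial_mod [of 1] center_normal unfolding upper_central_1 by simp

lemma Aut_2_eq: "Aut_i 2 G = autos_trivial_mod Z2"
  using Aut_i_eq_autos_trivial_mod [of 2] Z2_normal unfolding upper_central_2 by simp

lemma Aut_1_iff:
  assumes "f \<in> auto G" "f gen_a = E P" "f gen_b = E P'"
  shows "f \<in> Aut_i 1 G \<longleftrightarrow> redZ P = redZ (1, 0, 0) \<and> redZ P' = redZ (0, 1, 0)"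
  unfolding Aut_1_eq auto_trivial_mod_iff [OF center_normal assms(1)] assms(2,3) E_in_center_coset_iff ..

lemma Aut_2_iff:
  assumes "f \<in> auto G" "f gen_a = E P" "f gen_b = E P'"
  shows "f \<in> Aut_i 2 G \<longleftrightarrow> redab P = redab (1, 0, 0) \<and> redab P' = redab (0, 1, 0)"
  unfolding Aut_2_eq auto_trivial_mod_iff [OF Z2_normal assms(1)] assms(2,3) E_in_Z2_coset_iff ..

lemma auto_images:
  assumes "f \<in> auto G"
  obtains i j k i' j' k' where "f gen_a = E (i, j, k)" "f gen_b = E (i', j', k')"
proof -
  obtain i j k where "f gen_a = E (i, j, k)"
    using auto_closed [OF assms E_closed] by (rule E_cases)
  moreover obtain i' j' k' where "f gen_b = E (i', j', k')"
    using auto_closed [OF assms E_closed] by (rule E_cases)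
  ultimately show ?thesis
    by (rule that)
qed

lemma Aut_1_subset_Aut_2: "Aut_i 1 G \<subseteq> Aut_i 2 G"
proof
  fix f assume f: "f \<in> Aut_i 1 G"
  then have auto: "f \<in> auto G"
    unfolding Aut_1_eq by (simp add: autos_trivial_mod_def)
  then obtain i j k i' j' k' where im: "f gen_a = E (i, j, k)" "f gen_b = E (i', j', k')"
    by (rule auto_images)
  show "f \<in> Aut_i 2 G"
    using f redZ_imp_redab unfolding Aut_1_iff [OF auto im] Aut_2_iff [OF auto im] by blast
qed

lemma Aut_1_normal: "Aut_i 1 G \<lhd> AutoGroup G"
  unfolding Aut_1_eq using center_normal auto_preserves_center by (rule autos_trivial_mod_normal)

text \<open>The exponents of \<open>a\<close> and \<open>b\<close> modulo \<open>q\<close> are coordinates on the abelian group \<open>K/Z\<^sub>2(K)\<close>, on which an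
  automorphism acts by a matrix.\<close>

lemma auto_redab:
  assumes "f \<in> auto G" "f gen_a = E (i, j, k)" "f gen_b = E (i', j', k')"
  shows "redab (coord (f (E (r, s, u)))) = ((r * i + s * i') mod q, (r * j + s * j') mod q)"
  using redZ_imp_redab [OF auto_redZ [OF assms, of "(r, s, u)"]] by simp

lemma auto_preserves_Z2:
  assumes f: "f \<in> auto G" and x: "x \<in> Z2"
  shows "f x \<in> Z2"
proof -
  obtain i j k i' j' k' where im: "f gen_a = E (i, j, k)" "f gen_b = E (i', j', k')"
    using f by (rule auto_images)
  have "x \<in> carrier G"
    using x by (simp add: Z2_def kernel_def)
  then obtain r s u where x': "x = E (r, s, u)"
    by (rule E_cases)
  have "q dvd r" "q dvd s"
    using x unfolding x' E_in_Z2_iff redab_eq_iff by simp_all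
  then have "redab (coord (f x)) = redab (0, 0, 0)"
    unfolding x' auto_redab [OF f im] by simp
  then have "E (coord (f x)) \<in> Z2"
    by (simp only: E_in_Z2_iff)
  then show ?thesis
    by (simp only: E_coord [OF auto_closed [OF f \<open>x \<in> carrier G\<close>]])
qed

lemma Aut_2_normal: "Aut_i 2 G \<lhd> AutoGroup G"
  unfolding Aut_2_eq using Z2_normal auto_preserves_Z2 by (rule autos_trivial_mod_normal)

end

section \<open>Isomorphisms from parametrizations\<close>

text \<open>Here \<open>\<mu>\<close> records the data by which elements of \<open>G\<close> are to be distinguished and \<open>\<theta>\<close> parametrizes its
  values by \<open>T\<close>, compatibly with products. Then \<open>T\<close> is a quotient of \<open>G\<close>, and in particular a group; this
  spares a separate proof that the semidirect product is one.\<close>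

locale parametrized_image = group G for G (structure) +
  fixes T :: "'t monoid" and \<mu> :: "'a \<Rightarrow> 's" and \<theta> :: "'t \<Rightarrow> 's"
  assumes inj: "inj_on \<theta> (carrier T)" and img: "\<mu> ` carrier G = \<theta> ` carrier T"
    and one_T: "\<one>\<^bsub>T\<^esub> \<in> carrier T" "\<mu> \<one> = \<theta> \<one>\<^bsub>T\<^esub>"
    and mult_T: "\<And>f g x y. \<lbrakk>f \<in> carrier G; g \<in> carrier G; x \<in> carrier T; y \<in> carrier T;
      \<mu> f = \<theta> x; \<mu> g = \<theta> y\<rbrakk> \<Longrightarrow> x \<otimes>\<^bsub>T\<^esub> y \<in> carrier T \<and> \<mu> (f \<otimes> g) = \<theta> (x \<otimes>\<^bsub>T\<^esub> y)"
begin

definition proj where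
  "proj f = inv_into (carrier T) \<theta> (\<mu> f)"

lemma proj: "f \<in> carrier G \<Longrightarrow> proj f \<in> carrier T" "f \<in> carrier G \<Longrightarrow> \<mu> f = \<theta> (proj f)"
  unfolding proj_def using img by (metis imageI inv_into_into) (metis imageI f_inv_into_f img)

lemma proj_eqI: "\<mu> f = \<theta> x \<Longrightarrow> x \<in> carrier T \<Longrightarrow> proj f = x"
  unfolding proj_def by (simp add: inj)

lemma proj_hom: "proj \<in> hom G T"
  using mult_T proj by (intro homI) (auto intro: proj_eqI)

lemma proj_image: "proj ` carrier G = carrier T"
proof
  show "carrier T \<subseteq> proj ` carrier G"
  proof
    fix x assume x: "x \<in> carrier T"
    then obtain f where "f \<in> carrier G" "\<mu> f = \<theta> x"
      using img by (metis imageE imageI)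
    then show "x \<in> proj ` carrier G"
      using proj_eqI x by blast
  qed
qed (use proj in auto)

lemma group_T: "group T"
proof -
  have "group (T\<lparr>carrier := carrier T, one := \<one>\<^bsub>T\<^esub>\<rparr>)"
    using hom_imp_img_group [OF proj_hom] proj_eqI [OF one_T(2,1)] by (simp add: proj_image)
  then show ?thesis
    by simp
qed

lemma proj_group_hom: "group_hom G T proj"
  by (intro group_hom.intro group_hom_axioms.intro is_group group_T proj_hom)

lemma quotient_iso: "G Mod {f \<in> carrier G. \<mu> f = \<mu> \<one>} \<cong> T"
proof -
  have "proj f = \<one>\<^bsub>T\<^esub> \<longleftrightarrow> \<mu> f = \<mu> \<one>" if "f \<in> carrier G" for f
    using proj(2) [OF that] proj_eqI [of f] one_T by auto
  then have "kernel G T proj = {f \<in> carrier G. \<mu> f = \<mu> \<one>}"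
    by (auto simp: kernel_def)
  then show ?thesis
    using group_hom.FactGroup_iso [OF proj_group_hom proj_image] by simp
qed

lemma iso: "inj_on \<mu> (carrier G) \<Longrightarrow> G \<cong> T"
proof -
  assume "inj_on \<mu> (carrier G)"
  then have "inj_on proj (carrier G)"
    unfolding inj_on_def using proj(2) by metis
  then have "proj \<in> iso G T"
    using proj_hom proj_image by (simp add: iso_def bij_betw_def)
  then show ?thesis
    by (auto simp: is_iso_def)
qed

end


section \<open>The group \<open>Aut\<^sub>1(K)\<close>\<close>

context K_coordinates
begin

lemma group_Aut_1: "group ((AutoGroup G)\<lparr>carrier := Aut_i 1 G\<rparr>)"
  using subgroup.subgroup_is_group [OF normal_imp_subgroup [OF Aut_1_normal] AutoGroup] .

lemma group_Aut_2: "group ((AutoGroup G)\<lparr>carrier := Aut_i 2 G\<rparr>)"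
  using subgroup.subgroup_is_group [OF normal_imp_subgroup [OF Aut_2_normal] AutoGroup] .

lemma Aut_1_auto: "f \<in> Aut_i 1 G \<Longrightarrow> f \<in> auto G"
  unfolding Aut_1_eq by (simp add: autos_trivial_mod_def)

lemma Aut_2_auto: "f \<in> Aut_i 2 G \<Longrightarrow> f \<in> auto G"
  unfolding Aut_2_eq by (simp add: autos_trivial_mod_def)

lemma auto_eq_on_generators:
  assumes "f \<in> auto G" "g \<in> auto G" "f gen_a = g gen_a" "f gen_b = g gen_b"
  shows "f = g"
  using assms homs_eqI auto_in_hom by (intro auto_eqI) auto

lemma eq_of_dvd_diff:
  fixes n :: int
  shows "n dvd x - y \<Longrightarrow> x \<in> {0..<n} \<Longrightarrow> y \<in> {0..<n} \<Longrightarrow> x = y"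
  by (metis atLeastLessThan_iff mod_eq_dvd_iff mod_pos_pos_trivial)

text \<open>Every choice of central factors for \<open>a\<close> and \<open>b\<close> occurs, so that \<open>Aut\<^sub>1(K)\<close> corresponds to \<open>Z(K)\<^sup>2\<close>.\<close>

lemma Aut_1_images:
  assumes "f \<in> Aut_i 1 G"
  obtains x y x' y' where "x \<in> {0..<q}" "y \<in> {0..<q}" "x' \<in> {0..<q}" "y' \<in> {0..<q}"
    "f gen_a = E (1 + 2 * q * x, 2 * q * y, 0)" "f gen_b = E (2 * q * x', 1 + 2 * q * y', 0)"
proof -
  obtain i j k i' j' k' where im: "f gen_a = E (i, j, k)" "f gen_b = E (i', j', k')"
    using Aut_1_auto [OF assms] by (rule auto_images)
  have "redZ (i, j, k) = redZ (1, 0, 0)" "redZ (i', j', k') = redZ (0, 1, 0)"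
    using assms Aut_1_iff [OF Aut_1_auto [OF assms] im] by simp_all
  then have dvd: "2 * q dvd i - 1" "2 * q dvd j" "q dvd k" "2 * q dvd i'" "2 * q dvd j' - 1" "q dvd k'"
    unfolding redZ_eq_iff by simp_all
  have red: "2 * q * q dvd z - 2 * q * (z div (2 * q) mod q)" if "2 * q dvd z" for z
  proof -
    have "z - 2 * q * (z div (2 * q) mod q) = 2 * q * (z div (2 * q) - z div (2 * q) mod q)"
      using that by (simp add: right_diff_distrib)
    moreover have "q dvd z div (2 * q) - z div (2 * q) mod q"
      by (simp add: minus_mod_eq_mult_div)
    ultimately show ?thesis
      by (simp only: double_q_dvd_iff)
  qed
  have mod: "z mod q \<in> {0..<q}" for z
    using q_pos by simp
  show ?thesis
  proof (rule that)
    show "f gen_a = E (1 + 2 * q * ((i - 1) div (2 * q) mod q), 2 * q * (j div (2 * q) mod q), 0)"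
      unfolding im by (rule E_cong) (use red [OF dvd(1)] red [OF dvd(2)] dvd in \<open>simp add: diff_diff_add\<close>)
    show "f gen_b = E (2 * q * (i' div (2 * q) mod q), 1 + 2 * q * ((j' - 1) div (2 * q) mod q), 0)"
      unfolding im by (rule E_cong) (use red [OF dvd(4)] red [OF dvd(5)] dvd in \<open>simp add: diff_diff_add\<close>)
  qed (rule mod)+
qed

lemma Aut_1_exists:
  obtains f where "f \<in> Aut_i 1 G"
    "f gen_a = E (1 + 2 * q * x, 2 * q * y, 0)" "f gen_b = E (2 * q * x', 1 + 2 * q * y', 0)"
proof -
  let ?D = "(1 + 2 * q * x) * (1 + 2 * q * y') - 2 * q * y * (2 * q * x')"
  have "?D - 1 = q * (2 * (x + y' + 2 * q * x * y' - 2 * q * y * x'))"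
    by (simp add: algebra_simps)
  then have D: "q dvd ?D - 1"
    by (metis dvd_triv_left)
  obtain f where f: "f \<in> auto G"
    "f gen_a = E (1 + 2 * q * x, 2 * q * y, 0)" "f gen_b = E (2 * q * x', 1 + 2 * q * y', 0)"
    by (rule auto_exists [of "1 + 2 * q * x" "1 + 2 * q * y'" "2 * q * y" "2 * q * x'" 0 0])
      (use D in \<open>simp_all add: dvd_mult mult.assoc\<close>)
  then have "f \<in> Aut_i 1 G"
    unfolding Aut_1_iff [OF f] redZ_eq_iff by simp
  then show ?thesis
    using f that by blast
qed

text \<open>Central automorphisms move \<open>a\<close> and \<open>b\<close> by central elements, whose \<open>2q\<close>-th powers are trivial, and the
  center is generated by \<open>2q\<close>-th powers.\<close>

lemma Aut_1_fixes_center: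
  assumes "f \<in> Aut_i 1 G"
  shows "f (E (2 * q * x, 2 * q * y, 0)) = E (2 * q * x, 2 * q * y, 0)"
proof -
  obtain u v u' v' where im: "f gen_a = E (1 + 2 * q * u, 2 * q * v, 0)"
      "f gen_b = E (2 * q * u', 1 + 2 * q * v', 0)"
    using assms by (rule Aut_1_images)
  have "f (E (2 * q * x, 2 * q * y, 0)) =
      E (2 * q * (x * (1 + 2 * q * u) + y * (2 * q * u')), 2 * q * (x * (2 * q * v) + y * (1 + 2 * q * v')), 0)"
    by (rule endo_central [OF auto_in_hom [OF Aut_1_auto [OF assms]] im])
  also have "\<dots> = E (2 * q * x, 2 * q * y, 0)"
  proof (rule E_cong, unfold cong_mod.simps, intro conjI)
    show "2 * q * q dvd 2 * q * (x * (1 + 2 * q * u) + y * (2 * q * u')) - 2 * q * x"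
      by (rule dvdI [of _ _ "2 * (x * u + y * u')"]) (simp add: algebra_simps)
    show "2 * q * q dvd 2 * q * (x * (2 * q * v) + y * (1 + 2 * q * v')) - 2 * q * y"
      by (rule dvdI [of _ _ "2 * (x * v + y * v')"]) (simp add: algebra_simps)
  qed simp
  finally show ?thesis .
qed

lemma carrier_Zmod_q: "int n = q \<Longrightarrow> carrier (Zmod n) = {0..<q}"
  using q_nonzero by (auto simp: carrier_integer_mod_group)

lemma Aut_1_iso:
  assumes n: "int n = q"
  shows "(AutoGroup G)\<lparr>carrier := Aut_i 1 G\<rparr> \<cong> Zmod n \<times>\<times> Zmod n \<times>\<times> Zmod n \<times>\<times> Zmod n"
    (is "?A \<cong> ?T")
proof -
  define \<mu> where "\<mu> f = (f gen_a, f gen_b)" for f :: "'a \<Rightarrow> 'a"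
  define \<theta> where "\<theta> = (\<lambda>(x, y, x', y').
    (E (1 + 2 * q * x, 2 * q * y, 0), E (2 * q * x', 1 + 2 * q * y', 0)))"
  have \<theta>_eq: "\<theta> (x, y, x', y') = \<theta> (u, v, u', v') \<longleftrightarrow>
      q dvd x - u \<and> q dvd y - v \<and> q dvd x' - u' \<and> q dvd y' - v'" for x y x' y' u v u' v'
  proof -
    have "1 + 2 * q * z - (1 + 2 * q * w) = 2 * q * (z - w)" "2 * q * z - 2 * q * w = 2 * q * (z - w)" for z w
      by (simp_all add: algebra_simps)
    then show ?thesis
      unfolding \<theta>_def by (simp add: E_eq_iff double_q_dvd_iff q_nonzero)
  qed
  have T: "carrier ?T = {0..<q} \<times> {0..<q} \<times> {0..<q} \<times> {0..<q}"
    using carrier_Zmod_q [OF n] by simp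
  interpret A: parametrized_image ?A ?T \<mu> \<theta>
  proof (intro parametrized_image.intro parametrized_image_axioms.intro)
    show "group ?A"
      by (rule group_Aut_1)
    show "inj_on \<theta> (carrier ?T)"
    proof (rule inj_onI)
      fix s t assume st: "s \<in> carrier ?T" "t \<in> carrier ?T" "\<theta> s = \<theta> t"
      obtain x y x' y' u v u' v' where "s = (x, y, x', y')" "t = (u, v, u', v')"
        by (cases s; cases t) auto
      then show "s = t"
        using st(1,2) st(3) [unfolded \<open>s = _\<close> \<open>t = _\<close> \<theta>_eq]
        unfolding T by (auto intro: eq_of_dvd_diff [of q])
    qed
    show "\<mu> ` carrier ?A = \<theta> ` carrier ?T"
    proof
      show "\<mu> ` carrier ?A \<subseteq> \<theta> ` carrier ?T"
      proof (rule image_subsetI)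
        fix f assume "f \<in> carrier ?A"
        then have "f \<in> Aut_i 1 G" by simp
        then obtain x y x' y' where "x \<in> {0..<q}" "y \<in> {0..<q}" "x' \<in> {0..<q}" "y' \<in> {0..<q}"
            "f gen_a = E (1 + 2 * q * x, 2 * q * y, 0)" "f gen_b = E (2 * q * x', 1 + 2 * q * y', 0)"
          by (rule Aut_1_images)
        then show "\<mu> f \<in> \<theta> ` carrier ?T"
          unfolding T by (intro image_eqI [of _ _ "(x, y, x', y')"]) (simp_all add: \<mu>_def \<theta>_def)
      qed
      show "\<theta> ` carrier ?T \<subseteq> \<mu> ` carrier ?A"
      proof (rule image_subsetI)
        fix s :: "int \<times> int \<times> int \<times> int"
        obtain x y x' y' where s: "s = (x, y, x', y')"
          by (cases s)
        obtain f where "f \<in> Aut_i 1 G"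
          "f gen_a = E (1 + 2 * q * x, 2 * q * y, 0)" "f gen_b = E (2 * q * x', 1 + 2 * q * y', 0)"
          by (rule Aut_1_exists)
        then show "\<theta> s \<in> \<mu> ` carrier ?A"
          unfolding s by (intro image_eqI [of _ _ f]) (simp_all add: \<mu>_def \<theta>_def)
      qed
    qed
    show "\<one>\<^bsub>?T\<^esub> \<in> carrier ?T"
      unfolding T using q_pos by simp
    show "\<mu> \<one>\<^bsub>?A\<^esub> = \<theta> \<one>\<^bsub>?T\<^esub>"
      by (simp add: \<mu>_def \<theta>_def one_AutoGroup)
    fix f g s t
    assume "f \<in> carrier ?A" "g \<in> carrier ?A" "s \<in> carrier ?T" "t \<in> carrier ?T"
      and st: "\<mu> f = \<theta> s" "\<mu> g = \<theta> t"
    then have f: "f \<in> Aut_i 1 G" "f \<in> auto G" and g: "g \<in> Aut_i 1 G" "g \<in> auto G"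
      by (simp_all add: Aut_1_auto [simplified])
    obtain x y x' y' u v u' v' where s: "s = (x, y, x', y')" and t: "t = (u, v, u', v')"
      by (cases s; cases t) auto
    have im: "f gen_a = E (1 + 2 * q * x, 2 * q * y, 0)" "f gen_b = E (2 * q * x', 1 + 2 * q * y', 0)"
        "g gen_a = E (1 + 2 * q * u, 2 * q * v, 0)" "g gen_b = E (2 * q * u', 1 + 2 * q * v', 0)"
      using st by (simp_all add: s t \<mu>_def \<theta>_def)
    have central: "E (i + 2 * q * w, j + 2 * q * z, 0) = E (i, j, 0) \<otimes> E (2 * q * w, 2 * q * z, 0)"
      for i j w z
      using E_cong [OF cong_mod_mul_central_c(1) [of i j 0 w z 0]] unfolding E_mult by simp
    have shift: "f (E (i + 2 * q * w, j + 2 * q * z, 0)) = f (E (i, j, 0)) \<otimes> E (2 * q * w, 2 * q * z, 0)"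
      for i j w z
      unfolding central by (simp add: auto_mult [OF f(2)] Aut_1_fixes_center [OF f(1)])
    have "\<mu> (f \<otimes>\<^bsub>AutoGroup G\<^esub> g) = (f (g gen_a), f (g gen_b))"
      by (simp add: \<mu>_def AutoGroup_mult f g)
    also have "\<dots> = \<theta> (x + u, y + v, x' + u', y' + v')"
      using shift [of 1 u 0 v] shift [of 0 u' 1 v']
        central [of "1 + 2 * q * x" u "2 * q * y" v] central [of "2 * q * x'" u' "1 + 2 * q * y'" v']
      by (simp add: im \<theta>_def algebra_simps)
    also have "\<dots> = \<theta> ((x + u) mod q, (y + v) mod q, (x' + u') mod q, (y' + v') mod q)"
      unfolding \<theta>_eq by (simp add: mod_eq_dvd_iff [symmetric])
    finally show "s \<otimes>\<^bsub>?T\<^esub> t \<in> carrier ?T \<and> \<mu> (f \<otimes>\<^bsub>?A\<^esub> g) = \<theta> (s \<otimes>\<^bsub>?T\<^esub> t)"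
      unfolding T s t using n q_pos by simp
  qed
  have "inj_on \<mu> (carrier ?A)"
    using auto_eq_on_generators Aut_1_auto by (auto simp: inj_on_def \<mu>_def)
  then show ?thesis
    by (rule A.iso)
qed

end

section \<open>The group \<open>Aut\<^sub>2(K)/Aut\<^sub>1(K)\<close>\<close>

context K_coordinates
begin

text \<open>Automorphisms in \<open>Aut\<^sub>2(K)\<close> multiply \<open>a\<close> and \<open>b\<close> by elements of \<open>Z\<^sub>2(K)\<close>; modulo the center these
  are \<open>a\<^bsup>qx\<^esup> b\<^bsup>qy\<^esup> c\<^sup>z\<close> with \<open>x\<close>, \<open>y\<close> modulo \<open>2\<close> and \<open>z\<close> modulo \<open>q\<close>.\<close>

lemma Aut_2_images:
  assumes "f \<in> Aut_i 2 G"
  obtains P P' x y z x' y' z' where "f gen_a = E P" "f gen_b = E P'"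
    "redZ P = redZ (1 + q * x, q * y, z)" "redZ P' = redZ (q * x', 1 + q * y', z')"
    "x \<in> {0..<2}" "y \<in> {0..<2}" "z \<in> {0..<q}" "x' \<in> {0..<2}" "y' \<in> {0..<2}" "z' \<in> {0..<q}"
proof -
  obtain i j k i' j' k' where im: "f gen_a = E (i, j, k)" "f gen_b = E (i', j', k')"
    using Aut_2_auto [OF assms] by (rule auto_images)
  have "redab (i, j, k) = redab (1, 0, 0)" "redab (i', j', k') = redab (0, 1, 0)"
    using assms Aut_2_iff [OF Aut_2_auto [OF assms] im] by simp_all
  then have dvd: "q dvd i - 1" "q dvd j" "q dvd i'" "q dvd j' - 1"
    unfolding redab_eq_iff by simp_all
  have red: "2 * q dvd z - q * (z div q mod 2)" if "q dvd z" for z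
  proof -
    have "z - q * (z div q mod 2) = q * (z div q - z div q mod 2)"
      using that by (simp add: right_diff_distrib)
    also have "\<dots> = 2 * q * (z div q div 2)"
      by (simp add: minus_mod_eq_mult_div)
    finally show ?thesis by simp
  qed
  show ?thesis
  proof (rule that [OF im])
    show "redZ (i, j, k) = redZ (1 + q * ((i - 1) div q mod 2), q * (j div q mod 2), k mod q)"
      unfolding redZ_eq_iff using red [OF dvd(1)] red [OF dvd(2)]
      by (simp add: diff_diff_add minus_mod_eq_mult_div)
    show "redZ (i', j', k') = redZ (q * (i' div q mod 2), 1 + q * ((j' - 1) div q mod 2), k' mod q)"
      unfolding redZ_eq_iff using red [OF dvd(3)] red [OF dvd(4)]
      by (simp add: diff_diff_add minus_mod_eq_mult_div)
  qed (use q_pos in auto)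
qed

lemma Aut_2_exists:
  obtains f where "f \<in> Aut_i 2 G" "f gen_a = E (1 + q * x, q * y, z)" "f gen_b = E (q * x', 1 + q * y', z')"
proof -
  let ?D = "(1 + q * x) * (1 + q * y') - q * y * (q * x')"
  have D': "?D - 1 = q * (x + y' + q * x * y' - q * y * x')"
    by (simp add: algebra_simps)
  then have D: "q dvd ?D - 1"
    by (metis dvd_triv_left)
  have "even (?D - 1)"
    unfolding D' using even_q by simp
  then have "odd ?D"
    by simp
  then obtain f where f: "f \<in> auto G" "f gen_a = E (1 + q * x, q * y, z)" "f gen_b = E (q * x', 1 + q * y', z')"
    by (rule auto_exists) (use D in \<open>simp_all add: dvd_mult mult.assoc\<close>)
  then have "f \<in> Aut_i 2 G"
    unfolding Aut_2_iff [OF f] redab_eq_iff by simp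
  then show ?thesis
    using f that by blast
qed

lemma redZ_shift_eq_iff:
  "redZ (i + q * x, j + q * y, z) = redZ (i + q * u, j + q * v, w) \<longleftrightarrow>
    2 dvd x - u \<and> 2 dvd y - v \<and> q dvd z - w"
proof -
  have "2 * q dvd i + q * x - (i + q * u) \<longleftrightarrow> 2 dvd x - u" for i x u
  proof -
    have "i + q * x - (i + q * u) = (x - u) * q"
      by (simp add: algebra_simps)
    then show ?thesis
      by (simp only: dvd_mult_cancel_right q_nonzero simp_thms)
  qed
  then show ?thesis
    unfolding redZ_eq_iff by simp
qed

text \<open>Composition in \<open>Aut\<^sub>2(K)\<close> modulo the center is addition of the exponents: all other terms of the
  induced Heisenberg endomorphism contain \<open>q\<^sup>2\<close>, or \<open>q\<close> in the exponent of \<open>c\<close>.\<close>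

lemma heis_endo_Aut_2:
  "redZ (heis_endo (1 + q * x, q * y, z) (q * x', 1 + q * y', z') (1 + q * u, q * v, w)) =
    redZ (1 + q * (x + u), q * (y + v), z + w)"
  "redZ (heis_endo (1 + q * x, q * y, z) (q * x', 1 + q * y', z') (q * u, 1 + q * v, w)) =
    redZ (q * (x' + u), 1 + q * (y' + v), z' + w)"
proof -
  have first: "redZ (heis_endo (1 + q * x, q * y, z) (q * x', 1 + q * y', z') (1 + q * u, q * v, w)) =
      redZ (1 + q * (x + u) + q * (q * (u * x + v * x')), q * (y + v) + q * (q * (u * y + v * y')),
        z + w + q * (u * z + v * z' - tri (1 + q * u) * (1 + q * x) * y - tri (q * v) * x' * (1 + q * y')
          - (1 + q * u) * v * y * (q * (q * x')) + w * (x + y' + q * x * y' - q * y * x')))"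
    by (rule arg_cong [of _ _ redZ]) (simp add: algebra_simps)
  show "redZ (heis_endo (1 + q * x, q * y, z) (q * x', 1 + q * y', z') (1 + q * u, q * v, w)) =
    redZ (1 + q * (x + u), q * (y + v), z + w)"
    unfolding first redZ_eq_iff using even_q by simp
  have second: "redZ (heis_endo (1 + q * x, q * y, z) (q * x', 1 + q * y', z') (q * u, 1 + q * v, w)) =
      redZ (q * (x' + u) + q * (q * (u * x + v * x')), 1 + q * (y' + v) + q * (q * (u * y + v * y')),
        z' + w + q * (u * z + v * z' - tri (q * u) * (1 + q * x) * y - tri (1 + q * v) * x' * (1 + q * y')
          - u * (1 + q * v) * y * (q * (q * x')) + w * (x + y' + q * x * y' - q * y * x')))"
    by (rule arg_cong [of _ _ redZ]) (simp add: algebra_simps)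
  show "redZ (heis_endo (1 + q * x, q * y, z) (q * x', 1 + q * y', z') (q * u, 1 + q * v, w)) =
    redZ (q * (x' + u), 1 + q * (y' + v), z' + w)"
    unfolding second redZ_eq_iff using even_q by simp
qed

lemma Aut_2_quotient_iso:
  assumes n: "int n = q"
  shows "(AutoGroup G)\<lparr>carrier := Aut_i 2 G\<rparr> Mod Aut_i 1 G \<cong>
    (Zmod n \<times>\<times> Zmod n) \<times>\<times> (Zmod 2 \<times>\<times> Zmod 2 \<times>\<times> Zmod 2 \<times>\<times> Zmod 2)"
    (is "?A Mod _ \<cong> ?T")
proof -
  define \<mu> where "\<mu> f = (redZ (coord (f gen_a)), redZ (coord (f gen_b)))" for f :: "'a \<Rightarrow> 'a"
  define \<theta> where "\<theta> = (\<lambda>((z, z'), (x, y, x', y')).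
    (redZ (1 + q * x, 0 + q * y, z), redZ (0 + q * x', 1 + q * y', z')))"
  have \<mu>: "\<mu> f = (redZ P, redZ P')" if "f gen_a = E P" "f gen_b = E P'" for f P P'
    by (simp add: \<mu>_def that redZ_coord_E del: redZ.simps)
  have \<theta>_eq: "\<theta> ((z, z'), (x, y, x', y')) = \<theta> ((w, w'), (u, v, u', v')) \<longleftrightarrow>
      q dvd z - w \<and> q dvd z' - w' \<and> 2 dvd x - u \<and> 2 dvd y - v \<and> 2 dvd x' - u' \<and> 2 dvd y' - v'"
    for x y z x' y' z' u v w u' v' w'
    unfolding \<theta>_def prod.case prod.inject redZ_shift_eq_iff by blast
  have T: "carrier ?T = ({0..<q} \<times> {0..<q}) \<times> {0..<2} \<times> {0..<2} \<times> {0..<2} \<times> {0..<2}"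
    using carrier_Zmod_q [OF n] by (simp add: carrier_integer_mod_group)
  interpret A: parametrized_image ?A ?T \<mu> \<theta>
  proof (intro parametrized_image.intro parametrized_image_axioms.intro)
    show "group ?A"
      by (rule group_Aut_2)
    show "inj_on \<theta> (carrier ?T)"
    proof (rule inj_onI)
      fix s t assume st: "s \<in> carrier ?T" "t \<in> carrier ?T" "\<theta> s = \<theta> t"
      obtain x y z x' y' z' u v w u' v' w' where
        eqs: "s = ((z, z'), (x, y, x', y'))" "t = ((w, w'), (u, v, u', v'))"
        by (cases s; cases t) auto
      show "s = t"
        using st(1,2) st(3) [unfolded eqs \<theta>_eq] eq_of_dvd_diff [of q] eq_of_dvd_diff [of 2]
        unfolding T eqs mem_Times_iff fst_conv snd_conv prod.inject by blast
    qed
    show "\<mu> ` carrier ?A = \<theta> ` carrier ?T"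
    proof
      show "\<mu> ` carrier ?A \<subseteq> \<theta> ` carrier ?T"
      proof (rule image_subsetI)
        fix f assume "f \<in> carrier ?A"
        then have "f \<in> Aut_i 2 G" by simp
        then obtain P P' x y z x' y' z' where im: "f gen_a = E P" "f gen_b = E P'"
          "redZ P = redZ (1 + q * x, q * y, z)" "redZ P' = redZ (q * x', 1 + q * y', z')"
          "x \<in> {0..<2}" "y \<in> {0..<2}" "z \<in> {0..<q}" "x' \<in> {0..<2}" "y' \<in> {0..<2}" "z' \<in> {0..<q}"
          by (rule Aut_2_images)
        then show "\<mu> f \<in> \<theta> ` carrier ?T"
          unfolding T \<mu> [OF im(1,2)]
          by (intro image_eqI [of _ _ "((z, z'), (x, y, x', y'))"]) (simp_all add: \<theta>_def del: redZ.simps)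
      qed
      show "\<theta> ` carrier ?T \<subseteq> \<mu> ` carrier ?A"
      proof (rule image_subsetI)
        fix s :: "(int \<times> int) \<times> int \<times> int \<times> int \<times> int"
        obtain z z' x y x' y' where s: "s = ((z, z'), (x, y, x', y'))"
          by (cases s) auto
        obtain f where f: "f \<in> Aut_i 2 G"
          "f gen_a = E (1 + q * x, q * y, z)" "f gen_b = E (q * x', 1 + q * y', z')"
          by (rule Aut_2_exists)
        then show "\<theta> s \<in> \<mu> ` carrier ?A"
          unfolding s by (intro image_eqI [of _ _ f]) (simp_all add: \<mu> [OF f(2,3)] \<theta>_def del: redZ.simps)
      qed
    qed
    show "\<one>\<^bsub>?T\<^esub> \<in> carrier ?T"
      unfolding T using q_pos by simp
    show "\<mu> \<one>\<^bsub>?A\<^esub> = \<theta> \<one>\<^bsub>?T\<^esub>"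
      using \<mu> [of "\<one>\<^bsub>AutoGroup G\<^esub>"] by (simp add: \<theta>_def one_AutoGroup del: redZ.simps)
    fix f g s t
    assume "f \<in> carrier ?A" "g \<in> carrier ?A" "s \<in> carrier ?T" "t \<in> carrier ?T"
      and st: "\<mu> f = \<theta> s" "\<mu> g = \<theta> t"
    then have f: "f \<in> auto G" and g: "g \<in> auto G"
      by (simp_all add: Aut_2_auto)
    obtain x y z x' y' z' u v w u' v' w' where
      s: "s = ((z, z'), (x, y, x', y'))" and t: "t = ((w, w'), (u, v, u', v'))"
      by (cases s; cases t) auto
    obtain P P' where fP: "f gen_a = E P" "f gen_b = E P'"
      using f by (rule auto_images)
    obtain R R' where gR: "g gen_a = E R" "g gen_b = E R'"
      using g by (rule auto_images)
    have P: "redZ P = redZ (1 + q * x, q * y, z)" "redZ P' = redZ (q * x', 1 + q * y', z')"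
      and R: "redZ R = redZ (1 + q * u, q * v, w)" "redZ R' = redZ (q * u', 1 + q * v', w')"
      using st by (simp_all add: \<mu> [OF fP] \<mu> [OF gR] s t \<theta>_def del: redZ.simps)
    have "\<mu> (f \<otimes>\<^bsub>AutoGroup G\<^esub> g) = (redZ (heis_endo P P' R), redZ (heis_endo P P' R'))"
      by (simp add: \<mu>_def AutoGroup_mult f g gR auto_redZ [OF f fP] del: redZ.simps)
    also have "\<dots> = \<theta> ((z + w, z' + w'), (x + u, y + v, x' + u', y' + v'))"
      unfolding redZ_heis_endo_cong [OF R(1) P] redZ_heis_endo_cong [OF R(2) P] heis_endo_Aut_2
      by (simp add: \<theta>_def del: redZ.simps)
    also have "\<dots> = \<theta> (((z + w) mod q, (z' + w') mod q),
        ((x + u) mod 2, (y + v) mod 2, (x' + u') mod 2, (y' + v') mod 2))"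
      unfolding \<theta>_eq by (simp add: mod_eq_dvd_iff [symmetric])
    finally show "s \<otimes>\<^bsub>?T\<^esub> t \<in> carrier ?T \<and> \<mu> (f \<otimes>\<^bsub>?A\<^esub> g) = \<theta> (s \<otimes>\<^bsub>?T\<^esub> t)"
      unfolding T s t using n q_pos by simp
  qed
  have "{f \<in> carrier ?A. \<mu> f = \<mu> \<one>\<^bsub>?A\<^esub>} = Aut_i 1 G"
  proof (intro equalityI subsetI)
    fix f assume f: "f \<in> {f \<in> carrier ?A. \<mu> f = \<mu> \<one>\<^bsub>?A\<^esub>}"
    then have auto: "f \<in> auto G"
      by (simp add: Aut_2_auto)
    then obtain P P' where im: "f gen_a = E P" "f gen_b = E P'"
      using auto_images by metis
    show "f \<in> Aut_i 1 G"
      unfolding Aut_1_iff [OF auto im]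
      using f \<mu> [OF im] \<mu> [of "\<one>\<^bsub>AutoGroup G\<^esub>"] by (simp add: one_AutoGroup del: redZ.simps)
  next
    fix f assume f: "f \<in> Aut_i 1 G"
    then obtain P P' where im: "f gen_a = E P" "f gen_b = E P'"
      using auto_images [OF Aut_1_auto] by metis
    show "f \<in> {f \<in> carrier ?A. \<mu> f = \<mu> \<one>\<^bsub>?A\<^esub>}"
      using f Aut_1_iff [OF Aut_1_auto [OF f] im] Aut_1_subset_Aut_2 \<mu> [OF im]
        \<mu> [of "\<one>\<^bsub>AutoGroup G\<^esub>"]
      by (auto simp: one_AutoGroup simp del: redZ.simps One_nat_def)
  qed
  then show ?thesis
    using A.quotient_iso by simp
qed

end

section \<open>The group \<open>Aut(K)/Aut\<^sub>2(K)\<close>\<close>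

context K_coordinates
begin

text \<open>The matrix of an automorphism on \<open>K/Z\<^sub>2(K) = (\<int>/q)\<^sup>2\<close>, given by its two columns.\<close>

definition matrix where
  "matrix f = (redab (coord (f gen_a)), redab (coord (f gen_b)))"

lemma matrix_eq:
  "f gen_a = E (i, j, k) \<Longrightarrow> f gen_b = E (i', j', k') \<Longrightarrow>
    matrix f = ((i mod q, j mod q), (i' mod q, j' mod q))"
  by (simp add: matrix_def redab_coord_E del: redab.simps) simp

lemma matrix_one: "matrix \<one>\<^bsub>AutoGroup G\<^esub> = ((1 mod q, 0), (0, 1 mod q))"
  using matrix_eq [of "\<one>\<^bsub>AutoGroup G\<^esub>" 1 0 0 0 1 0] by (simp add: one_AutoGroup)

lemma matrix_mult:
  assumes f: "f \<in> auto G" and g: "g \<in> auto G"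
    and "matrix f = ((i, j), (i', j'))" "matrix g = ((r, s), (r', s'))"
  shows "matrix (f \<otimes>\<^bsub>AutoGroup G\<^esub> g) =
    (((r * i + s * i') mod q, (r * j + s * j') mod q), ((r' * i + s' * i') mod q, (r' * j + s' * j') mod q))"
proof -
  obtain i0 j0 k0 i0' j0' k0' where fE: "f gen_a = E (i0, j0, k0)" "f gen_b = E (i0', j0', k0')"
    using f by (rule auto_images)
  obtain r0 s0 u0 r0' s0' u0' where gE: "g gen_a = E (r0, s0, u0)" "g gen_b = E (r0', s0', u0')"
    using g by (rule auto_images)
  have eqs: "i = i0 mod q" "j = j0 mod q" "i' = i0' mod q" "j' = j0' mod q"
    "r = r0 mod q" "s = s0 mod q" "r' = r0' mod q" "s' = s0' mod q"
    using assms(3,4) matrix_eq [OF fE] matrix_eq [OF gE] by simp_all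
  have "matrix (f \<otimes>\<^bsub>AutoGroup G\<^esub> g) = (redab (coord (f (E (r0, s0, u0)))), redab (coord (f (E (r0', s0', u0')))))"
    by (simp add: matrix_def AutoGroup_mult f g gE del: redab.simps)
  moreover have mod: "(w * x + y * z) mod q = ((w mod q) * (x mod q) + (y mod q) * (z mod q)) mod q" for w x y z
    unfolding cong_def [symmetric] by (intro cong_add cong_mult) (simp_all add: cong_def)
  ultimately show ?thesis
    unfolding auto_redab [OF f fE] eqs by (simp only: mod [symmetric])
qed

lemma Aut_2_eq_matrix_kernel:
  "Aut_i 2 G = {f \<in> carrier (AutoGroup G). matrix f = matrix \<one>\<^bsub>AutoGroup G\<^esub>}"
proof -
  have "f \<in> Aut_i 2 G \<longleftrightarrow> matrix f = matrix \<one>\<^bsub>AutoGroup G\<^esub>" if f: "f \<in> auto G" for f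
  proof -
    obtain i j k i' j' k' where fE: "f gen_a = E (i, j, k)" "f gen_b = E (i', j', k')"
      using f by (rule auto_images)
    show ?thesis
      unfolding Aut_2_iff [OF f fE] matrix_eq [OF fE] matrix_one by simp
  qed
  then show ?thesis
    using Aut_2_auto by (auto simp: carrier_AutoGroup)
qed

lemma Zmod_units_facts:
  assumes n: "int n = q" and q: "q > 1"
  shows "group (Zmod_units n)" "carrier (Zmod_units n) = {u. 0 < u \<and> u < q \<and> coprime u q}"
    "\<one>\<^bsub>Zmod_units n\<^esub> = 1" "\<And>u v. u \<otimes>\<^bsub>Zmod_units n\<^esub> v = u * v mod q"
proof -
  interpret R: residues q "residue_ring q"
    by (simp add: residues_def q)
  show "group (Zmod_units n)"
    unfolding Zmod_units_def n by (rule R.units_group)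
  show "carrier (Zmod_units n) = {u. 0 < u \<and> u < q \<and> coprime u q}"
    unfolding Zmod_units_def n units_of_carrier by (rule R.res_units_eq)
  show "\<one>\<^bsub>Zmod_units n\<^esub> = 1" "\<And>u v. u \<otimes>\<^bsub>Zmod_units n\<^esub> v = u * v mod q"
    unfolding Zmod_units_def n units_of_one units_of_mult
    using q by (simp_all add: R.res_mult_eq R.res_one_eq)
qed

text \<open>With \<open>p = q/2\<close>, the parameter \<open>((u, e, d), 0)\<close> stands for the matrix with diagonal \<open>u\<close>, \<open>u\<inverse>\<close>, upper right
  entry \<open>p e\<close> and lower left entry \<open>p d\<close>, and \<open>((u, e, d), 1)\<close> for the same matrix with its columns exchanged.
  The congruences of \<open>auto_matrix\<close> allow no other matrices: if \<open>i\<close> is odd they force \<open>D = 1\<close> and hence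
  \<open>2j = 2i' = 0\<close> modulo \<open>q\<close>, and similarly with \<open>D = -1\<close> if \<open>i\<close> is even.\<close>

lemma Aut_quotient_iso:
  assumes n: "int n = q" and m: "m > 2"
  shows "AutoGroup G Mod Aut_i 2 G \<cong>
    semidirect_product (Zmod_units n \<times>\<times> (Zmod 2 \<times>\<times> Zmod 2)) (Zmod 2) (inv_swap n)"
    (is "_ \<cong> ?T")
proof -
  obtain p where p: "q = 2 * p"
    using even_q ..
  have "q = 2 * 2 ^ (m - 2)"
    using m by (simp add: q_def Suc_diff_Suc flip: power_Suc)
  then have "p = 2 ^ (m - 2)"
    using p by simp
  then have even_p: "even p" and p_pos: "p > 0"
    using m by simp_all
  have q_gt_1: "q > 1"
    using p p_pos by simp
  let ?U = "Zmod_units n"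
  note U = Zmod_units_facts [OF n q_gt_1]
  interpret U: group ?U
    by (rule U(1))
  have inv_U: "inv\<^bsub>?U\<^esub> u \<in> carrier ?U" "u * inv\<^bsub>?U\<^esub> u mod q = 1" if "u \<in> carrier ?U" for u
    using U.inv_closed [OF that] U.r_inv [OF that] by (simp_all add: U)
  have inv_U_eq: "inv\<^bsub>?U\<^esub> u = v" if "u * v mod q = 1" "u \<in> carrier ?U" "v \<in> carrier ?U" for u v
    using U.inv_equality [of v u] that by (simp add: U mult.commute)
  have odd_U: "odd u" if "u \<in> carrier ?U" for u
    using that even_q by (auto simp: U dest: coprime_common_divisor [of _ _ 2])
  have mod_U: "u mod q = u" if "u \<in> carrier ?U" for u
    using that by (simp add: U)
  have unit: "u mod q \<in> carrier ?U" if "odd u" for u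
  proof -
    have "coprime (u mod q) q"
      using coprime_two_power_odd(2) [OF that] q_nonzero
      by (metis coprime_commute coprime_mod_left_iff)
    moreover have "u mod q \<noteq> 0"
      using that even_q by (metis dvd_imp_mod_0 dvd_trans mod_0_imp_dvd)
    then have "0 < u mod q"
      using pos_mod_sign [OF q_pos, of u] by linarith
    ultimately show ?thesis
      by (simp add: U q_nonzero)
  qed
  have mult_U: "u * v mod q \<in> carrier ?U" "inv\<^bsub>?U\<^esub> (u * v mod q) = inv\<^bsub>?U\<^esub> u * inv\<^bsub>?U\<^esub> v mod q"
    if "u \<in> carrier ?U" "v \<in> carrier ?U" for u v
    using U.m_closed [OF that] U.inv_mult_group [OF that] by (simp_all add: U mult.commute)
  \<comment> \<open>Rules for entries: those that are multiples of \<open>p\<close> depend on a parity only, and products of two such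
    entries vanish.\<close>
  have pmod: "p * x mod q = p * (x mod 2)" for x
    by (simp only: p mult_mod_right mult.commute [of 2 p])
  have pp: "(x + p * (p * y)) mod q = x mod q" for x y
  proof -
    obtain r where "p = 2 * r"
      using even_p ..
    then have "x + p * (p * y) = x + (r * y) * q"
      by (simp add: p)
    then show ?thesis
      by (simp only: mod_mult_self1)
  qed
  have off: "(p * x * w + p * y * z) mod q = p * ((x + y) mod 2)" if "odd w" "odd z" for x y w z
  proof -
    have "(p * x * w + p * y * z) mod q = p * ((x * w + y * z) mod 2)"
      using pmod [of "x * w + y * z"] by (simp add: algebra_simps)
    also have "(x * w + y * z) mod 2 = (x + y) mod 2"
      using that by (simp add: mod2_eq_if)
    finally show ?thesis .
  qed
  have half: "\<exists>e\<in>{0..<2}. x mod q = p * e" if "p dvd x" for x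
  proof -
    obtain y where "x = p * y"
      using \<open>p dvd x\<close> ..
    then show ?thesis
      using pmod [of y] by (intro bexI [of _ "y mod 2"]) simp_all
  qed
  have p_dvd: "p dvd x" if "odd w" "q dvd w * (2 * x)" for w x
  proof -
    have "q dvd 2 * x"
      using that coprime_two_power_odd(2) by (simp add: coprime_dvd_mult_right_iff)
    then show ?thesis
      by (simp add: p)
  qed

  define \<theta> where "\<theta> = (\<lambda>((u, e, d), h :: int). if h = 0
    then ((u, p * d), (p * e, inv\<^bsub>?U\<^esub> u)) else ((p * e, inv\<^bsub>?U\<^esub> u), (u, p * d)))"
  have T: "carrier ?T = (carrier ?U \<times> {0..<2} \<times> {0..<2}) \<times> {0..<2}"
    by (simp add: semidirect_product_def carrier_integer_mod_group)
  have T_mult: "((u, e, d), h) \<otimes>\<^bsub>?T\<^esub> ((v, e', d'), h') = (if h = 0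
      then ((u * v mod q, (e + e') mod 2, (d + d') mod 2), (h + h') mod 2)
      else ((u * inv\<^bsub>?U\<^esub> v mod q, (e + d') mod 2, (d + e') mod 2), (h + h') mod 2))"
    for u e d h v e' d' h'
    by (simp add: semidirect_product_def inv_swap_def U)
  have two_range: "(0 :: int) \<in> {0..<2}" "(1 :: int) \<in> {0..<2}"
    by simp_all
  have two: "h = 0 \<or> h = 1" if "h \<in> {0..<2}" for h :: int
    using that by auto

  interpret A: parametrized_image "AutoGroup G" ?T matrix \<theta>
  proof (intro parametrized_image.intro parametrized_image_axioms.intro)
    show "group (AutoGroup G)"
      by (rule AutoGroup)
    show "inj_on \<theta> (carrier ?T)"
    proof (rule inj_onI)
      fix s t assume st: "s \<in> carrier ?T" "t \<in> carrier ?T" "\<theta> s = \<theta> t"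
      obtain u e d h v e' d' h' where eqs: "s = ((u, e, d), h)" "t = ((v, e', d'), h')"
        by (cases s; cases t) auto
      have "u \<noteq> p * x" "v \<noteq> p * x" for x
        using odd_U [of u] odd_U [of v] st(1,2) even_p unfolding T eqs by auto
      moreover have "h = 0 \<or> h = 1" "h' = 0 \<or> h' = 1"
        using st(1,2) two unfolding T eqs by simp_all
      ultimately show "s = t"
        using st(3) p_pos unfolding eqs \<theta>_def by (auto split: if_splits)
    qed
    show "matrix ` carrier (AutoGroup G) = \<theta> ` carrier ?T"
    proof
      show "matrix ` carrier (AutoGroup G) \<subseteq> \<theta> ` carrier ?T"
      proof (rule image_subsetI)
        fix f assume "f \<in> carrier (AutoGroup G)"
        then have f: "f \<in> auto G"
          by (simp add: carrier_AutoGroup)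
        obtain i j k i' j' k' where fE: "f gen_a = E (i, j, k)" "f gen_b = E (i', j', k')"
          using f by (rule auto_images)
        note M = auto_matrix [OF f fE]
        define D where "D = i * j' - j * i'"
        have D: "odd D" "q dvd i * (D - 1)" "q dvd j * (D + 1)" "q dvd i' * (D + 1)" "q dvd j' * (D - 1)"
          using M by (simp_all add: D_def)
        show "matrix f \<in> \<theta> ` carrier ?T"
        proof (cases "odd i")
          case True
          have D1: "q dvd D - 1"
            using D(2) coprime_two_power_odd(2) [OF True] by (simp add: coprime_dvd_mult_right_iff)
          have "p dvd x" if "q dvd x * (D + 1)" for x
          proof -
            have "x * (D + 1) = x * (D - 1) + 2 * x"
              by (simp add: algebra_simps)
            then have "q dvd 2 * x"
              using that D1 by (metis dvd_add_right_iff dvd_mult)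
            then show ?thesis
              by (simp add: p)
          qed
          then have "p dvd j" "p dvd i'"
            using D by simp_all
          then obtain d e where d: "d \<in> {0..<2}" "j mod q = p * d" and e: "e \<in> {0..<2}" "i' mod q = p * e"
            using half by metis
          have "q dvd j * i'"
          proof -
            obtain x y where "j = p * x" "i' = p * y"
              using \<open>p dvd j\<close> \<open>p dvd i'\<close> by (auto elim!: dvdE)
            then show ?thesis
              using pp [of 0 "x * y"] by (simp add: mod_eq_0_iff_dvd ac_simps)
          qed
          moreover have "i * j' - 1 = (D - 1) + j * i'"
            by (simp add: D_def)
          ultimately have "q dvd i * j' - 1"
            using D1 by (metis dvd_add)
          then have "i * j' mod q = 1 mod q"
            by (simp only: mod_eq_dvd_iff)
          then have inv: "(i mod q) * (j' mod q) mod q = 1"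
            using q_gt_1 by (simp add: mod_mult_eq)
          have "odd j'"
            using D(1) True \<open>p dvd j\<close> even_p unfolding D_def by (auto elim!: dvdE)
          then have "inv\<^bsub>?U\<^esub> (i mod q) = j' mod q"
            using inv unit True by (intro inv_U_eq)
          then have "matrix f = \<theta> ((i mod q, e, d), 0)"
            by (simp add: matrix_eq [OF fE] \<theta>_def d e)
          moreover have "((i mod q, e, d), 0) \<in> carrier ?T"
            unfolding T using unit [OF True] d(1) e(1) two_range(1) by blast
          ultimately show ?thesis
            by (rule image_eqI)
        next
          case False
          then have ji': "odd j" "odd i'"
            using D(1) unfolding D_def by auto
          have D1: "q dvd D + 1"
            using D(3) coprime_two_power_odd(2) [OF ji'(1)] by (simp add: coprime_dvd_mult_right_iff)
          have "p dvd x" if "q dvd x * (D - 1)" for x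
          proof -
            have "x * (D - 1) + 2 * x = x * (D + 1)"
              by (simp add: algebra_simps)
            then have "q dvd 2 * x"
              using that D1 by (metis dvd_add_right_iff dvd_mult)
            then show ?thesis
              by (simp add: p)
          qed
          then have "p dvd i" "p dvd j'"
            using D by simp_all
          then obtain d e where d: "d \<in> {0..<2}" "j' mod q = p * d" and e: "e \<in> {0..<2}" "i mod q = p * e"
            using half by metis
          have "q dvd i * j'"
          proof -
            obtain x y where "i = p * x" "j' = p * y"
              using \<open>p dvd i\<close> \<open>p dvd j'\<close> by (auto elim!: dvdE)
            then show ?thesis
              using pp [of 0 "x * y"] by (simp add: mod_eq_0_iff_dvd ac_simps)
          qed
          moreover have "i' * j - 1 = i * j' - (D + 1)"
            by (simp add: D_def)
          ultimately have "q dvd i' * j - 1"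
            using D1 by (metis dvd_diff)
          then have "i' * j mod q = 1 mod q"
            by (simp only: mod_eq_dvd_iff)
          then have inv: "(i' mod q) * (j mod q) mod q = 1"
            using q_gt_1 by (simp add: mod_mult_eq)
          then have "inv\<^bsub>?U\<^esub> (i' mod q) = j mod q"
            using unit ji' by (intro inv_U_eq)
          then have "matrix f = \<theta> ((i' mod q, e, d), 1)"
            by (simp add: matrix_eq [OF fE] \<theta>_def d e)
          moreover have "((i' mod q, e, d), 1) \<in> carrier ?T"
            unfolding T using unit [OF ji'(2)] d(1) e(1) two_range(2) by blast
          ultimately show ?thesis
            by (rule image_eqI)
        qed
      qed
      show "\<theta> ` carrier ?T \<subseteq> matrix ` carrier (AutoGroup G)"
      proof (rule image_subsetI)
        fix s assume s: "s \<in> carrier ?T"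
        obtain u e d h where eq: "s = ((u, e, d), h)"
          by (cases s) auto
        have u: "u \<in> carrier ?U" and e: "e \<in> {0..<2}" and d: "d \<in> {0..<2}" and h: "h = 0 \<or> h = 1"
          using s two unfolding T eq by simp_all
        define u' where "u' = inv\<^bsub>?U\<^esub> u"
        have u': "u' \<in> carrier ?U" "q dvd u * u' - 1"
          using inv_U [OF u] q_gt_1 by (simp_all add: u'_def mod_eq_dvd_iff [symmetric])
        have q_dvd_pp: "q dvd p * (p * z)" for z
          using pp [of 0 z] by (simp add: mod_eq_0_iff_dvd)
        define D where "D = u * u' - p * d * (p * e)"
        have D: "q dvd D - 1"
        proof -
          have "D - 1 = (u * u' - 1) - p * (p * (d * e))"
            by (simp add: D_def algebra_simps)
          then show ?thesis
            using u'(2) q_dvd_pp by (metis dvd_diff)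
        qed
        have "odd D"
          using odd_U [OF u] odd_U [OF u'(1)] even_p by (simp add: D_def)
        have D': "q dvd p * z * (D + 1)" for z
        proof -
          have "p * z * (D + 1) = p * z * (D - 1) + q * z"
            by (simp add: p algebra_simps)
          then show ?thesis
            using D by simp
        qed
        have range: "p * z mod q = p * z" if "z \<in> {0..<2}" for z
          using that pmod [of z] by simp
        show "\<theta> s \<in> matrix ` carrier (AutoGroup G)"
          using h
        proof
          assume "h = 0"
          obtain f where "f \<in> auto G" and fE: "f gen_a = E (u, p * d, 0)" "f gen_b = E (p * e, u', 0)"
            by (rule auto_exists [of u u' "p * d" "p * e" 0 0, folded D_def]) (use D D' \<open>odd D\<close> in simp_all)
          then show ?thesis
            by (intro image_eqI [of _ _ f])
              (simp_all add: matrix_eq [OF fE] eq \<theta>_def \<open>h = 0\<close> carrier_AutoGroup range [OF d] range [OF e]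
                mod_U u u'(1) u'_def [symmetric])
        next
          assume "h = 1"
          have neg: "p * e * (p * d) - u' * u = - D"
            by (simp add: D_def algebra_simps)
          have "p * z * (- D - 1) = - (p * z * (D + 1))" "z * (- D + 1) = - (z * (D - 1))" for z
            by (simp_all add: algebra_simps)
          then have dvd: "q dvd p * e * (- D - 1)" "q dvd p * d * (- D - 1)"
            "q dvd u' * (- D + 1)" "q dvd u * (- D + 1)"
            using D D' by (simp_all only: dvd_minus_iff dvd_mult)
          have "odd (- D)"
            using \<open>odd D\<close> by simp
          then obtain f where "f \<in> auto G" and fE: "f gen_a = E (p * e, u', 0)" "f gen_b = E (u, p * d, 0)"
            by (rule auto_exists [of "p * e" "p * d" u' u 0 0, unfolded neg, OF _ dvd(1,3,4,2)])
          then show ?thesis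
            by (intro image_eqI [of _ _ f])
              (simp_all add: matrix_eq [OF fE] eq \<theta>_def \<open>h = 1\<close> carrier_AutoGroup range [OF d] range [OF e]
                mod_U u u'(1) u'_def [symmetric])
        qed
      qed
    qed
    show "\<one>\<^bsub>?T\<^esub> \<in> carrier ?T"
      unfolding T using U.one_closed by (simp add: semidirect_product_def)
    show "matrix \<one>\<^bsub>AutoGroup G\<^esub> = \<theta> \<one>\<^bsub>?T\<^esub>"
      using U.inv_one q_gt_1 by (simp add: matrix_one \<theta>_def semidirect_product_def U(3))
    fix f g s t
    assume fg: "f \<in> carrier (AutoGroup G)" "g \<in> carrier (AutoGroup G)"
      and s: "s \<in> carrier ?T" and t: "t \<in> carrier ?T"
      and st: "matrix f = \<theta> s" "matrix g = \<theta> t"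
    have f: "f \<in> auto G" and g: "g \<in> auto G"
      using fg by (simp_all add: carrier_AutoGroup)
    obtain u e d h v e' d' h' where eqs: "s = ((u, e, d), h)" "t = ((v, e', d'), h')"
      by (cases s; cases t) auto
    have u: "u \<in> carrier ?U" and v: "v \<in> carrier ?U" and h: "h = 0 \<or> h = 1" "h' = 0 \<or> h' = 1"
      using s t two unfolding T eqs by simp_all
    define u' v' where "u' = inv\<^bsub>?U\<^esub> u" and "v' = inv\<^bsub>?U\<^esub> v"
    have u': "u' \<in> carrier ?U" and v': "v' \<in> carrier ?U"
      using inv_U(1) u v by (simp_all add: u'_def v'_def)
    note odd = odd_U [OF u] odd_U [OF u'] odd_U [OF v] odd_U [OF v']
    have inv: "inv\<^bsub>?U\<^esub> (u * v mod q) = u' * v' mod q" "inv\<^bsub>?U\<^esub> (u * v' mod q) = u' * v mod q"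
      using mult_U(2) [OF u v] mult_U(2) [OF u v'] U.inv_inv [OF v] by (simp_all add: u'_def v'_def)
    have closed: "s \<otimes>\<^bsub>?T\<^esub> t \<in> carrier ?T"
      using mult_U(1) [OF u v] mult_U(1) [OF u v'] unfolding T eqs T_mult
      by (simp add: v'_def)
    have diag: "(x * y + p * z * (p * w)) mod q = y * x mod q"
      "(p * z * (p * w) + x * y) mod q = y * x mod q" for x y z w
      using pp [of "x * y" "z * w"] by (simp_all add: ac_simps)
    have off': "(w * (p * x) + p * y * z) mod q = p * ((x + y) mod 2)"
      "(w * (p * x) + p * y * z) mod q = p * ((y + x) mod 2)"
      "(p * y * z + w * (p * x)) mod q = p * ((x + y) mod 2)"
      "(p * y * z + w * (p * x)) mod q = p * ((y + x) mod 2)" if "odd w" "odd z" for x y w z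
      using off [OF that, of x y] by (simp_all add: ac_simps)
    have "matrix (f \<otimes>\<^bsub>AutoGroup G\<^esub> g) = \<theta> (s \<otimes>\<^bsub>?T\<^esub> t)"
    proof (cases "h = 0"; cases "h' = 0")
      assume hh: "h = 0" "h' = 0"
      have "matrix f = ((u, p * d), (p * e, u'))" "matrix g = ((v, p * d'), (p * e', v'))"
        using st hh by (simp_all add: eqs \<theta>_def u'_def v'_def)
      from matrix_mult [OF f g this] show ?thesis
        by (simp add: eqs T_mult \<theta>_def hh inv diag off' odd)
    next
      assume hh: "h = 0" "h' \<noteq> 0"
      have "matrix f = ((u, p * d), (p * e, u'))" "matrix g = ((p * e', v'), (v, p * d'))"
        using st hh by (simp_all add: eqs \<theta>_def u'_def v'_def)
      from matrix_mult [OF f g this] show ?thesis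
        using hh h by (simp add: eqs T_mult \<theta>_def inv diag off' odd)
    next
      assume hh: "h \<noteq> 0" "h' = 0"
      have "matrix f = ((p * e, u'), (u, p * d))" "matrix g = ((v, p * d'), (p * e', v'))"
        using st hh by (simp_all add: eqs \<theta>_def u'_def v'_def)
      from matrix_mult [OF f g this] show ?thesis
        using hh h by (simp add: eqs T_mult \<theta>_def inv diag off' odd flip: v'_def)
    next
      assume hh: "h \<noteq> 0" "h' \<noteq> 0"
      have "matrix f = ((p * e, u'), (u, p * d))" "matrix g = ((p * e', v'), (v, p * d'))"
        using st hh by (simp_all add: eqs \<theta>_def u'_def v'_def)
      from matrix_mult [OF f g this] show ?thesis
        using hh h by (simp add: eqs T_mult \<theta>_def inv diag off' odd flip: v'_def)
    qed
    with closed show "s \<otimes>\<^bsub>?T\<^esub> t \<in> carrier ?T \<and> matrix (f \<otimes>\<^bsub>AutoGroup G\<^esub> g) = \<theta> (s \<otimes>\<^bsub>?T\<^esub> t)" ..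
  qed
  show ?thesis
    unfolding Aut_2_eq_matrix_kernel by (rule A.quotient_iso)
qed

end

subsection \<open>The case \<open>m = 2\<close>\<close>

definition int_of_bit :: "bit \<Rightarrow> int" where
  "int_of_bit x = (if x = 1 then 1 else 0)"

lemma int_of_bit_simps [simp]: "int_of_bit 0 = 0" "int_of_bit 1 = 1"
  by (simp_all add: int_of_bit_def)

lemma inj_int_of_bit: "int_of_bit x = int_of_bit y \<longleftrightarrow> x = y"
  by (cases "x = 0"; cases "y = 0") simp_all

lemma int_of_bit_add_mult:
  "int_of_bit (x * y + z * w) = (int_of_bit x * int_of_bit y + int_of_bit z * int_of_bit w) mod 2"
  by (cases "x = 0"; cases "y = 0"; cases "z = 0"; cases "w = 0") simp_all

lemma mod_2_eq_int_of_bit: "i mod 2 = int_of_bit (of_bool (odd i))" for i :: int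
  by (simp add: mod2_eq_if)

lemma invertible_bit_iff:
  fixes A :: "bit ^ 2 ^ 2"
  shows "invertible A \<longleftrightarrow> odd (int_of_bit (A $ 1 $ 1) * int_of_bit (A $ 2 $ 2)
    - int_of_bit (A $ 2 $ 1) * int_of_bit (A $ 1 $ 2))"
  unfolding invertible_det_nz det_2
  by (cases "A $ 1 $ 1 = 0"; cases "A $ 1 $ 2 = 0"; cases "A $ 2 $ 1 = 0"; cases "A $ 2 $ 2 = 0") simp_all

context K_coordinates
begin

text \<open>For \<open>q = 2\<close> the congruences for the matrix hold as soon as the determinant is odd.\<close>

lemma Aut_quotient_iso_GL2:
  assumes "m = 2"
  shows "AutoGroup G Mod Aut_i 2 G \<cong> GL2_F2"
proof -
  have q: "q = 2"
    unfolding q_def unfolding assms by simp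
  define \<theta> where "\<theta> A = ((int_of_bit (A $ 1 $ 1), int_of_bit (A $ 2 $ 1)),
      (int_of_bit (A $ 1 $ 2), int_of_bit (A $ 2 $ 2)))" for A :: "bit ^ 2 ^ 2"
  interpret A: parametrized_image "AutoGroup G" GL2_F2 matrix \<theta>
  proof (intro parametrized_image.intro parametrized_image_axioms.intro)
    show "group (AutoGroup G)"
      by (rule AutoGroup)
    show "inj_on \<theta> (carrier GL2_F2)"
      by (rule inj_onI) (simp add: \<theta>_def inj_int_of_bit vec_eq_iff forall_2)
    show "matrix ` carrier (AutoGroup G) = \<theta> ` carrier GL2_F2"
    proof
      show "matrix ` carrier (AutoGroup G) \<subseteq> \<theta> ` carrier GL2_F2"
      proof (rule image_subsetI)
        fix f assume "f \<in> carrier (AutoGroup G)"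
        then have f: "f \<in> auto G"
          by (simp add: carrier_AutoGroup)
        obtain i j k i' j' k' where fE: "f gen_a = E (i, j, k)" "f gen_b = E (i', j', k')"
          using f by (rule auto_images)
        define A :: "bit ^ 2 ^ 2" where
          "A = vector [vector [of_bool (odd i), of_bool (odd i')], vector [of_bool (odd j), of_bool (odd j')]]"
        have "matrix f = \<theta> A"
          unfolding matrix_eq [OF fE] q mod_2_eq_int_of_bit by (simp add: \<theta>_def A_def)
        moreover have "invertible A"
          using auto_matrix(1) [OF f fE] unfolding invertible_bit_iff by (auto simp: A_def)
        ultimately show "matrix f \<in> \<theta> ` carrier GL2_F2"
          by (simp add: GL2_F2_def)
      qed
      show "\<theta> ` carrier GL2_F2 \<subseteq> matrix ` carrier (AutoGroup G)"
      proof (rule image_subsetI)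
        fix A assume A: "A \<in> carrier GL2_F2"
        define D where "D = int_of_bit (A $ 1 $ 1) * int_of_bit (A $ 2 $ 2)
            - int_of_bit (A $ 2 $ 1) * int_of_bit (A $ 1 $ 2)"
        have "odd D"
          using A by (simp only: D_def GL2_F2_def invertible_bit_iff partial_object.select_convs mem_Collect_eq
              not_False_eq_True)
        then have "q dvd x * (D - 1)" "q dvd x * (D + 1)" for x
          by (simp_all add: q)
        then obtain f where "f \<in> auto G"
          and fE: "f gen_a = E (int_of_bit (A $ 1 $ 1), int_of_bit (A $ 2 $ 1), 0)"
            "f gen_b = E (int_of_bit (A $ 1 $ 2), int_of_bit (A $ 2 $ 2), 0)"
          using \<open>odd D\<close> auto_exists [of "int_of_bit (A $ 1 $ 1)" "int_of_bit (A $ 2 $ 2)"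
              "int_of_bit (A $ 2 $ 1)" "int_of_bit (A $ 1 $ 2)" 0 0, folded D_def] by blast
        moreover have "int_of_bit x mod 2 = int_of_bit x" for x
          by (simp add: int_of_bit_def)
        ultimately show "\<theta> A \<in> matrix ` carrier (AutoGroup G)"
          by (intro image_eqI [of _ _ f]) (simp_all add: matrix_eq [OF fE] \<theta>_def q carrier_AutoGroup)
      qed
    qed
    show "\<one>\<^bsub>GL2_F2\<^esub> \<in> carrier GL2_F2"
      by (simp add: GL2_F2_def invertible_det_nz)
    show "matrix \<one>\<^bsub>AutoGroup G\<^esub> = \<theta> \<one>\<^bsub>GL2_F2\<^esub>"
      by (simp add: matrix_one \<theta>_def GL2_F2_def q mat_def)
    fix f g A B
    assume "f \<in> carrier (AutoGroup G)" "g \<in> carrier (AutoGroup G)"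
      and AB: "A \<in> carrier GL2_F2" "B \<in> carrier GL2_F2" "matrix f = \<theta> A" "matrix g = \<theta> B"
    then have "f \<in> auto G" "g \<in> auto G"
      by (simp_all add: carrier_AutoGroup)
    note fg = this
    have entry: "(A ** B) $ i $ j = A $ i $ 1 * B $ 1 $ j + A $ i $ 2 * B $ 2 $ j" for i j
      unfolding matrix_matrix_mult_def by (simp only: vec_lambda_beta sum_2)
    have "matrix (f \<otimes>\<^bsub>AutoGroup G\<^esub> g) = \<theta> (A ** B)"
      unfolding matrix_mult [OF fg AB(3,4) [unfolded \<theta>_def]] \<theta>_def entry int_of_bit_add_mult q
      by (simp only: mult.commute)
    moreover have "invertible (A ** B)"
      using AB(1,2) by (simp add: GL2_F2_def invertible_mult)
    ultimately show "A \<otimes>\<^bsub>GL2_F2\<^esub> B \<in> carrier GL2_F2 \<and>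
        matrix (f \<otimes>\<^bsub>AutoGroup G\<^esub> g) = \<theta> (A \<otimes>\<^bsub>GL2_F2\<^esub> B)"
      by (simp add: GL2_F2_def)
  qed
  show ?thesis
    unfolding Aut_2_eq_matrix_kernel by (rule A.quotient_iso)
qed

end

section \<open>The structure of \<open>Aut(K)\<close>\<close>

theorem theorem5p15:
  fixes m :: nat and l :: int
  assumes "m > 1" and "odd l"
  shows "let K = K_group m l in
      Aut_i 1 K \<lhd> AutoGroup K
    \<and> Aut_i 2 K \<lhd> AutoGroup K
    \<and> Aut_i 1 K \<subseteq> Aut_i 2 K
    \<and> (AutoGroup K)\<lparr>carrier := Aut_i 1 K\<rparr>
        \<cong> Zmod (2 ^ (m - 1)) \<times>\<times> Zmod (2 ^ (m - 1)) \<times>\<times> Zmod (2 ^ (m - 1)) \<times>\<times> Zmod (2 ^ (m - 1))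
    \<and> (AutoGroup K)\<lparr>carrier := Aut_i 2 K\<rparr> Mod Aut_i 1 K
        \<cong> (Zmod (2 ^ (m - 1)) \<times>\<times> Zmod (2 ^ (m - 1))) \<times>\<times> (Zmod 2 \<times>\<times> Zmod 2 \<times>\<times> Zmod 2 \<times>\<times> Zmod 2)
    \<and> (m > 2 \<longrightarrow>
        AutoGroup K Mod Aut_i 2 K
        \<cong> semidirect_product (Zmod_units (2 ^ (m - 1)) \<times>\<times> (Zmod 2 \<times>\<times> Zmod 2)) (Zmod 2)
             (inv_swap (2 ^ (m - 1))))
    \<and> (m = 2 \<longrightarrow> AutoGroup K Mod Aut_i 2 K \<cong> GL2_F2)"
proof -
  interpret K_parameters m l
    using assms by unfold_locales
  obtain E where "K_coordinates (K_group m l) m l E"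
    by (rule K_group_coordinates)
  then interpret K: K_coordinates "K_group m l" m l E .
  have n: "int (2 ^ (m - 1)) = q"
    by (simp add: q_def)
  show ?thesis
    unfolding Let_def
    by (intro conjI impI K.Aut_1_normal K.Aut_2_normal K.Aut_1_subset_Aut_2 K.Aut_1_iso [OF n]
        K.Aut_2_quotient_iso [OF n] K.Aut_quotient_iso [OF n] K.Aut_quotient_iso_GL2)
qed

end
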